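(* Consider the Markov decision process, the recursive discounted utility $U(x,\pi)$ and the operators $T$, $T_f$ described in the context. Suppose that Assumptions (A), (B) and (W) hold. Then: (a) the Bellman equation $Tv=v$ has a unique solution $v^*\in\mathcal M^d_b(X)$, and $$\lim_{m\to\infty}\|T^{(m)}\mathbf 0-v^*\|_\omega=0\quad\text{and}\quad v^*(x)=\sup_{\pi\in\Pi}U(x,\pi),\ x\in X;$$ (b) there exists $f^*\in F$ such that $T_{f^*}v^*=v^*$, and $f^*$ is an optimal stationary policy, i.e. $U(x,f^* )\ge U(x,\pi)$ for all $\pi\in\Pi$ and $x\in X$; (c) $v^*\in\mathcal U^d_b(X)$. Moreover, (a) and (b) remain valid if Assumptions (A), (B) and (S) hold (instead of (A), (B), (W)).
   Context: Notation. $\underline{\mathbb R}=\mathbb R\cup\{-\infty\}$, $\mathbb R_+=[0,\infty)$, $\mathbb N=\{1,2,\dots\}$. A Borel space is a non-empty Borel subset of a complete separable metric space. For a Borel space $Y$, $\mathcal M(Y)$ is the set of Borel measurable functions $g:Y\to\underline{\mathbb R}$ and $\mathcal U(Y)$ is the set of upper semicontinuous functions on $Y$ (with values in $\underline{\mathbb R}$). $\mathbf 0$ is the zero function. Markov decision process. $X$ (state space) and $A$ (action space) are Borel spaces; $D\subset X\times A$ is a non-empty Borel set such that $A(x)=\{a\in A:(x,a)\in D\}$ is non-empty for each $x\in X$; $q$ is a transition probability from $D$ to $X$; $u\in\mathcal M(D)$ is the one-period utility; $\delta:\underline{\mathbb R}\to\underline{\mathbb R}$ is the discount function. $H_1=X$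 and $H_{n+1}=D^n\times X$; elements are $h_n=(x_1,a_1,\dots,a_{n-1},x_n)$. A policy $\pi=(\pi_n)_{n\ge1}$ is a sequence of Borel measurable maps $\pi_n:H_n\to A$ with $\pi_n(h_n)\in A(x_n)$; $\Pi$ is the set of all policies. $F$ is the set of Borel measurable $f:X\to A$ with $f(x)\in A(x)$ for all $x$; $f\in F$ is identified with the stationary policy $(f,f,\dots)$. Weight function and function spaces. $\omega:X\to[1,\infty)$ is a fixed Borel measurable function. $\mathcal M^a_b(X)$ is the set of $v\in\mathcal M(X)$ with $v/\omega$ bounded from above; $\mathcal M^d_b(X)$ is the set of $v\in\mathcal M(X)$ with $|v|/\omega$ bounded, with norm $\|v\|_\omega=\sup_{x\in X}|v(x)|/\omega(x)$. $\mathcal U^d_b(X)=\mathcal M^d_b(X)\cap\mathcal U(X)$. Recursive discounted utility. For $\pi\in\Pi$ and $v\in\mathcal M(H_{k+1})$ (whenever well defined), $$T_{\pi_k}v(h_k)=u(x_k,\pi_k(h_k))+\int_X\delta\big(v(h_k,\pi_k(h_k),x_{k+1})\big)\,q(dx_{k+1}|x_k,\pi_k(h_k)).$$ $U_n(x,\pi)=T_{\pi_1}T_{\pi_2}\cdots T_{\pi_n}\mathbf 0(x)$ and $U(x,\pi)=\lim_{n\to\infty}U_n(x,\pi)$ (under the assumptions here this limit exists). Dynamic programming operators. For $v\in\mathcal M^a_b(X)$ and $f\in F$: $Tv(x)=\sup_{a\in A(x)}\left[u(x,a)+\int_X\delta(v(y))q(dy|x,a)\right]$ and $T_fv(x)=u(x,f(x))+\int_X\delta(v(y))q(dy|x,f(x))$.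 $T^{(m)}$ is the $m$-fold composition of $T$. Assumptions (A): (A2.1) there is $b>0$ with $u(x,a)\ge-b\omega(x)$ for all $(x,a)\in D$; (A2.2) there is $c>0$ with $u(x,a)\le c\omega(x)$ for all $(x,a)\in D$. Assumptions (B): (B2.1) there is an increasing function $\gamma:\mathbb R_+\to\mathbb R_+$ with $\gamma(z)<z$ for every $z>0$ and $|\delta(z_1)-\delta(z_2)|\le\gamma(|z_1-z_2|)$ for all $z_1,z_2\in\mathbb R$; (B2.2) $\delta$ is increasing, $\delta(0)=0$, $\delta(-\infty)=-\infty$; (B2.3) (i) $\gamma(y+z)\le\gamma(y)+\gamma(z)$ for all $y,z\ge0$, and (ii) $\gamma(\omega(x)y)\le\omega(x)\gamma(y)$ for all $x\in X$, $y>0$; (B2.4) there is a constant $\alpha$ with $\int_X\omega(y)q(dy|x,a)\le\alpha\omega(x)$ for all $(x,a)\in D$, and either $\alpha\le1$, or $\alpha>1$ and $\alpha\gamma(z)<z$ for all $z\in(0,\infty)$. Assumptions (W): (W2.1) $A(x)$ is compact for every $x$ and $x\mapsto A(x)$ is upper semicontinuous, i.e. $\{x\in X:A(x)\cap K\ne\emptyset\}$ is closed for each closed $K\subset A$; (W2.2) $u$ is upper semicontinuous on $D$; (W2.3) $(x,a)\mapsto\int_X\phi(y)q(dy|x,a)$ is continuous on $D$ for each bounded continuous $\phi$; (W2.4) $\omega$ is continuous on $X$; (W2.5) $(x,a)\mapsto\int_X\omega(y)q(dy|x,a)$ is continuous on $D$. Assumptions (S): (S2.1) $A(x)$ is compact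 for every $x$; (S2.2) $u(x,\cdot)$ is upper semicontinuous on $A(x)$ for every $x$; (S2.3) for each $x\in X$ and Borel $\widetilde X\subset X$, $q(\widetilde X|x,\cdot)$ is continuous on $A(x)$; (S2.4) $a\mapsto\int_X\omega(y)q(dy|x,a)$ is continuous on $A(x)$ for every $x$. *)

theory Defs
  imports "HOL-Probability.Probability"
begin

text \<open>
  Every Borel space is a Borel subset of a type of class \<^class>\<open>polish_space\<close> (a complete
  separable metric space), with the relative topology and the trace of the Borel sets. Functions on
  such a set are total functions whose values outside the set are irrelevant; in particular
  equations between them are required only on the set. The range of the reals extended by minus
  infinity is \<open>{..<\<infinity>}\<close> in \<^typ>\<open>ereal\<close>.
\<close>

abbreviation borel_on :: "'b::topological_space set \<Rightarrow> 'b measure" where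
  "borel_on Y \<equiv> restrict_space borel Y"

definition measurable_funs :: "'b::topological_space set \<Rightarrow> ('b \<Rightarrow> ereal) set" where
  "measurable_funs Y = {g \<in> borel_measurable (borel_on Y). \<forall>y\<in>Y. g y < \<infinity>}"

definition usc_on :: "'b::topological_space set \<Rightarrow> ('b \<Rightarrow> ereal) \<Rightarrow> bool" where
  "usc_on Y g \<longleftrightarrow> (\<forall>y\<in>Y. Limsup (at y within Y) g \<le> g y)"

definition usc_funs :: "'b::topological_space set \<Rightarrow> ('b \<Rightarrow> ereal) set" where
  "usc_funs Y = {g. usc_on Y g \<and> (\<forall>y\<in>Y. g y < \<infinity>)}"

text \<open>
  Integral of an extended real function as the integral of its positive part minus that of its
  negative part (\<^const>\<open>e2ennreal\<close> sends negative numbers to 0). It is meaningful whenever one of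
  the two is finite. This is the case for all integrands below, since the positive part is
  dominated by a multiple of the weight function.
\<close>
definition ereal_integral :: "'b measure \<Rightarrow> ('b \<Rightarrow> ereal) \<Rightarrow> ereal" where
  "ereal_integral N f =
     enn2ereal (\<integral>\<^sup>+ y. e2ennreal (f y) \<partial>N) - enn2ereal (\<integral>\<^sup>+ y. e2ennreal (- f y) \<partial>N)"

record ('x, 'a) mdp =
  states :: "'x set"
  actions :: "'a set"
  constr :: "('x \<times> 'a) set"
  kernel :: "'x \<times> 'a \<Rightarrow> 'x measure"
  utility :: "'x \<times> 'a \<Rightarrow> ereal"
  discount :: "ereal \<Rightarrow> ereal"
  weight :: "'x \<Rightarrow> real"

definition admissible :: "('x, 'a) mdp \<Rightarrow> 'x \<Rightarrow> 'a set" where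
  "admissible M x = {a \<in> actions M. (x, a) \<in> constr M}"

definition markov_decision_process :: "('x::polish_space, 'a::polish_space) mdp \<Rightarrow> bool" where
  "markov_decision_process M \<longleftrightarrow>
     states M \<in> sets borel \<and> states M \<noteq> {} \<and>
     actions M \<in> sets borel \<and> actions M \<noteq> {} \<and>
     constr M \<in> sets borel \<and> constr M \<noteq> {} \<and> constr M \<subseteq> states M \<times> actions M \<and>
     (\<forall>x\<in>states M. admissible M x \<noteq> {}) \<and>
     kernel M \<in> borel_on (constr M) \<rightarrow>\<^sub>M prob_algebra (borel_on (states M)) \<and>
     utility M \<in> measurable_funs (constr M) \<and>
     discount M \<in> {..<\<infinity>} \<rightarrow> {..<\<infinity>} \<and>
     weight M \<in> borel_measurable (borel_on (states M)) \<and> (\<forall>x\<in>states M. 1 \<le> weight M x)"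

text \<open>
  A history \<open>(x\<^sub>1, a\<^sub>1, \<dots>, x\<^sub>n\<^sub>-\<^sub>1, a\<^sub>n\<^sub>-\<^sub>1, x\<^sub>n)\<close> is the pair \<open>(d, x\<^sub>n)\<close> where \<open>d i = (x\<^sub>i, a\<^sub>i)\<close> for
  \<open>1 \<le> i < n\<close> and \<open>d i\<close> is \<^const>\<open>undefined\<close> for all other \<open>i\<close>. Stages are numbered from 1, so
  \<open>\<pi> 0\<close> plays no role in a policy \<open>\<pi>\<close>.
\<close>
type_synonym ('x, 'a) history = "(nat \<Rightarrow> 'x \<times> 'a) \<times> 'x"

definition history_space ::
    "('x::polish_space, 'a::polish_space) mdp \<Rightarrow> nat \<Rightarrow> ('x, 'a) history measure" where
  "history_space M n = (\<Pi>\<^sub>M i\<in>{1..<n}. borel_on (constr M)) \<Otimes>\<^sub>M borel_on (states M)"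

definition policies ::
    "('x::polish_space, 'a::polish_space) mdp \<Rightarrow> (nat \<Rightarrow> ('x, 'a) history \<Rightarrow> 'a) set" where
  "policies M = {\<pi>. \<forall>n\<ge>1. \<pi> n \<in> history_space M n \<rightarrow>\<^sub>M borel_on (actions M) \<and>
     (\<forall>(d, x)\<in>space (history_space M n). \<pi> n (d, x) \<in> admissible M x)}"

definition decision_rules :: "('x::polish_space, 'a::polish_space) mdp \<Rightarrow> ('x \<Rightarrow> 'a) set" where
  "decision_rules M = {f \<in> borel_on (states M) \<rightarrow>\<^sub>M borel_on (actions M).
     \<forall>x\<in>states M. f x \<in> admissible M x}"

definition stationary :: "('x \<Rightarrow> 'a) \<Rightarrow> nat \<Rightarrow> ('x, 'a) history \<Rightarrow> 'a" where
  "stationary f = (\<lambda>n (d, x). f x)"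

text \<open>The operator \<open>T\<^bsub>\<pi>\<^sub>k\<^esub>\<close>.\<close>
definition policy_op :: "('x, 'a) mdp \<Rightarrow> (nat \<Rightarrow> ('x, 'a) history \<Rightarrow> 'a) \<Rightarrow> nat \<Rightarrow>
    (('x, 'a) history \<Rightarrow> ereal) \<Rightarrow> ('x, 'a) history \<Rightarrow> ereal" where
  "policy_op M \<pi> k v = (\<lambda>(d, x). let a = \<pi> k (d, x) in
     utility M (x, a) + ereal_integral (kernel M (x, a)) (\<lambda>y. discount M (v (d(k := (x, a)), y))))"

definition finite_utility ::
    "('x, 'a) mdp \<Rightarrow> nat \<Rightarrow> 'x \<Rightarrow> (nat \<Rightarrow> ('x, 'a) history \<Rightarrow> 'a) \<Rightarrow> ereal" where
  "finite_utility M n x \<pi> = foldr (policy_op M \<pi>) [1..<Suc n] (\<lambda>_. 0) (\<lambda>_. undefined, x)"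

definition recursive_utility ::
    "('x, 'a) mdp \<Rightarrow> 'x \<Rightarrow> (nat \<Rightarrow> ('x, 'a) history \<Rightarrow> 'a) \<Rightarrow> ereal" where
  "recursive_utility M x \<pi> = lim (\<lambda>n. finite_utility M n x \<pi>)"

definition optimal_policy ::
    "('x::polish_space, 'a::polish_space) mdp \<Rightarrow> (nat \<Rightarrow> ('x, 'a) history \<Rightarrow> 'a) \<Rightarrow> bool" where
  "optimal_policy M \<sigma> \<longleftrightarrow> \<sigma> \<in> policies M \<and>
     (\<forall>\<pi>\<in>policies M. \<forall>x\<in>states M. recursive_utility M x \<pi> \<le> recursive_utility M x \<sigma>)"

definition decision_op :: "('x, 'a) mdp \<Rightarrow> ('x \<Rightarrow> 'a) \<Rightarrow> ('x \<Rightarrow> ereal) \<Rightarrow> 'x \<Rightarrow> ereal" where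
  "decision_op M f v x =
     utility M (x, f x) + ereal_integral (kernel M (x, f x)) (\<lambda>y. discount M (v y))"

definition bellman_op :: "('x, 'a) mdp \<Rightarrow> ('x \<Rightarrow> ereal) \<Rightarrow> 'x \<Rightarrow> ereal" where
  "bellman_op M v x = (SUP a\<in>admissible M x.
     utility M (x, a) + ereal_integral (kernel M (x, a)) (\<lambda>y. discount M (v y)))"

definition weighted_norm :: "('x, 'a) mdp \<Rightarrow> ('x \<Rightarrow> ereal) \<Rightarrow> ereal" where
  "weighted_norm M v = (SUP x\<in>states M. \<bar>v x\<bar> / ereal (weight M x))"

definition weighted_bounded :: "('x::topological_space, 'a) mdp \<Rightarrow> ('x \<Rightarrow> ereal) set" where
  "weighted_bounded M = {v \<in> measurable_funs (states M). weighted_norm M v < \<infinity>}"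

definition solves_bellman :: "('x::topological_space, 'a) mdp \<Rightarrow> ('x \<Rightarrow> ereal) \<Rightarrow> bool" where
  "solves_bellman M v \<longleftrightarrow> v \<in> weighted_bounded M \<and> (\<forall>x\<in>states M. bellman_op M v x = v x)"

definition assumptions_A :: "('x, 'a) mdp \<Rightarrow> bool" where
  "assumptions_A M \<longleftrightarrow>
     (\<exists>b>0. \<forall>(x, a)\<in>constr M. ereal (- b * weight M x) \<le> utility M (x, a)) \<and>
     (\<exists>c>0. \<forall>(x, a)\<in>constr M. utility M (x, a) \<le> ereal (c * weight M x))"

text \<open>``Increasing'' is understood in the weak sense, for both \<open>\<gamma>\<close> and the discount function.\<close>
definition assumptions_B :: "('x, 'a) mdp \<Rightarrow> bool" where
  "assumptions_B M \<longleftrightarrow> (\<exists>\<gamma> :: real \<Rightarrow> real.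
     \<gamma> \<in> {0..} \<rightarrow> {0..} \<and> mono_on {0..} \<gamma> \<and> (\<forall>z>0. \<gamma> z < z) \<and>
     (\<forall>z1 z2 :: real. \<bar>discount M (ereal z1) - discount M (ereal z2)\<bar> \<le> ereal (\<gamma> \<bar>z1 - z2\<bar>)) \<and>
     mono_on {..<\<infinity>} (discount M) \<and> discount M 0 = 0 \<and> discount M (-\<infinity>) = -\<infinity> \<and>
     (\<forall>y\<ge>0. \<forall>z\<ge>0. \<gamma> (y + z) \<le> \<gamma> y + \<gamma> z) \<and>
     (\<forall>x\<in>states M. \<forall>y>0. \<gamma> (weight M x * y) \<le> weight M x * \<gamma> y) \<and>
     (\<exists>\<alpha> :: real.
        (\<forall>(x, a)\<in>constr M.
           (\<integral>\<^sup>+ y. ennreal (weight M y) \<partial>kernel M (x, a)) \<le> ennreal (\<alpha> * weight M x)) \<and>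
        (\<alpha> \<le> 1 \<or> \<alpha> > 1 \<and> (\<forall>z>0. \<alpha> * \<gamma> z < z))))"

definition assumptions_W :: "('x::polish_space, 'a::polish_space) mdp \<Rightarrow> bool" where
  "assumptions_W M \<longleftrightarrow>
     (\<forall>x\<in>states M. compact (admissible M x)) \<and>
     (\<forall>K. closedin (top_of_set (actions M)) K \<longrightarrow>
        closedin (top_of_set (states M)) {x \<in> states M. admissible M x \<inter> K \<noteq> {}}) \<and>
     usc_on (constr M) (utility M) \<and>
     (\<forall>\<phi> :: 'x \<Rightarrow> real. continuous_on (states M) \<phi> \<and> bounded (\<phi> ` states M) \<longrightarrow>
        continuous_on (constr M) (\<lambda>d. \<integral>y. \<phi> y \<partial>kernel M d)) \<and>
     continuous_on (states M) (weight M) \<and>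
     continuous_on (constr M) (\<lambda>d. \<integral>\<^sup>+ y. ennreal (weight M y) \<partial>kernel M d)"

definition assumptions_S :: "('x::polish_space, 'a::polish_space) mdp \<Rightarrow> bool" where
  "assumptions_S M \<longleftrightarrow> (\<forall>x\<in>states M.
     compact (admissible M x) \<and>
     usc_on (admissible M x) (\<lambda>a. utility M (x, a)) \<and>
     (\<forall>B\<in>sets (borel_on (states M)).
        continuous_on (admissible M x) (\<lambda>a. measure (kernel M (x, a)) B)) \<and>
     continuous_on (admissible M x) (\<lambda>a. \<integral>\<^sup>+ y. ennreal (weight M y) \<partial>kernel M (x, a)))"

end

theory Submission
  imports Defs
begin

text \<open>
  By (A) and (B) the utility is bounded by a multiple \<open>\<kappa> \<omega>\<close> of the weight function \<open>\<omega>\<close>, and every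
  one-stage operator is a nonlinear contraction in the weighted norm: if \<open>\<bar>v - v'\<bar> \<le> c \<omega>\<close>, then the
  images differ by at most \<open>\<psi>(c) \<omega>\<close>, where \<open>\<psi> = max 1 \<alpha> \<cdot> \<gamma>\<close>. The function \<open>\<psi>\<close> is increasing and
  subadditive with \<open>\<psi>(z) < z\<close> for \<open>z > 0\<close>; hence its iterates tend to 0, and since \<open>\<psi>\<close> has an
  affine upper bound of slope \<open>\<psi>(1) < 1\<close> there is a radius \<open>R\<close> with \<open>\<kappa> + \<psi>(R) \<le> R\<close>. All operators map the weighted ball
  of radius \<open>R\<close> into itself, so that everything takes place among real-valued functions, value
  iteration from 0 is a Cauchy sequence with rate \<open>\<psi>\<^sup>n(R)\<close>, and its limit is the unique fixed point.
  The utilities of a policy over finite horizons converge for the same reason. They are bounded by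
  the iterates of value iteration, with equality in the limit for the stationary policy of a rule
  that attains the maximum in the Bellman equation.

  What remains is to show that the Bellman operator preserves measurability and that maximizing
  decision rules exist. Both follow from a theorem of descriptive set theory, which covers (W) and (S) at once: a Borel function on a Borel set with
  compact sections, upper semicontinuous on each section, has a Borel measurable maximizer
  (\<open>measurable_maximizer\<close>). It rests on the theorem that the projection of a Borel set with compact
  sections is Borel (\<open>borel_projection_compact_sections\<close>), which is derived from the Kunugui--Novikov
  theorem on Borel sets with closed sections (\<open>borel_closed_sections\<close>). The latter is proved by a
  separation argument in the style of Lusin and Novikov.

  The maximizer theorem needs the function \<open>a \<mapsto> u(x,a) + \<integral>\<delta>(v) dq(\<cdot>|x,a)\<close> to be upper
  semicontinuous. For the integral this is a Fatou argument: \<open>C \<omega> - \<delta>(v)\<close> is nonnegative and is a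
  limit from below of functions with continuous integrals (\<open>usc_integral\<close>), namely bounded Lipschitz
  functions under (W) and simple functions under (S). Under (W) the Bellman operator also preserves
  upper semicontinuity, by the closed graph argument of Berge (\<open>usc_on_real_bellman_W\<close>).
\<close>

section \<open>Borel sets with closed sections\<close>

text \<open>
  A set is analytic if it is the projection of a closed set along a Polish space. The second factor
  is the space of real sequences; its completeness is used in \<open>borel_closed_sections\<close>.
\<close>
definition analytic :: "'z::metric_space set \<Rightarrow> bool" where
  "analytic S \<longleftrightarrow> (\<exists>F :: ('z \<times> (nat \<Rightarrow> real)) set. closed F \<and> S = fst ` F)"

lemma analytic_closed:
  assumes "closed S"
  shows "analytic S"
proof -
  have "closed (S \<times> (UNIV :: (nat \<Rightarrow> real) set))"
    using assms by (intro closed_Times) auto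
  moreover have "S = fst ` (S \<times> (UNIV :: (nat \<Rightarrow> real) set))"
    by auto
  ultimately show ?thesis
    unfolding analytic_def by blast
qed

text \<open>
  The index of the member of the union is encoded as the first entry of a sequence. So as to obtain
  a closed set, this entry may be any nonnegative real \<open>t\<close>, with the condition that the tail belongs
  to \<open>F n\<close> for each \<open>n\<close> at distance less than 1 from \<open>t\<close>. There is always such an \<open>n\<close>, and only one
  if \<open>t\<close> is an integer.
\<close>
lemma analytic_UN:
  fixes S :: "nat \<Rightarrow> 'z::metric_space set"
  assumes "\<And>n. analytic (S n)"
  shows "analytic (\<Union>n. S n)"
proof -
  obtain F :: "nat \<Rightarrow> ('z \<times> (nat \<Rightarrow> real)) set" where F: "\<And>n. closed (F n)" "\<And>n. S n = fst ` F n"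
    using assms unfolding analytic_def by metis
  define shift where "shift = (\<lambda>p :: 'z \<times> (nat \<Rightarrow> real). (fst p, \<lambda>k. snd p (Suc k)))"
  have cont_coord: "continuous_on UNIV (\<lambda>p :: 'z \<times> (nat \<Rightarrow> real). snd p k)" for k
    by (rule continuous_on_compose2[OF continuous_on_product_coordinates continuous_on_snd[OF continuous_on_id]]) auto
  have cont_shift: "continuous_on UNIV shift"
    unfolding shift_def
    by (intro continuous_on_Pair continuous_on_coordinatewise_then_product cont_coord continuous_on_fst continuous_on_id)
  define G where "G = {p. 0 \<le> snd p 0} \<inter> (\<Inter>n. {p. 1 \<le> \<bar>snd p 0 - real n\<bar>} \<union> shift -` F n)"
  have "closed G"
    unfolding G_def
    by (intro closed_Int closed_INT ballI closed_Un closed_Collect_le continuous_intros cont_coord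
        closed_vimage F cont_shift)
  moreover have "(\<Union>n. S n) = fst ` G"
  proof (intro equalityI subsetI)
    fix x assume "x \<in> (\<Union>n. S n)"
    then obtain n y where y: "(x, y) \<in> F n"
      using F(2) by force
    define y' where "y' = (\<lambda>k. case k of 0 \<Rightarrow> real n | Suc k \<Rightarrow> y k)"
    have "1 \<le> \<bar>real n - real m\<bar> \<or> shift (x, y') \<in> F m" for m
    proof (cases "m = n")
      case True
      then show ?thesis using y by (simp add: shift_def y'_def)
    qed (auto simp: abs_real_def)
    then have "(x, y') \<in> G"
      by (auto simp: G_def y'_def)
    then show "x \<in> fst ` G" by force
  next
    fix x assume "x \<in> fst ` G"
    then obtain y where y: "(x, y) \<in> G" by force
    have "\<bar>y 0 - real (nat \<lfloor>y 0\<rfloor>)\<bar> < 1"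
      using y unfolding G_def by (simp; linarith)
    then have "shift (x, y) \<in> F (nat \<lfloor>y 0\<rfloor>)"
      using y unfolding G_def by (auto simp: not_le dest!: spec[of _ "nat \<lfloor>y 0\<rfloor>"])
    then show "x \<in> (\<Union>n. S n)"
      using F(2) by (force simp: shift_def)
  qed
  ultimately show ?thesis
    unfolding analytic_def by blast
qed

lemma analytic_INT:
  fixes S :: "nat \<Rightarrow> 'z::metric_space set"
  assumes "\<And>n. analytic (S n)"
  shows "analytic (\<Inter>n. S n)"
proof -
  obtain F :: "nat \<Rightarrow> ('z \<times> (nat \<Rightarrow> real)) set" where F: "\<And>n. closed (F n)" "\<And>n. S n = fst ` F n"
    using assms unfolding analytic_def by metis
  define slice where "slice = (\<lambda>n (p :: 'z \<times> (nat \<Rightarrow> real)). (fst p, \<lambda>k. snd p (prod_encode (n, k))))"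
  have cont_coord: "continuous_on UNIV (\<lambda>p :: 'z \<times> (nat \<Rightarrow> real). snd p k)" for k
    by (rule continuous_on_compose2[OF continuous_on_product_coordinates continuous_on_snd[OF continuous_on_id]]) auto
  have cont_slice: "continuous_on UNIV (slice n)" for n
    unfolding slice_def
    by (intro continuous_on_Pair continuous_on_coordinatewise_then_product cont_coord continuous_on_fst continuous_on_id)
  define G where "G = (\<Inter>n. slice n -` F n)"
  have "closed G"
    unfolding G_def by (intro closed_INT ballI closed_vimage F cont_slice)
  moreover have "(\<Inter>n. S n) = fst ` G"
  proof (intro equalityI subsetI)
    fix x assume "x \<in> (\<Inter>n. S n)"
    then have "\<forall>n. \<exists>y. (x, y) \<in> F n"
      using F(2) by force
    then obtain y where y: "\<And>n. (x, y n) \<in> F n" by metis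
    have "(x, \<lambda>i. y (fst (prod_decode i)) (snd (prod_decode i))) \<in> G"
      using y by (auto simp: G_def slice_def)
    then show "x \<in> fst ` G" by force
  next
    fix x assume "x \<in> fst ` G"
    then show "x \<in> (\<Inter>n. S n)"
      using F(2) by (force simp: G_def slice_def)
  qed
  ultimately show ?thesis
    unfolding analytic_def by blast
qed

lemma analytic_open:
  fixes S :: "'z::metric_space set"
  assumes "open S"
  shows "analytic S"
proof (cases "S = UNIV")
  case True
  then show ?thesis by (simp add: analytic_closed)
next
  case False
  have "S = (\<Union>n. {x. 1 / real (Suc n) \<le> infdist x (- S)})"
  proof (intro equalityI subsetI)
    fix x assume "x \<in> S"
    then have "infdist x (- S) > 0"
      using assms False in_closed_iff_infdist_zero[of "- S" x] infdist_nonneg[of x "- S"]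
      by (auto simp: less_le closed_def)
    then obtain n where "1 / real (Suc n) < infdist x (- S)"
      using nat_approx_posE by blast
    then show "x \<in> (\<Union>n. {x. 1 / real (Suc n) \<le> infdist x (- S)})"
      by (auto intro: less_imp_le)
  next
    fix x assume "x \<in> (\<Union>n. {x. 1 / real (Suc n) \<le> infdist x (- S)})"
    then obtain n where n: "1 / real (Suc n) \<le> infdist x (- S)" by auto
    have "0 < 1 / real (Suc n)" by simp
    then have "0 < infdist x (- S)" using n by linarith
    then show "x \<in> S"
      using infdist_zero[of x "- S"] by (cases "x \<in> S") auto
  qed
  moreover have "closed {x. 1 / real (Suc n) \<le> infdist x (- S)}" for n
    by (intro closed_Collect_le continuous_intros)
  ultimately show ?thesis
    using analytic_UN[of "\<lambda>n. {x. 1 / real (Suc n) \<le> infdist x (- S)}"] analytic_closed by metis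
qed

lemma analytic_borel:
  fixes S :: "'z::metric_space set"
  assumes "S \<in> sets borel"
  shows "analytic S"
proof -
  have "S \<in> sigma_sets UNIV {S. open S}"
    using assms by (simp add: borel_def)
  then have "analytic S \<and> analytic (- S)"
  proof induction
    case (Basic a)
    then show ?case by (auto intro: analytic_open analytic_closed simp: closed_def)
  next
    case Empty
    then show ?case by (auto intro: analytic_closed)
  next
    case (Compl a)
    then show ?case by (auto simp: Compl_eq_Diff_UNIV[symmetric])
  next
    case (Union a)
    then show ?case by (auto intro: analytic_UN analytic_INT simp: Compl_UN)
  qed
  then show ?thesis ..
qed

text \<open>
  Here \<open>Sep\<close> is an abstract notion of separability for sequences of sets: if one member is a countable
  union and the sequence is separable with each of the pieces in its place, then it is separable.
  If a sequence of closed
  sets is not separable, then its members can be cut down, one at a time and each infinitely often,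
  to closed sets whose diameters tend to 0, such that no stage is separable.
\<close>
lemma shrinking_inseparable:
  fixes K :: "nat \<Rightarrow> 'w::{complete_space, second_countable_topology} set"
  assumes split: "\<forall>K n L. K n = (\<Union>m. L m) \<longrightarrow> (\<forall>m::nat. Sep (K(n := L m))) \<longrightarrow> Sep K"
    and "\<not> Sep K" and "\<forall>n. closed (K n)"
  shows "\<exists>H. (\<forall>k. \<not> Sep (H k)) \<and> (\<forall>k n. H k n \<subseteq> K n) \<and> (\<forall>n. decseq (\<lambda>k. H k n)) \<and>
    (\<forall>k n. closed (H k n)) \<and> (\<forall>n e. 0 < e \<longrightarrow> (\<exists>k. \<forall>v\<in>H k n. \<forall>w\<in>H k n. dist v w < e))"
proof -
  obtain C :: "'w set" where C: "countable C" "\<And>X. open X \<Longrightarrow> X \<noteq> {} \<Longrightarrow> \<exists>d\<in>C. d \<in> X"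
    using countable_dense_setE by blast
  have "C \<noteq> {}" using C(2)[OF open_UNIV] by auto
  define c where "c = from_nat_into C"
  have dense: "\<exists>m. dist (c m) w < e" if "0 < e" for w e
  proof -
    have "ball w e \<noteq> {}" using that by simp
    then obtain d where "d \<in> C" "d \<in> ball w e" using C(2)[OF open_ball] by blast
    then show ?thesis
      using from_nat_into_surj[OF C(1)] unfolding c_def by (metis mem_ball dist_commute)
  qed
  \<comment> \<open>The member of the sequence that is cut down at stage \<open>k\<close>; every index occurs infinitely often.\<close>
  define idx where "idx k = fst (prod_decode k)" for k
  have step: "\<exists>m. \<not> Sep (J(n := J n \<inter> cball (c m) e))" if "\<not> Sep J" "0 < e" for J n and e :: real
  proof (rule ccontr)
    assume *: "\<not> ?thesis"
    have "J n = (\<Union>m. J n \<inter> cball (c m) e)"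
      using dense[OF that(2)] by (force intro: less_imp_le)
    then show False using split[rule_format, of J n "\<lambda>m. J n \<inter> cball (c m) e"] * that by auto
  qed
  define refine where "refine k J = (let n = idx k in
     J(n := J n \<inter> cball (c (SOME m. \<not> Sep (J(n := J n \<inter> cball (c m) (1 / real (Suc k)))))) (1 / real (Suc k))))" for k J
  have refine: "\<not> Sep (refine k J)" if "\<not> Sep J" for k J
    unfolding refine_def Let_def
    using someI_ex[OF step[OF that, of "1 / real (Suc k)" "idx k"]] by simp
  define H where "H = rec_nat K refine"
  have H_0: "H 0 = K" and H_Suc: "H (Suc k) = refine k (H k)" for k
    by (simp_all add: H_def)
  have sub: "H (Suc k) n \<subseteq> H k n" for k n
    unfolding H_Suc refine_def Let_def by auto
  have 1: "\<not> Sep (H k)" for k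
    by (induction k) (auto simp: H_0 H_Suc assms refine)
  have 2: "closed (H k n)" for k n
    by (induction k arbitrary: n) (auto simp: H_0 H_Suc assms refine_def Let_def)
  have 3: "decseq (\<lambda>k. H k n)" for n
    by (rule decseq_SucI) (rule sub)
  have 4: "H k n \<subseteq> K n" for k n
    using decseqD[OF 3, of 0 k n] by (simp add: H_0)
  have 5: "\<exists>k. \<forall>v\<in>H k n. \<forall>w\<in>H k n. dist v w < e" if e: "0 < e" for n and e :: real
  proof -
    obtain j where j: "1 / real (Suc j) < e / 2"
      by (rule nat_approx_posE[OF half_gt_zero[OF e]])
    define k where "k = prod_encode (n, j)"
    have "idx k = n" by (simp add: idx_def k_def)
    have "j \<le> k" unfolding k_def by (rule le_prod_encode_2)
    then have "1 / real (Suc k) \<le> 1 / real (Suc j)" by (simp add: field_simps)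
    then have r: "1 / real (Suc k) < e / 2" using j by simp
    obtain a where a: "H (Suc k) n \<subseteq> cball a (1 / real (Suc k))"
      using \<open>idx k = n\<close> unfolding H_Suc refine_def Let_def by auto
    have "dist v w < e" if "v \<in> H (Suc k) n" "w \<in> H (Suc k) n" for v w
    proof -
      have "dist a v \<le> 1 / real (Suc k)" "dist a w \<le> 1 / real (Suc k)"
        using that a by (auto simp: subset_iff simp del: of_nat_Suc)
      with r have "dist a v < e / 2" "dist a w < e / 2" by linarith+
      then show ?thesis using dist_triangle3[of v w a] by linarith
    qed
    then show ?thesis by blast
  qed
  show ?thesis using 1 2 3 4 5 by blast
qed

text \<open>
  The Kunugui--Novikov theorem: if the sections of a Borel set are closed, then its complement is a
  countable union of Borel rectangles whose second sides belong to a given base. The largest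
  possible first sides, the sets of those \<open>x\<close> for which \<open>V n\<close> does not meet the section of \<open>B\<close> at \<open>x\<close>,
  are complements of analytic sets; the point is to shrink them to Borel sets such that the
  rectangles still cover the complement.

  With \<open>B\<close> and its complement represented as projections of the closed sets \<open>F\<close> and \<open>G\<close>, consider the
  sequence \<open>K\<close> with \<open>K 0 = G\<close> and \<open>K (n + 1)\<close> the part of \<open>F\<close> above the closure of \<open>V n\<close>. It is separable
  if there are Borel sets \<open>R n\<close> that contain the projections of \<open>K (n + 1)\<close> such that the rectangles
  \<open>- R n \<times> V n\<close> cover the projection of \<open>K 0\<close>. If it were not separable, one could shrink it to a
  point \<open>(x, y)\<close> outside \<open>B\<close> and to points of \<open>B\<close> with first coordinates \<open>x\<^sub>n\<close>. For some \<open>n\<close> with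
  \<open>y \<in> V n\<close> the closure of \<open>V n\<close> misses the section at \<open>x\<close>, so that \<open>x\<^sub>n \<noteq> x\<close>, and disjoint
  neighbourhoods of the two points separate a late stage.
\<close>
lemma borel_closed_sections:
  fixes B :: "('x::{complete_space, second_countable_topology} \<times>
      'h::{complete_space, second_countable_topology}) set"
  assumes B: "B \<in> sets borel"
    and sections: "\<And>x. closed {h. (x, h) \<in> B}"
    and V: "topological_basis (range V)"
  shows "\<exists>W :: nat \<Rightarrow> 'x set. (\<forall>n. W n \<in> sets borel) \<and> - B = (\<Union>n. W n \<times> V n)"
proof -
  obtain F :: "(('x \<times> 'h) \<times> (nat \<Rightarrow> real)) set" where F: "closed F" "B = fst ` F"
    using analytic_borel[OF B] unfolding analytic_def by auto
  have "- B \<in> sets borel" using B by auto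
  then obtain G :: "(('x \<times> 'h) \<times> (nat \<Rightarrow> real)) set" where G: "closed G" "- B = fst ` G"
    using analytic_borel[of "- B"] unfolding analytic_def by auto
  have openV: "open (V n)" for n
    using V by (auto simp: topological_basis_open)
  define K where "K n = (case n of 0 \<Rightarrow> G | Suc n \<Rightarrow> {w \<in> F. snd (fst w) \<in> closure (V n)})" for n
  have K_0: "K 0 = G" and K_Suc: "K (Suc n) = F \<inter> (\<lambda>w. snd (fst w)) -` closure (V n)" for n
    by (auto simp: K_def)
  have closedK: "closed (K n)" for n
  proof (cases n)
    case (Suc m)
    then show ?thesis
      by (auto simp: K_Suc intro!: closed_Int F closed_vimage continuous_intros)
  qed (simp add: K_0 G)
  define Sep :: "(nat \<Rightarrow> (('x \<times> 'h) \<times> (nat \<Rightarrow> real)) set) \<Rightarrow> bool" where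
    "Sep J \<longleftrightarrow> (\<exists>R. (\<forall>n. R n \<in> sets borel \<and> (\<forall>w\<in>J (Suc n). fst (fst w) \<in> R n)) \<and>
        (\<forall>w\<in>J 0. \<exists>n. fst (fst w) \<notin> R n \<and> snd (fst w) \<in> V n))" for J
  have split: "Sep J" if J: "J n = (\<Union>m. L m)" and sep: "\<And>m::nat. Sep (J(n := L m))" for J n L
  proof -
    have "\<forall>m. \<exists>R. (\<forall>j. R j \<in> sets borel \<and> (\<forall>w\<in>(J(n := L m)) (Suc j). fst (fst w) \<in> R j)) \<and>
        (\<forall>w\<in>(J(n := L m)) 0. \<exists>j. fst (fst w) \<notin> R j \<and> snd (fst w) \<in> V j)"
      using sep unfolding Sep_def by blast
    then obtain R where R: "\<And>m j. R m j \<in> sets borel"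
        "\<And>m j w. w \<in> (J(n := L m)) (Suc j) \<Longrightarrow> fst (fst w) \<in> R m j"
        "\<And>m w. w \<in> (J(n := L m)) 0 \<Longrightarrow> \<exists>j. fst (fst w) \<notin> R m j \<and> snd (fst w) \<in> V j"
      by metis
    define R' where "R' j = (if Suc j = n then \<Union>m. R m j else \<Inter>m. R m j)" for j
    have "R' j \<in> sets borel" for j
      using R(1) by (auto simp: R'_def)
    moreover have "fst (fst w) \<in> R' j" if w: "w \<in> J (Suc j)" for j w
    proof (cases "Suc j = n")
      case True
      then obtain m where "w \<in> L m" using w J by auto
      then show ?thesis using True R(2)[of w m j] by (auto simp: R'_def)
    next
      case False
      then show ?thesis using w R(2)[of w _ j] by (auto simp: R'_def)
    qed
    moreover have "\<exists>j. fst (fst w) \<notin> R' j \<and> snd (fst w) \<in> V j" if w: "w \<in> J 0" for w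
    proof (cases n)
      case 0
      then obtain m where m: "w \<in> L m" using w J by auto
      show ?thesis using R(3)[of w m] m 0 by (auto simp: R'_def)
    next
      case (Suc i)
      have *: "\<exists>j. fst (fst w) \<notin> R m j \<and> snd (fst w) \<in> V j" for m
        using R(3)[of w m] w Suc by auto
      show ?thesis
      proof (rule ccontr)
        assume neg: "\<not> ?thesis"
        \<comment> \<open>If \<open>x\<close> lies in some \<open>R m i\<close>, the separation for this \<open>m\<close> is violated; otherwise
          the second coordinate is outside \<open>V i\<close>, and any \<open>m\<close> will do.\<close>
        define m where "m = (SOME m. fst (fst w) \<in> R m i)"
        obtain j where j: "fst (fst w) \<notin> R m j" "snd (fst w) \<in> V j" using * by blast
        with neg have "fst (fst w) \<in> R' j" by blast
        then show False
          using j someI_ex[of "\<lambda>m. fst (fst w) \<in> R m i"] Suc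
          by (auto simp: R'_def m_def split: if_splits)
      qed
    qed
    ultimately show ?thesis unfolding Sep_def by blast
  qed
  have "Sep K"
  proof (rule ccontr)
    assume "\<not> Sep K"
    obtain H where H: "\<And>k. \<not> Sep (H k)" "\<And>k n. H k n \<subseteq> K n" "\<And>n. decseq (\<lambda>k. H k n)"
      "\<And>k n. closed (H k n)" "\<And>n e. 0 < e \<Longrightarrow> \<exists>k. \<forall>v\<in>H k n. \<forall>w\<in>H k n. dist v w < e"
      using shrinking_inseparable[of Sep K] split \<open>\<not> Sep K\<close> closedK by metis
    have limit_point: "\<exists>w. \<forall>k. w \<in> H k n" if ne: "\<And>k. H k n \<noteq> {}" for n
    proof -
      have "H k n \<subseteq> H m n" if "m \<le> k" for m k
        using decseqD[OF H(3) that] .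
      from decreasing_closed_nest[of "\<lambda>k. H k n", OF H(4) ne this H(5)]
      show ?thesis by metis
    qed
    have small: "\<exists>k0. \<forall>k\<ge>k0. H k n \<subseteq> U" if U: "open U" "w \<in> U" and w: "\<And>k. w \<in> H k n" for U w n
    proof -
      obtain e where e: "0 < e" "ball w e \<subseteq> U" using U by (meson open_contains_ball)
      obtain k0 where k0: "\<forall>v\<in>H k0 n. \<forall>w\<in>H k0 n. dist v w < e" using H(5)[OF e(1)] by blast
      have "H k n \<subseteq> ball w e" if "k0 \<le> k" for k
        using k0 w decseqD[OF H(3) that, of n] by auto
      with e(2) show ?thesis by blast
    qed
    have "H k 0 \<noteq> {}" for k
    proof
      assume "H k 0 = {}"
      then have "Sep (H k)" unfolding Sep_def by (intro exI[of _ "\<lambda>_. UNIV"]) auto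
      with H(1) show False by blast
    qed
    then obtain w0 where w0: "\<And>k. w0 \<in> H k 0" using limit_point by blast
    obtain x y where xy: "fst w0 = (x, y)" by (cases "fst w0")
    have "w0 \<in> G" using w0 H(2) K_0 by blast
    then have "(x, y) \<in> - B" using G(2) xy by (metis image_eqI)
    then have "y \<in> - {h. (x, h) \<in> B}" "open (- {h. (x, h) \<in> B})"
      using sections by auto
    then obtain e where e: "0 < e" "cball y e \<subseteq> - {h. (x, h) \<in> B}"
      by (meson open_contains_cball)
    obtain n where n: "y \<in> V n" "V n \<subseteq> ball y e"
      using topological_basisE[OF V open_ball, of y y e] e(1) by auto
    have clV: "closure (V n) \<subseteq> - {h. (x, h) \<in> B}"
      using closure_minimal[OF order.trans[OF n(2) ball_subset_cball] closed_cball] e(2) by (rule order.trans)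
    \<comment> \<open>The set \<open>K (n + 1)\<close> may have been cut down to the empty set, in which case \<open>U = {}\<close> works.\<close>
    have "\<exists>U U' k1. open U \<and> open U' \<and> x \<in> U' \<and> U \<inter> U' = {} \<and>
        (\<forall>k\<ge>k1. \<forall>w\<in>H k (Suc n). fst (fst w) \<in> U)"
    proof (cases "\<exists>k. H k (Suc n) = {}")
      case True
      then obtain k1 where "H k1 (Suc n) = {}" by blast
      then have "H k (Suc n) = {}" if "k1 \<le> k" for k
        using decseqD[OF H(3) that, of "Suc n"] by auto
      then show ?thesis by (intro exI[of _ "{}"] exI[of _ UNIV] exI[of _ k1]) auto
    next
      case False
      then obtain w1 where w1: "\<And>k. w1 \<in> H k (Suc n)" using limit_point by blast
      then have "w1 \<in> K (Suc n)" using H(2) by blast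
      then have "w1 \<in> F" "snd (fst w1) \<in> closure (V n)" by (auto simp: K_Suc)
      then have "(fst (fst w1), snd (fst w1)) \<in> B" using F(2) by auto
      then have "fst (fst w1) \<noteq> x"
        using clV \<open>snd (fst w1) \<in> closure (V n)\<close> by auto
      then obtain U U' where U: "open U" "open U'" "fst (fst w1) \<in> U" "x \<in> U'" "U \<inter> U' = {}"
        by (meson hausdorff)
      have "open ((\<lambda>w. fst (fst w)) -` U :: (('x \<times> 'h) \<times> (nat \<Rightarrow> real)) set)"
        by (intro open_vimage U continuous_intros)
      then obtain k1 where "\<forall>k\<ge>k1. H k (Suc n) \<subseteq> (\<lambda>w. fst (fst w)) -` U"
        using small[of _ w1 "Suc n"] w1 U(3) by blast
      with U show ?thesis by blast
    qed
    then obtain U U' k1 where U: "open U" "open U'" "x \<in> U'" "U \<inter> U' = {}"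
      "\<And>k w. k1 \<le> k \<Longrightarrow> w \<in> H k (Suc n) \<Longrightarrow> fst (fst w) \<in> U" by blast
    have "open (fst -` (U' \<times> V n) :: (('x \<times> 'h) \<times> (nat \<Rightarrow> real)) set)"
      by (intro open_vimage open_Times U openV continuous_intros)
    then obtain k2 where k2: "\<forall>k\<ge>k2. H k 0 \<subseteq> fst -` (U' \<times> V n)"
      using small[of _ w0 0] w0 xy U(3) n(1) by fastforce
    define k where "k = max k1 k2"
    have "Sep (H k)"
      unfolding Sep_def
    proof (intro exI[of _ "(\<lambda>_. UNIV)(n := U)"] conjI allI ballI)
      fix w assume "w \<in> H k 0"
      then have "fst w \<in> U' \<times> V n" using k2[rule_format, of k] by (auto simp: k_def)
      then show "\<exists>j. fst (fst w) \<notin> ((\<lambda>_. UNIV)(n := U)) j \<and> snd (fst w) \<in> V j"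
        using U(4) by (intro exI[of _ n]) auto
    next
      fix j w assume "w \<in> H k (Suc j)"
      then show "fst (fst w) \<in> ((\<lambda>_. UNIV)(n := U)) j"
        using U(5)[of k w] by (cases "j = n") (simp_all add: k_def)
    next
      fix j show "((\<lambda>_. UNIV)(n := U)) j \<in> sets borel"
        using U(1) by (cases "j = n") simp_all
    qed
    with H(1) show False by blast
  qed
  then have "\<exists>R. (\<forall>n. R n \<in> sets borel \<and> (\<forall>w\<in>K (Suc n). fst (fst w) \<in> R n)) \<and>
        (\<forall>w\<in>K 0. \<exists>n. fst (fst w) \<notin> R n \<and> snd (fst w) \<in> V n)"
    unfolding Sep_def .
  then obtain R where R: "\<And>n. R n \<in> sets borel" "\<And>n w. w \<in> K (Suc n) \<Longrightarrow> fst (fst w) \<in> R n"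
    "\<And>w. w \<in> K 0 \<Longrightarrow> \<exists>n. fst (fst w) \<notin> R n \<and> snd (fst w) \<in> V n"
    by metis
  have "- B = (\<Union>n. (- R n) \<times> V n)"
  proof (intro equalityI subsetI)
    fix z assume "z \<in> - B"
    then obtain w where "w \<in> G" "z = fst w" using G(2) by auto
    moreover from this have "w \<in> K 0" using K_0 by simp
    then obtain n where "fst (fst w) \<notin> R n" "snd (fst w) \<in> V n" using R(3) by blast
    ultimately show "z \<in> (\<Union>n. (- R n) \<times> V n)"
      by (auto simp: mem_Times_iff)
  next
    fix z assume "z \<in> (\<Union>n. (- R n) \<times> V n)"
    then obtain n where n: "fst z \<notin> R n" "snd z \<in> V n" by auto
    show "z \<in> - B"
    proof
      assume "z \<in> B"
      then obtain w where "w \<in> F" "z = fst w" using F(2) by auto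
      then have "w \<in> K (Suc n)" using n closure_subset by (auto simp: K_Suc)
      then show False using R(2) n(1) \<open>z = fst w\<close> by blast
    qed
  qed
  moreover have "- R n \<in> sets borel" for n
    using R(1) by auto
  ultimately show ?thesis by (intro exI[of _ "\<lambda>n. - R n"]) auto
qed

section \<open>Projections of Borel sets with compact sections\<close>

text \<open>
  If all sections lie in one compact set \<open>C\<close>, then the section at \<open>x\<close> is empty if and only if finitely
  many of the rectangles of \<open>borel_closed_sections\<close> at \<open>x\<close> cover \<open>C\<close>. There are only countably many
  finite subfamilies.
\<close>
lemma borel_projection_compact:
  fixes B :: "('x::{complete_space, second_countable_topology} \<times>
      'h::{complete_space, second_countable_topology}) set"
  assumes B: "B \<in> sets borel"
    and sections: "\<And>x. compact {h. (x, h) \<in> B}"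
    and C: "compact C" "snd ` B \<subseteq> C"
  shows "fst ` B \<in> sets borel"
proof -
  obtain \<V> :: "'h set set" where \<V>: "countable \<V>" "topological_basis \<V>"
    using ex_countable_basis by blast
  have "\<V> \<noteq> {}"
  proof
    assume "\<V> = {}"
    then show False using topological_basisE[OF \<V>(2) open_UNIV UNIV_I] by auto
  qed
  define V where "V = from_nat_into \<V>"
  have range_V: "range V = \<V>"
    using \<V>(1) \<open>\<V> \<noteq> {}\<close> by (simp add: V_def range_from_nat_into)
  have openV: "open (V n)" for n
    using topological_basis_open[OF \<V>(2), of "V n"] range_V by auto
  have V: "topological_basis (range V)"
    using \<V>(2) range_V by simp
  obtain W where W: "\<And>n. W n \<in> sets borel" "- B = (\<Union>n. W n \<times> V n)"
    using borel_closed_sections[OF B compact_imp_closed[OF sections] V] by metis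
  define \<I> where "\<I> = {I :: nat set. finite I \<and> C \<subseteq> (\<Union>n\<in>I. V n)}"
  have "countable \<I>"
    unfolding \<I>_def by (rule countable_subset[OF _ countable_Collect_finite]) auto
  have "- (fst ` B) = (\<Union>I\<in>\<I>. \<Inter>n\<in>I. W n)"
  proof (intro equalityI subsetI)
    fix x assume "x \<in> - (fst ` B)"
    then have x: "(x, h) \<in> - B" for h by force
    define N where "N = {n. x \<in> W n}"
    have "C \<subseteq> (\<Union>n\<in>N. V n)"
      using x unfolding W(2) by (auto simp: N_def)
    then obtain I where I: "I \<subseteq> N" "finite I" "C \<subseteq> (\<Union>n\<in>I. V n)"
      using compactE_image[OF C(1), of N V] openV by metis
    then show "x \<in> (\<Union>I\<in>\<I>. \<Inter>n\<in>I. W n)"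
      by (auto simp: \<I>_def N_def)
  next
    fix x assume "x \<in> (\<Union>I\<in>\<I>. \<Inter>n\<in>I. W n)"
    then obtain I where I: "C \<subseteq> (\<Union>n\<in>I. V n)" "\<forall>n\<in>I. x \<in> W n"
      by (auto simp: \<I>_def)
    have "(x, h) \<notin> B" for h
    proof
      assume "(x, h) \<in> B"
      then obtain n where "n \<in> I" "h \<in> V n" using C(2) I(1) by force
      then have "(x, h) \<in> - B" unfolding W(2) using I(2) by blast
      with \<open>(x, h) \<in> B\<close> show False by simp
    qed
    then show "x \<in> - (fst ` B)" by force
  qed
  moreover have "(\<Inter>n\<in>I. W n) \<in> sets borel" if "I \<in> \<I>" for I
  proof (cases "I = {}")
    case False
    then show ?thesis
      using that W(1) by (intro sets.finite_INT) (auto simp: \<I>_def)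
  qed simp
  ultimately have "- (fst ` B) \<in> sets borel"
    using \<open>countable \<I>\<close> sets.countable_UN''[of \<I> "\<lambda>I. \<Inter>n\<in>I. W n" borel] by auto
  from borel_comp[OF this] show ?thesis by simp
qed

text \<open>
  Embedding of a separable metric space into the Hilbert cube by means of a dense sequence \<open>d\<close>,
  with the cube regarded as a compact subset of the space of all real sequences.
\<close>
definition cube_embedding :: "(nat \<Rightarrow> 'a) \<Rightarrow> 'a::metric_space \<Rightarrow> nat \<Rightarrow> real" where
  "cube_embedding d a = (\<lambda>n. min 1 (dist a (d n)))"

lemma continuous_cube_embedding: "continuous_on S (cube_embedding d)"
  unfolding cube_embedding_def
  by (rule continuous_on_coordinatewise_then_product)
    (intro continuous_on_min continuous_on_const continuous_on_dist continuous_on_id)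

text \<open>
  For the supremum distance of sequences the embedding is an isometry with respect to the metric
  \<open>min 1 (dist a b)\<close>.
\<close>
lemma cube_embedding_dist_le:
  assumes dense: "\<And>a e. 0 < e \<Longrightarrow> \<exists>n. dist a (d n) < e"
    and le: "\<And>n. \<bar>cube_embedding d a n - cube_embedding d b n\<bar> \<le> s"
  shows "min 1 (dist a b) \<le> s"
proof (rule field_le_epsilon)
  fix e :: real assume "0 < e"
  then obtain n where n: "dist b (d n) < e / 2" using dense[of "e / 2"] by auto
  have "dist a b \<le> dist a (d n) + dist b (d n)" by (metis dist_triangle2)
  then show "min 1 (dist a b) \<le> s + e"
    using n le[of n] \<open>0 < e\<close> unfolding cube_embedding_def by linarith
qed

lemma inj_cube_embedding:
  assumes "\<And>a e. 0 < e \<Longrightarrow> \<exists>n. dist a (d n) < e"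
  shows "inj (cube_embedding d)"
proof (rule injI)
  fix a b assume "cube_embedding d a = cube_embedding d b"
  then have "min 1 (dist a b) \<le> 0"
    by (intro cube_embedding_dist_le[of d]) (simp_all add: assms)
  then have "dist a b \<le> 0" by linarith
  then show "a = b" by simp
qed

text \<open>
  By completeness, a point of the cube lies in the image of \<open>K\<close> if and only if it is a limit in the
  supremum distance of images of points of \<open>K\<close>. This is a Borel condition, since these points may be
  taken from a countable dense subset of \<open>K\<close>.
\<close>
lemma closed_image_cube_embedding:
  fixes d :: "nat \<Rightarrow> 'a::{complete_space, second_countable_topology}"
  assumes dense: "\<And>a e. 0 < e \<Longrightarrow> \<exists>n. dist a (d n) < e"
    and K: "closed K"
  shows "cube_embedding d ` K \<in> sets borel"
proof (cases "K = {}")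
  case False
  obtain T where T: "countable T" "T \<subseteq> K" "K \<subseteq> closure T" using separable by blast
  with False have "T \<noteq> {}" by auto
  define t where "t = from_nat_into T"
  have t: "t n \<in> K" for n
    using subsetD[OF T(2) from_nat_into[OF \<open>T \<noteq> {}\<close>]] by (simp add: t_def)
  have t_dense: "\<exists>n. dist (t n) a < e" if a: "a \<in> K" and e: "0 < e" for a e
  proof -
    have "a \<in> closure T" using T(3) a by blast
    then obtain b where "b \<in> T" "dist b a < e" using e closure_approachable[of a T] by blast
    then show ?thesis
      using from_nat_into_surj[OF T(1)] unfolding t_def by metis
  qed
  let ?e = "cube_embedding d"
  have "?e ` K = (\<Inter>k. \<Union>n. \<Inter>j. {h. \<bar>h j - ?e (t n) j\<bar> \<le> 1 / real (Suc k)})"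
  proof (intro equalityI subsetI)
    fix h assume "h \<in> ?e ` K"
    then obtain a where a: "a \<in> K" "h = ?e a" by blast
    have "\<exists>n. \<forall>j. \<bar>h j - ?e (t n) j\<bar> \<le> 1 / real (Suc k)" for k
    proof -
      obtain n where n: "dist (t n) a < 1 / real (Suc k)" using t_dense[OF a(1), of "1 / real (Suc k)"] by auto
      have "\<bar>h j - ?e (t n) j\<bar> \<le> dist (t n) a" for j
        using abs_dist_diff_le[of a "d j" "t n"] unfolding a(2) cube_embedding_def
        by (simp add: dist_commute)
      then show ?thesis using n by (intro exI[of _ n] allI) (rule order.trans[OF _ less_imp_le])
    qed
    then show "h \<in> (\<Inter>k. \<Union>n. \<Inter>j. {h. \<bar>h j - ?e (t n) j\<bar> \<le> 1 / real (Suc k)})" by simp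
  next
    fix h assume "h \<in> (\<Inter>k. \<Union>n. \<Inter>j. {h. \<bar>h j - ?e (t n) j\<bar> \<le> 1 / real (Suc k)})"
    then have "\<forall>k. \<exists>n. \<forall>j. \<bar>h j - ?e (t n) j\<bar> \<le> 1 / real (Suc k)" by simp
    then obtain n where n: "\<And>k j. \<bar>h j - ?e (t (n k)) j\<bar> \<le> 1 / real (Suc k)" by metis
    have close: "min 1 (dist (t (n k)) (t (n l))) \<le> 1 / real (Suc k) + 1 / real (Suc l)" for k l
    proof (rule cube_embedding_dist_le[OF dense])
      show "\<bar>?e (t (n k)) j - ?e (t (n l)) j\<bar> \<le> 1 / real (Suc k) + 1 / real (Suc l)" for j
        using n[of j k] n[of j l] by linarith
    qed
    have "Cauchy (\<lambda>k. t (n k))"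
    proof (rule metric_CauchyI)
      fix e :: real assume "0 < e"
      then have "0 < min 1 e / 2" by simp
      then obtain N where N: "1 / real (Suc N) < min 1 e / 2" by (rule nat_approx_posE)
      have "dist (t (n k)) (t (n l)) < e" if "N \<le> k" "N \<le> l" for k l
      proof -
        have "1 / real (Suc k) \<le> 1 / real (Suc N)" "1 / real (Suc l) \<le> 1 / real (Suc N)"
          using that by (simp_all add: field_simps)
        with N close[of k l] show ?thesis by linarith
      qed
      then show "\<exists>N. \<forall>k\<ge>N. \<forall>l\<ge>N. dist (t (n k)) (t (n l)) < e" by blast
    qed
    then obtain a where a: "(\<lambda>k. t (n k)) \<longlonglongrightarrow> a"
      by (auto simp: Cauchy_convergent_iff convergent_def)
    have "a \<in> K" using closed_sequentially[OF K _ a] t by blast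
    moreover have "h j = ?e a j" for j
    proof (rule LIMSEQ_unique)
      show "(\<lambda>k. ?e (t (n k)) j) \<longlonglongrightarrow> ?e a j"
        unfolding cube_embedding_def by (intro tendsto_intros a)
      have "(\<lambda>k. h j - ?e (t (n k)) j) \<longlonglongrightarrow> 0"
        by (rule Lim_null_comparison[OF _ LIMSEQ_Suc[OF lim_1_over_n]]) (simp add: n del: of_nat_Suc)
      from tendsto_diff[OF tendsto_const[of "h j"] this]
      show "(\<lambda>k. ?e (t (n k)) j) \<longlonglongrightarrow> h j" by simp
    qed
    ultimately show "h \<in> ?e ` K" by blast
  qed
  also have "\<dots> \<in> sets borel"
  proof -
    have "closed (\<Inter>j. {h :: nat \<Rightarrow> real. \<bar>h j - ?e (t n) j\<bar> \<le> 1 / real (Suc k)})" for n k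
      by (intro closed_INT ballI closed_Collect_le continuous_on_rabs continuous_on_diff
          continuous_on_const continuous_on_product_coordinates)
    then show ?thesis by (intro sets.countable_INT sets.countable_UN) auto
  qed
  finally show ?thesis .
qed simp

lemma compact_unit_cube: "compact {h :: nat \<Rightarrow> real. \<forall>n. h n \<in> {0..1}}"
proof -
  have "compactin (product_topology (\<lambda>_::nat. euclidean :: real topology) UNIV) (\<Pi>\<^sub>E n\<in>UNIV. {0..1})"
    by (subst compactin_PiE) auto
  moreover have "(\<Pi>\<^sub>E n\<in>UNIV. {0..1}) = {h :: nat \<Rightarrow> real. \<forall>n. h n \<in> {0..1}}"
    by auto
  ultimately show ?thesis by (simp add: euclidean_product_topology)
qed

text \<open>
  The set \<open>B\<close> is transported into the Hilbert cube. The image \<open>B'\<close> is again Borel, since the inverse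
  \<open>g\<close> of the embedding is Borel measurable on the image of the whole space, which is a Borel set.
\<close>
theorem borel_projection_compact_sections:
  fixes B :: "('x::{complete_space, second_countable_topology} \<times>
      'a::{complete_space, second_countable_topology}) set"
  assumes B: "B \<in> sets borel"
    and sections: "\<And>x. compact {a. (x, a) \<in> B}"
  shows "fst ` B \<in> sets borel"
proof -
  obtain T :: "'a set" where T: "countable T" "closure T = UNIV"
    using separable[of "UNIV :: 'a set"] by (metis top.extremum_uniqueI)
  then have "T \<noteq> {}" by auto
  define d where "d = from_nat_into T"
  have dense: "\<exists>n. dist a (d n) < e" if e: "0 < e" for a e
  proof -
    have "a \<in> closure T" using T(2) by simp
    then obtain b where "b \<in> T" "dist b a < e" using e closure_approachable[of a T] by blast
    then show ?thesis
      using from_nat_into_surj[OF T(1)] unfolding d_def by (metis dist_commute)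
  qed
  let ?e = "cube_embedding d"
  have inj: "inj ?e" by (rule inj_cube_embedding[OF dense])
  define g where "g h = (if h \<in> range ?e then inv ?e h else undefined)" for h
  have g_e: "g (?e a) = a" for a using inj by (simp add: g_def)
  have range: "range ?e \<in> sets borel"
    by (rule closed_image_cube_embedding[OF dense closed_UNIV])
  have g: "g \<in> borel_measurable borel"
  proof (rule borel_measurableI)
    fix S :: "'a set" assume "open S"
    then have "?e ` (- S) \<in> sets borel" by (intro closed_image_cube_embedding[OF dense]) auto
    moreover have "g -` S = range ?e - ?e ` (- S) \<union> (if undefined \<in> S then - range ?e else {})"
      using g_e by (auto simp: g_def inj split: if_splits)
    ultimately show "g -` S \<inter> space borel \<in> sets borel" using range by auto
  qed
  define B' where "B' = {p. snd p \<in> range ?e \<and> (fst p, g (snd p)) \<in> B}"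
  have B'_eq: "B' = {(x, ?e a) |x a. (x, a) \<in> B}"
    using g_e by (fastforce simp: B'_def)
  have "fst ` B' \<in> sets borel"
  proof (rule borel_projection_compact)
    have "(\<lambda>p :: 'x \<times> (nat \<Rightarrow> real). (fst p, g (snd p))) \<in> borel_measurable borel"
      using g unfolding borel_prod[symmetric] by measurable
    from measurable_sets[OF this B]
    have "{p. (fst p, g (snd p)) \<in> B} \<in> sets borel" by (simp add: vimage_def)
    moreover have "UNIV \<times> range ?e \<in> sets (borel :: ('x \<times> (nat \<Rightarrow> real)) measure)"
      using range by (intro borel_Times) auto
    moreover have "B' = {p. (fst p, g (snd p)) \<in> B} \<inter> UNIV \<times> range ?e"
      by (auto simp: B'_def)
    ultimately show "B' \<in> sets borel" by auto
    show "compact {h. (x, h) \<in> B'}" for x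
    proof -
      have "{h. (x, h) \<in> B'} = ?e ` {a. (x, a) \<in> B}" unfolding B'_eq by auto
      then show ?thesis
        using compact_continuous_image[OF continuous_cube_embedding sections] by simp
    qed
    show "snd ` B' \<subseteq> {h. \<forall>n. h n \<in> {0..1}}"
      unfolding B'_eq by (auto simp: cube_embedding_def)
  qed (rule compact_unit_cube)
  moreover have "fst ` B' = fst ` B" unfolding B'_eq by force
  ultimately show ?thesis by simp
qed

section \<open>Measurable selection of maximizers\<close>

text \<open>
  The part of \<open>D\<close> where \<open>g\<close> attains its maximum over the section.
\<close>
definition argmax_set :: "('x \<times> 'a) set \<Rightarrow> ('x \<times> 'a \<Rightarrow> real) \<Rightarrow> ('x \<times> 'a) set" where
  "argmax_set D g = {(x, a) \<in> D. \<forall>b. (x, b) \<in> D \<longrightarrow> g (x, b) \<le> g (x, a)}"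

lemma usc_attains_max:
  fixes g :: "'a::t2_space \<Rightarrow> real"
  assumes S: "compact S" "S \<noteq> {}" and upper: "\<And>c. closed {a \<in> S. c \<le> g a}"
  shows "\<exists>a\<in>S. \<forall>b\<in>S. g b \<le> g a"
proof -
  have "S \<inter> (\<Inter>b\<in>S. {a \<in> S. g b \<le> g a}) \<noteq> {}"
  proof (rule compact_imp_fip_image[OF S(1) upper])
    fix I assume I: "finite I" "I \<subseteq> S"
    show "S \<inter> (\<Inter>b\<in>I. {a \<in> S. g b \<le> g a}) \<noteq> {}"
    proof (cases "I = {}")
      case False
      then have "Max (g ` I) \<in> g ` I" using I(1) by (intro Max_in) auto
      then obtain a where "a \<in> I" "g a = Max (g ` I)" by auto
      then have "a \<in> S \<inter> (\<Inter>b\<in>I. {a \<in> S. g b \<le> g a})"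
        using I by auto
      then show ?thesis by blast
    qed (use S in auto)
  qed
  then show ?thesis by blast
qed

text \<open>
  Passing to the maximum points keeps sets Borel: a point \<open>(x, a)\<close> of \<open>D\<close> fails to be one if and only
  if there is a rational \<open>q > g (x, a)\<close> such that \<open>x\<close> lies in the projection of \<open>{g \<ge> q}\<close>.
\<close>
lemma argmax_set_compact_sections:
  fixes D :: "('x::{complete_space, second_countable_topology} \<times>
      'a::{complete_space, second_countable_topology}) set"
  assumes D: "D \<in> sets borel" and g: "g \<in> borel_measurable (borel_on D)"
    and sections: "\<And>x. compact {a. (x, a) \<in> D}"
    and upper: "\<And>x c. closed {a. (x, a) \<in> D \<and> c \<le> g (x, a)}"
  shows "argmax_set D g \<in> sets borel" (is ?borel)
    and "\<And>x. compact {a. (x, a) \<in> argmax_set D g}" (is "\<And>x. ?compact x")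
    and "fst ` argmax_set D g = fst ` D" (is ?fst)
proof -
  have attained: "\<exists>a. (x, a) \<in> argmax_set D g" if "(x, b) \<in> D" for x b
    using usc_attains_max[OF sections[of x], of "\<lambda>a. g (x, a)"] upper[of x] that
    by (auto simp: argmax_set_def)
  have "x \<in> fst ` argmax_set D g" if "(x, b) \<in> D" for x b
    using attained[OF that] by (metis fst_conv image_eqI)
  moreover have "argmax_set D g \<subseteq> D" by (auto simp: argmax_set_def)
  ultimately show ?fst by auto
  show "?compact x" for x
  proof (cases "\<exists>b. (x, b) \<in> D")
    case True
    then obtain b where b: "(x, b) \<in> argmax_set D g" using attained by blast
    have "{a. (x, a) \<in> argmax_set D g} = {a. (x, a) \<in> D} \<inter> {a. (x, a) \<in> D \<and> g (x, b) \<le> g (x, a)}"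
      using b by (auto simp: argmax_set_def intro: order.trans)
    then show ?thesis using compact_Int_closed[OF sections upper] by simp
  qed (simp add: argmax_set_def)
  have restrict: "{d \<in> D. P (g d)} \<in> sets borel" if "Measurable.pred borel P" for P
  proof -
    have "{d \<in> space (borel_on D). P (g d)} \<in> sets (borel_on D)"
      using g that by measurable
    then show ?thesis using D by (simp add: space_restrict_space sets_restrict_space_iff)
  qed
  have proj: "fst ` {d \<in> D. q \<le> g d} \<in> sets borel" for q
  proof (rule borel_projection_compact_sections)
    show "compact {a. (x, a) \<in> {d \<in> D. q \<le> g d}}" for x
    proof -
      have "{a. (x, a) \<in> {d \<in> D. q \<le> g d}} = {a. (x, a) \<in> D} \<inter> {a. (x, a) \<in> D \<and> q \<le> g (x, a)}"
        by auto
      then show ?thesis using compact_Int_closed[OF sections[of x] upper[of x q]] by simp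
    qed
  qed (rule restrict, measurable)
  have "argmax_set D g =
      D - (\<Union>q\<in>\<rat>. {d \<in> D. g d < q} \<inter> fst ` {d \<in> D. q \<le> g d} \<times> UNIV)" (is "_ = D - ?R")
  proof (intro equalityI subsetI)
    fix d assume d: "d \<in> argmax_set D g"
    then show "d \<in> D - ?R" by (fastforce simp: argmax_set_def)
  next
    fix d assume d: "d \<in> D - ?R"
    obtain x a where xa: "d = (x, a)" by (cases d)
    have "g (x, b) \<le> g (x, a)" if b: "(x, b) \<in> D" for b
    proof (rule ccontr)
      assume "\<not> ?thesis"
      then obtain q where "q \<in> \<rat>" "g (x, a) < q" "q < g (x, b)"
        using Rats_dense_in_real[of "g (x, a)" "g (x, b)"] by auto
      moreover from this have "x \<in> fst ` {d \<in> D. q \<le> g d}"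
        using b by (force intro: less_imp_le)
      ultimately have "(x, a) \<in> ?R" using d xa by blast
      with d xa show False by blast
    qed
    then show "d \<in> argmax_set D g" using d xa by (simp add: argmax_set_def)
  qed
  also have "\<dots> \<in> sets borel"
  proof (intro sets.Diff D sets.countable_UN'' countable_rat sets.Int borel_Times proj)
    show "{d \<in> D. g d < q} \<in> sets borel" for q
      by (rule restrict) measurable
  qed auto
  finally show ?borel .
qed

text \<open>
  To select one point of each section, the distances to the points \<open>e n\<close> of a dense sequence are
  minimized one after the other. In the limit only one point remains, since two remaining points
  have the same distance to every \<open>e n\<close>.
\<close>
theorem borel_uniformization_compact_sections:
  fixes D :: "('x::{complete_space, second_countable_topology} \<times>
      'a::{complete_space, second_countable_topology}) set"
  assumes D: "D \<in> sets borel" and sections: "\<And>x. compact {a. (x, a) \<in> D}"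
  shows "\<exists>f\<in>borel_measurable (borel_on (fst ` D)). \<forall>x\<in>fst ` D. (x, f x) \<in> D"
proof -
  obtain T :: "'a set" where T: "countable T" "closure T = UNIV"
    using separable[of "UNIV :: 'a set"] by (metis top.extremum_uniqueI)
  then have "T \<noteq> {}" by auto
  define e where "e = from_nat_into T"
  define E where "E = rec_nat D (\<lambda>n E. argmax_set E (\<lambda>(x, a). - dist a (e n)))"
  have E_0: "E 0 = D" and E_Suc: "E (Suc n) = argmax_set (E n) (\<lambda>(x, a). - dist a (e n))" for n
    by (simp_all add: E_def)
  have E: "E n \<in> sets borel \<and> (\<forall>x. compact {a. (x, a) \<in> E n}) \<and> fst ` E n = fst ` D" for n
  proof (induction n)
    case 0
    show ?case using D sections by (simp add: E_0)
  next
    case (Suc n)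
    have "continuous_on UNIV (\<lambda>d :: 'x \<times> 'a. - dist (snd d) (e n))"
      by (intro continuous_intros)
    then have g: "(\<lambda>(x, a). - dist a (e n)) \<in> borel_measurable (borel_on (E n))"
      by (intro measurable_restrict_space1 borel_measurable_continuous_onI)
        (simp add: case_prod_unfold)
    have upper: "closed {a. (x, a) \<in> E n \<and> c \<le> (case (x, a) of (x, a) \<Rightarrow> - dist a (e n))}" for x c
    proof -
      have "closed ({a. (x, a) \<in> E n} \<inter> {a. c \<le> - dist a (e n)})"
        using Suc by (intro closed_Int compact_imp_closed closed_Collect_le continuous_intros) auto
      then show ?thesis by (simp add: Collect_conj_eq)
    qed
    show ?case
      using argmax_set_compact_sections[of "E n", OF _ g _ upper] Suc unfolding E_Suc by metis
  qed
  have sub: "E (Suc n) \<subseteq> E n" for n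
    unfolding E_Suc by (auto simp: argmax_set_def)
  have dec: "E n \<subseteq> E m" if "m \<le> n" for m n
    using lift_Suc_antimono_le[of E, OF sub that] .
  define G where "G = (\<Inter>n. E n)"
  have G_borel: "G \<in> sets borel" unfolding G_def using E by auto
  have G_D: "G \<subseteq> D" using E_0 unfolding G_def by blast
  have unique: "a = b" if a: "(x, a) \<in> G" and b: "(x, b) \<in> G" for x a b
  proof -
    have same: "dist a (e n) = dist b (e n)" for n
    proof -
      have "(x, a) \<in> E (Suc n)" "(x, b) \<in> E (Suc n)" using a b unfolding G_def by blast+
      then show ?thesis unfolding E_Suc by (force simp: argmax_set_def)
    qed
    have "dist a b \<le> 0 + r" if "0 < r" for r
    proof -
      have "b \<in> closure T" using T(2) by simp
      then have "\<exists>t\<in>T. dist t b < r / 2"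
        unfolding closure_approachable using that half_gt_zero by blast
      then obtain n where "dist (e n) b < r / 2"
        using from_nat_into_surj[OF T(1)] unfolding e_def by metis
      then show ?thesis using same[of n] dist_triangle2[of a b "e n"] by (simp add: dist_commute)
    qed
    then have "dist a b \<le> 0" by (rule field_le_epsilon)
    then show ?thesis by simp
  qed
  have nonempty: "\<exists>a. (x, a) \<in> G" if x: "x \<in> fst ` D" for x
  proof -
    have "{a. (x, a) \<in> E 0} \<inter> (\<Inter>n\<in>UNIV. {a. (x, a) \<in> E n}) \<noteq> {}"
    proof (rule compact_imp_fip_image)
      fix I :: "nat set" assume I: "finite I"
      obtain a where a: "(x, a) \<in> E (Max (insert 0 I))"
      proof -
        have "x \<in> fst ` E (Max (insert 0 I))" using x E by metis
        then show ?thesis using that by auto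
      qed
      have "(x, a) \<in> E n" if "n \<in> insert 0 I" for n
        using dec[of n "Max (insert 0 I)"] I that a by auto
      then show "{a. (x, a) \<in> E 0} \<inter> (\<Inter>n\<in>I. {a. (x, a) \<in> E n}) \<noteq> {}" by blast
    qed (use E in \<open>auto intro: compact_imp_closed\<close>)
    then show ?thesis unfolding G_def by blast
  qed
  define f where "f x = (THE a. (x, a) \<in> G)" for x
  have f: "(x, a) \<in> G \<longleftrightarrow> a = f x" if x: "x \<in> fst ` D" for x a
  proof -
    have "\<exists>!a. (x, a) \<in> G" using nonempty[OF x] unique by blast
    then show ?thesis unfolding f_def by (metis (mono_tags, lifting) theI')
  qed
  have "f \<in> borel_measurable (borel_on (fst ` D))"
  proof (rule borel_measurableI)
    fix S :: "'a set" assume "open S"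
    have "fst ` (G \<inter> UNIV \<times> (- S)) \<in> sets borel"
    proof (rule borel_projection_compact_sections)
      show "G \<inter> UNIV \<times> (- S) \<in> sets borel"
        using \<open>open S\<close> by (intro sets.Int G_borel borel_Times) auto
      have "finite {a. (x, a) \<in> G \<inter> UNIV \<times> (- S)}" for x
      proof (cases "\<exists>a. (x, a) \<in> G")
        case True
        then obtain a where "(x, a) \<in> G" by blast
        then have "{a. (x, a) \<in> G \<inter> UNIV \<times> (- S)} \<subseteq> {a}" using unique by blast
        then show ?thesis using finite_subset by blast
      qed auto
      then show "compact {a. (x, a) \<in> G \<inter> UNIV \<times> (- S)}" for x by (rule finite_imp_compact)
    qed
    moreover have "f -` S \<inter> fst ` D = fst ` D - fst ` (G \<inter> UNIV \<times> (- S))"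
    proof (intro equalityI subsetI)
      fix x assume x: "x \<in> f -` S \<inter> fst ` D"
      then have "x \<notin> fst ` (G \<inter> UNIV \<times> (- S))" using f[of x] by auto
      with x show "x \<in> fst ` D - fst ` (G \<inter> UNIV \<times> (- S))" by blast
    next
      fix x assume x: "x \<in> fst ` D - fst ` (G \<inter> UNIV \<times> (- S))"
      then have "(x, f x) \<in> G" using f by blast
      then have "f x \<in> S" using x by force
      with x show "x \<in> f -` S \<inter> fst ` D" by blast
    qed
    moreover have "fst ` D \<in> sets borel" by (rule borel_projection_compact_sections[OF D sections])
    ultimately show "f -` S \<inter> space (borel_on (fst ` D)) \<in> sets (borel_on (fst ` D))"
      by (auto simp: space_restrict_space sets_restrict_space_iff)
  qed
  moreover have "(x, f x) \<in> D" if "x \<in> fst ` D" for x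
    using f[OF that] G_D by blast
  ultimately show ?thesis by blast
qed

theorem measurable_maximizer:
  fixes D :: "('x::{complete_space, second_countable_topology} \<times>
      'a::{complete_space, second_countable_topology}) set"
    and g :: "'x \<times> 'a \<Rightarrow> real"
  assumes "D \<in> sets borel" and "g \<in> borel_measurable (borel_on D)"
    and "\<And>x. compact {a. (x, a) \<in> D}"
    and "\<And>x c. closed {a. (x, a) \<in> D \<and> c \<le> g (x, a)}"
  shows "\<exists>f\<in>borel_measurable (borel_on (fst ` D)).
    \<forall>x\<in>fst ` D. (x, f x) \<in> D \<and> (\<forall>a. (x, a) \<in> D \<longrightarrow> g (x, a) \<le> g (x, f x))"
proof -
  note E = argmax_set_compact_sections[OF assms]
  obtain f where "f \<in> borel_measurable (borel_on (fst ` D))"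
    "\<forall>x\<in>fst ` D. (x, f x) \<in> argmax_set D g"
    using borel_uniformization_compact_sections[OF E(1,2)] unfolding E(3) by blast
  then show ?thesis by (intro bexI[of _ f]) (auto simp: argmax_set_def)
qed

section \<open>Contraction properties of the one-stage operators\<close>

text \<open>
  For integrable real functions the integral of extended real functions is the Bochner integral.
\<close>
lemma ereal_integral_ereal:
  assumes "integrable N h"
  shows "ereal_integral N (\<lambda>y. ereal (h y)) = ereal (\<integral>y. h y \<partial>N)"
proof -
  have fin: "(\<integral>\<^sup>+ y. ennreal (h y) \<partial>N) \<noteq> \<infinity>" "(\<integral>\<^sup>+ y. ennreal (- h y) \<partial>N) \<noteq> \<infinity>"
    using assms unfolding real_integrable_def by auto
  then show ?thesis
    unfolding ereal_integral_def real_lebesgue_integral_def[OF assms]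
    by (cases "\<integral>\<^sup>+ y. ennreal (h y) \<partial>N"; cases "\<integral>\<^sup>+ y. ennreal (- h y) \<partial>N") auto
qed

lemma ereal_integral_cong:
  assumes "\<And>y. y \<in> space N \<Longrightarrow> f y = g y"
  shows "ereal_integral N f = ereal_integral N g"
  unfolding ereal_integral_def using assms by (simp cong: nn_integral_cong)

text \<open>
  The nonlinear moduli of contraction.
\<close>
locale comparison_function =
  fixes \<psi> :: "real \<Rightarrow> real"
  assumes nonneg: "0 \<le> z \<Longrightarrow> 0 \<le> \<psi> z"
    and mono: "0 \<le> y \<Longrightarrow> y \<le> z \<Longrightarrow> \<psi> y \<le> \<psi> z"
    and less: "0 < z \<Longrightarrow> \<psi> z < z"
    and subadd: "0 \<le> y \<Longrightarrow> 0 \<le> z \<Longrightarrow> \<psi> (y + z) \<le> \<psi> y + \<psi> z"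
begin

lemma zero [simp]: "\<psi> 0 = 0"
proof (rule antisym)
  show "\<psi> 0 \<le> 0"
  proof (rule field_le_epsilon)
    fix e :: real assume "0 < e"
    then show "\<psi> 0 \<le> 0 + e" using mono[of 0 e] less[of e] by simp
  qed
qed (simp add: nonneg)

lemma le: "0 \<le> z \<Longrightarrow> \<psi> z \<le> z"
  using less[of z] by (cases "z = 0") (auto intro: less_imp_le)

lemma iterate_nonneg: "0 \<le> z \<Longrightarrow> 0 \<le> (\<psi> ^^ n) z"
  by (induction n) (auto intro: nonneg)

lemma iterate_tendsto_0:
  assumes "0 \<le> z"
  shows "(\<lambda>n. (\<psi> ^^ n) z) \<longlonglongrightarrow> 0"
proof -
  have "decseq (\<lambda>n. (\<psi> ^^ n) z)"
    by (rule decseq_SucI) (simp add: le iterate_nonneg assms)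
  then obtain l where l: "(\<lambda>n. (\<psi> ^^ n) z) \<longlonglongrightarrow> l" "\<And>n. l \<le> (\<psi> ^^ n) z"
    using decseq_convergent[of "\<lambda>n. (\<psi> ^^ n) z" 0] iterate_nonneg[OF assms] by blast
  have "0 \<le> l" by (rule LIMSEQ_le_const[OF l(1)]) (use iterate_nonneg[OF assms] in blast)
  have "(\<psi> ^^ Suc n) z \<le> \<psi> l + ((\<psi> ^^ n) z - l)" for n
    using subadd[of l "(\<psi> ^^ n) z - l"] le[of "(\<psi> ^^ n) z - l"] l(2)[of n] \<open>0 \<le> l\<close> by simp
  moreover have "(\<lambda>n. \<psi> l + ((\<psi> ^^ n) z - l)) \<longlonglongrightarrow> \<psi> l + (l - l)"
    by (intro tendsto_intros l)
  ultimately have "l \<le> \<psi> l + (l - l)"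
    using LIMSEQ_le[OF LIMSEQ_Suc[OF l(1)]] by blast
  then have "l = 0" using less[of l] \<open>0 \<le> l\<close> by (cases "l = 0") auto
  with l(1) show ?thesis by simp
qed

text \<open>
  Convergence of value iteration and of the utilities of a policy over finite horizons.
\<close>
lemma convergent_iterate_bound:
  fixes s :: "nat \<Rightarrow> real"
  assumes c: "0 \<le> c" and bound: "\<And>n k. \<bar>s (n + k) - s n\<bar> \<le> (\<psi> ^^ n) c * b"
  shows "convergent s"
proof -
  have "Cauchy s"
  proof (rule metric_CauchyI)
    fix e :: real assume "0 < e"
    have "(\<lambda>n. (\<psi> ^^ n) c * b) \<longlonglongrightarrow> 0"
      by (intro tendsto_mult_left_zero iterate_tendsto_0 c)
    then have "eventually (\<lambda>n. (\<psi> ^^ n) c * b < e / 2) sequentially"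
      using \<open>0 < e\<close> by (intro order_tendstoD) auto
    then obtain N where N: "(\<psi> ^^ N) c * b < e / 2"
      using eventually_happens'[OF sequentially_bot] by blast
    have close: "\<bar>s m - s N\<bar> < e / 2" if "N \<le> m" for m
      using bound[of N "m - N"] N that by simp
    have "dist (s m) (s n) < e" if "N \<le> m" "N \<le> n" for m n
      using close[OF that(1)] close[OF that(2)] unfolding dist_real_def by linarith
    then show "\<exists>N. \<forall>m\<ge>N. \<forall>n\<ge>N. dist (s m) (s n) < e" by blast
  qed
  then show ?thesis by (simp add: Cauchy_convergent_iff)
qed

lemma linear_bound:
  assumes "0 \<le> z"
  shows "\<psi> z \<le> (z + 1) * \<psi> 1"
proof -
  have *: "\<psi> (real n) \<le> real n * \<psi> 1" for n
  proof (induction n)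
    case (Suc n)
    then show ?case using subadd[of "real n" 1] by (simp add: algebra_simps)
  qed simp
  define n where "n = nat \<lceil>z\<rceil>"
  have n: "z \<le> real n" "real n \<le> z + 1" using assms unfolding n_def by linarith+
  have "\<psi> z \<le> real n * \<psi> 1" using mono[OF assms n(1)] *[of n] by linarith
  also have "\<dots> \<le> (z + 1) * \<psi> 1" using n(2) nonneg[of 1] by (intro mult_right_mono) auto
  finally show ?thesis .
qed

text \<open>
  The linear bound has slope \<open>\<psi> 1 < 1\<close>; therefore \<open>R - \<psi> R\<close> exceeds every constant for large \<open>R\<close>.
\<close>
lemma invariant_radius: "\<exists>R0\<ge>0. \<forall>R\<ge>R0. \<kappa> + \<psi> R \<le> R"
proof (intro exI[of _ "max 0 ((\<kappa> + \<psi> 1) / (1 - \<psi> 1))"] conjI allI impI)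
  fix R assume R: "max 0 ((\<kappa> + \<psi> 1) / (1 - \<psi> 1)) \<le> R"
  have "\<kappa> + \<psi> 1 \<le> R * (1 - \<psi> 1)" using R less[of 1] by (simp add: pos_divide_le_eq)
  moreover have "\<psi> R \<le> (R + 1) * \<psi> 1" using R by (intro linear_bound) simp
  ultimately show "\<kappa> + \<psi> R \<le> R" by (simp add: algebra_simps)
qed simp

end

text \<open>
  Assumptions (A) and (B) with fixed constants. The utility bounds from below and above are
  combined in \<open>\<kappa>\<close>, and the two cases for \<open>\<alpha>\<close> are combined by \<open>max 1 \<alpha>\<close>.
\<close>
locale weighted_mdp =
  fixes M :: "('x::polish_space, 'a::polish_space) mdp" and \<gamma> :: "real \<Rightarrow> real" and \<alpha> \<kappa> :: real
  assumes mdp: "markov_decision_process M"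
    and utility_bound: "(x, a) \<in> constr M \<Longrightarrow> \<bar>utility M (x, a)\<bar> \<le> ereal (\<kappa> * weight M x)"
    and \<gamma>_nonneg: "0 \<le> z \<Longrightarrow> 0 \<le> \<gamma> z"
    and \<gamma>_mono: "0 \<le> y \<Longrightarrow> y \<le> z \<Longrightarrow> \<gamma> y \<le> \<gamma> z"
    and \<gamma>_less: "0 < z \<Longrightarrow> max 1 \<alpha> * \<gamma> z < z"
    and \<gamma>_subadd: "0 \<le> y \<Longrightarrow> 0 \<le> z \<Longrightarrow> \<gamma> (y + z) \<le> \<gamma> y + \<gamma> z"
    and \<gamma>_weight: "x \<in> states M \<Longrightarrow> 0 < y \<Longrightarrow> \<gamma> (weight M x * y) \<le> weight M x * \<gamma> y"
    and discount_\<gamma>: "\<bar>discount M (ereal y) - discount M (ereal z)\<bar> \<le> ereal (\<gamma> \<bar>y - z\<bar>)"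
    and discount_mono: "y \<le> z \<Longrightarrow> discount M (ereal y) \<le> discount M (ereal z)"
    and discount_0: "discount M 0 = 0"
    and weight_drift: "(x, a) \<in> constr M \<Longrightarrow>
      (\<integral>\<^sup>+ y. ennreal (weight M y) \<partial>kernel M (x, a)) \<le> ennreal (\<alpha> * weight M x)"
begin

abbreviation X where "X \<equiv> states M"
abbreviation D where "D \<equiv> constr M"
abbreviation A where "A \<equiv> admissible M"
abbreviation Q where "Q \<equiv> kernel M"
abbreviation w where "w \<equiv> weight M"

lemma D_borel: "D \<in> sets borel" and X_nonempty: "X \<noteq> {}"
  and D_subset: "D \<subseteq> X \<times> actions M"
  and A_nonempty: "x \<in> X \<Longrightarrow> A x \<noteq> {}"
  and w_measurable: "w \<in> borel_measurable (borel_on X)" and w_ge_1: "x \<in> X \<Longrightarrow> 1 \<le> w x"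
  and utility_measurable: "utility M \<in> borel_measurable (borel_on D)"
  and kernel_measurable: "Q \<in> borel_on D \<rightarrow>\<^sub>M prob_algebra (borel_on X)"
  using mdp unfolding markov_decision_process_def measurable_funs_def by auto

lemma space_X: "space (borel_on X) = X"
  by (simp add: space_restrict_space)

lemma space_D: "space (borel_on D) = D"
  by (simp add: space_restrict_space)

lemma D_states: "(x, a) \<in> D \<Longrightarrow> x \<in> X"
  using D_subset by auto

lemma A_iff: "a \<in> A x \<longleftrightarrow> (x, a) \<in> D"
  using D_subset by (auto simp: admissible_def)

lemma fst_D: "fst ` D = X"
proof (intro equalityI subsetI)
  fix x assume "x \<in> X"
  then obtain a where "a \<in> A x" using A_nonempty by blast
  then show "x \<in> fst ` D" by (force simp: A_iff)
qed (use D_subset in auto)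

lemma prob_space_Q: "d \<in> D \<Longrightarrow> prob_space (Q d)"
  and sets_Q: "d \<in> D \<Longrightarrow> sets (Q d) = sets (borel_on X)"
  using measurable_space[OF kernel_measurable, of d] by (auto simp: space_D space_prob_algebra)

lemma space_Q: "d \<in> D \<Longrightarrow> space (Q d) = X"
  using sets_eq_imp_space_eq[OF sets_Q] by (simp add: space_X)

lemma w_pos: "x \<in> X \<Longrightarrow> 0 < w x"
  using w_ge_1[of x] by simp

lemma measurable_Q: "d \<in> D \<Longrightarrow> f \<in> borel_measurable (borel_on X) \<Longrightarrow> f \<in> borel_measurable (Q d)"
  using measurable_cong_sets[OF sets_Q refl] by blast

lemma integrable_w: "(x, a) \<in> D \<Longrightarrow> integrable (Q (x, a)) w"
  and integral_w: "(x, a) \<in> D \<Longrightarrow> (\<integral>y. w y \<partial>Q (x, a)) \<le> \<alpha> * w x"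
proof -
  assume d: "(x, a) \<in> D"
  interpret prob_space "Q (x, a)" by (rule prob_space_Q[OF d])
  have meas: "w \<in> borel_measurable (Q (x, a))" by (rule measurable_Q[OF d w_measurable])
  have fin: "(\<integral>\<^sup>+ y. ennreal (w y) \<partial>Q (x, a)) \<le> ennreal (\<alpha> * w x)" by (rule weight_drift[OF d])
  have nonneg: "AE y in Q (x, a). 0 \<le> w y"
    using w_pos by (intro AE_I2) (auto simp: space_Q[OF d] intro: less_imp_le)
  show int: "integrable (Q (x, a)) w"
    by (rule integrableI_nonneg[OF meas nonneg]) (use fin in \<open>auto simp: order.strict_trans1\<close>)
  have "1 \<le> (\<integral>y. w y \<partial>Q (x, a))"
    using int w_ge_1 by (intro integral_ge_const AE_I2) (simp_all add: space_Q[OF d])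
  moreover have *: "ennreal (\<integral>y. w y \<partial>Q (x, a)) \<le> ennreal (\<alpha> * w x)"
    using fin nn_integral_eq_integral[OF int nonneg] by simp
  ultimately have "0 < \<alpha> * w x"
    by (metis ennreal_eq_0_iff ennreal_le_iff2 linorder_not_le not_one_le_zero order.trans)
  then show "(\<integral>y. w y \<partial>Q (x, a)) \<le> \<alpha> * w x"
    using * by (simp add: ennreal_le_iff)
qed

text \<open>
  The modulus of contraction of all one-stage operators.
\<close>
definition \<psi> where "\<psi> z = max 1 \<alpha> * \<gamma> z"

sublocale comparison_function \<psi>
proof
  show "\<psi> y \<le> \<psi> z" if "0 \<le> y" "y \<le> z" for y z
    unfolding \<psi>_def by (intro mult_left_mono \<gamma>_mono that) simp
  show "\<psi> (y + z) \<le> \<psi> y + \<psi> z" if "0 \<le> y" "0 \<le> z" for y z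
    unfolding \<psi>_def distrib_left[symmetric] by (intro mult_left_mono \<gamma>_subadd that) simp
qed (use \<gamma>_nonneg \<gamma>_less in \<open>auto simp: \<psi>_def\<close>)

lemma \<gamma>_le_\<psi>: "0 \<le> z \<Longrightarrow> \<gamma> z \<le> \<psi> z"
  unfolding \<psi>_def using mult_right_mono[of 1 "max 1 \<alpha>" "\<gamma> z"] \<gamma>_nonneg by simp

lemma \<gamma>_0: "\<gamma> 0 = 0"
  using \<gamma>_le_\<psi>[of 0] \<gamma>_nonneg[of 0] by simp

lemma \<gamma>_le: "0 \<le> z \<Longrightarrow> \<gamma> z \<le> z"
  using \<gamma>_le_\<psi> le order.trans by blast

definition real_discount :: "real \<Rightarrow> real" where
  "real_discount z = real_of_ereal (discount M (ereal z))"

lemma ereal_real_discount: "ereal (real_discount z) = discount M (ereal z)"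
proof -
  have "\<bar>discount M (ereal z)\<bar> \<le> ereal (\<gamma> \<bar>z\<bar>)"
    using discount_\<gamma>[of z 0] discount_0 by (simp add: zero_ereal_def[symmetric])
  then have "\<bar>discount M (ereal z)\<bar> \<noteq> \<infinity>" by auto
  then show ?thesis by (simp add: real_discount_def ereal_real)
qed

lemma real_discount_\<gamma>: "\<bar>real_discount y - real_discount z\<bar> \<le> \<gamma> \<bar>y - z\<bar>"
  using discount_\<gamma>[of y z] by (simp flip: ereal_real_discount)

lemma real_discount_0 [simp]: "real_discount 0 = 0"
  by (simp add: real_discount_def discount_0 flip: zero_ereal_def)

lemma real_discount_mono: "y \<le> z \<Longrightarrow> real_discount y \<le> real_discount z"
  using discount_mono[of y z] by (simp flip: ereal_real_discount)

lemma real_discount_lipschitz: "\<bar>real_discount y - real_discount z\<bar> \<le> \<bar>y - z\<bar>"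
  using real_discount_\<gamma>[of y z] \<gamma>_le[of "\<bar>y - z\<bar>"] by simp

lemma abs_real_discount: "\<bar>real_discount z\<bar> \<le> \<bar>z\<bar>"
  using real_discount_lipschitz[of z 0] by simp

lemma continuous_real_discount: "continuous_on UNIV real_discount"
proof -
  have "1-lipschitz_on UNIV real_discount"
    by (rule lipschitz_onI) (auto simp: dist_real_def real_discount_lipschitz)
  then show ?thesis by (rule lipschitz_on_continuous_on)
qed

lemma measurable_real_discount: "f \<in> borel_measurable N \<Longrightarrow> (\<lambda>y. real_discount (f y)) \<in> borel_measurable N"
  using measurable_compose[OF _ borel_measurable_continuous_onI[OF continuous_real_discount]] .

text \<open>
  The measurable functions of weighted norm at most \<open>C\<close>. As for all functions on the state space,
  values outside \<^term>\<open>X\<close> are irrelevant.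
\<close>
definition weighted_ball :: "real \<Rightarrow> ('x \<Rightarrow> real) set" where
  "weighted_ball C = {v \<in> borel_measurable (borel_on X). \<forall>x\<in>X. \<bar>v x\<bar> \<le> C * w x}"

lemma weighted_ballD:
  assumes "v \<in> weighted_ball C"
  shows "v \<in> borel_measurable (borel_on X)" and "x \<in> X \<Longrightarrow> \<bar>v x\<bar> \<le> C * w x"
  using assms by (auto simp: weighted_ball_def)

lemma weighted_ball_mono: "C \<le> C' \<Longrightarrow> v \<in> weighted_ball C \<Longrightarrow> v \<in> weighted_ball C'"
  unfolding weighted_ball_def
  by (auto intro!: order.trans[OF _ mult_right_mono[of C C']] dest: w_pos intro: less_imp_le)

lemma zero_weighted_ball: "0 \<le> C \<Longrightarrow> (\<lambda>_. 0) \<in> weighted_ball C"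
  unfolding weighted_ball_def by (auto dest: w_pos)

lemma integrable_weighted:
  assumes d: "d \<in> D" and v: "v \<in> weighted_ball C"
  shows "integrable (Q d) v"
proof (rule Bochner_Integration.integrable_bound)
  show "integrable (Q d) (\<lambda>y. C * w y)"
    using integrable_w[of "fst d" "snd d"] d by simp
  show "v \<in> borel_measurable (Q d)" using measurable_Q[OF d weighted_ballD(1)[OF v]] .
  show "AE y in Q d. norm (v y) \<le> norm (C * w y)"
    using weighted_ballD(2)[OF v] abs_ge_self order.trans
    by (intro AE_I2) (force simp: space_Q[OF d])
qed

lemma real_discount_weighted_ball:
  "v \<in> weighted_ball C \<Longrightarrow> (\<lambda>y. real_discount (v y)) \<in> weighted_ball C"
  unfolding weighted_ball_def
  by (auto intro: measurable_real_discount order.trans[OF abs_real_discount])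

definition real_utility :: "'x \<times> 'a \<Rightarrow> real" where
  "real_utility d = real_of_ereal (utility M d)"

lemma ereal_real_utility: "(x, a) \<in> D \<Longrightarrow> ereal (real_utility (x, a)) = utility M (x, a)"
  using utility_bound[of x a] by (cases "utility M (x, a)") (auto simp: real_utility_def)

lemma abs_real_utility: "(x, a) \<in> D \<Longrightarrow> \<bar>real_utility (x, a)\<bar> \<le> \<kappa> * w x"
  using utility_bound[of x a] by (simp flip: ereal_real_utility)

text \<open>
  The expression under the supremum in the Bellman operator, as a real number. The lemma
  \<open>ereal_action_value\<close> identifies it with the extended real one.
\<close>
definition action_value :: "('x \<Rightarrow> real) \<Rightarrow> 'x \<times> 'a \<Rightarrow> real" where
  "action_value v d = real_utility d + (\<integral>y. real_discount (v y) \<partial>Q d)"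

lemma ereal_action_value:
  assumes d: "(x, a) \<in> D" and v: "v \<in> weighted_ball C" and V: "\<And>y. y \<in> X \<Longrightarrow> V y = ereal (v y)"
  shows "utility M (x, a) + ereal_integral (Q (x, a)) (\<lambda>y. discount M (V y)) =
    ereal (action_value v (x, a))"
proof -
  have "ereal_integral (Q (x, a)) (\<lambda>y. discount M (V y)) =
      ereal_integral (Q (x, a)) (\<lambda>y. ereal (real_discount (v y)))"
    by (intro ereal_integral_cong) (simp add: V space_Q[OF d] ereal_real_discount)
  also have "\<dots> = ereal (\<integral>y. real_discount (v y) \<partial>Q (x, a))"
    by (intro ereal_integral_ereal integrable_weighted[OF d real_discount_weighted_ball[OF v]])
  finally show ?thesis
    by (simp add: action_value_def flip: ereal_real_utility[OF d])
qed

lemma action_value_measurable: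
  assumes "v \<in> weighted_ball C"
  shows "action_value v \<in> borel_measurable (borel_on D)"
proof -
  have "(\<lambda>N. \<integral>y. real_discount (v y) \<partial>N) \<in> borel_measurable (subprob_algebra (borel_on X))"
    by (intro integral_measurable_subprob_algebra measurable_real_discount weighted_ballD(1)[OF assms])
  then have "(\<lambda>d. \<integral>y. real_discount (v y) \<partial>Q d) \<in> borel_measurable (borel_on D)"
    using measurable_compose[OF measurable_prob_algebraD[OF kernel_measurable]] by blast
  then show ?thesis
    unfolding action_value_def real_utility_def
    by (intro borel_measurable_add borel_measurable_real_of_ereal utility_measurable)
qed

lemma action_value_contraction:
  assumes d: "(x, a) \<in> D" and v: "v \<in> weighted_ball C" and v': "v' \<in> weighted_ball C'"
    and c: "0 \<le> c" and diff: "\<And>y. y \<in> X \<Longrightarrow> \<bar>v y - v' y\<bar> \<le> c * w y"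
  shows "\<bar>action_value v (x, a) - action_value v' (x, a)\<bar> \<le> \<psi> c * w x"
proof -
  let ?N = "Q (x, a)"
  note int = integrable_weighted[OF d real_discount_weighted_ball[OF v]]
    integrable_weighted[OF d real_discount_weighted_ball[OF v']]
  have "\<bar>real_discount (v y) - real_discount (v' y)\<bar> \<le> \<gamma> c * w y" if y: "y \<in> X" for y
  proof -
    have "\<bar>real_discount (v y) - real_discount (v' y)\<bar> \<le> \<gamma> \<bar>v y - v' y\<bar>" by (rule real_discount_\<gamma>)
    also have "\<dots> \<le> \<gamma> (w y * c)" using diff[OF y] by (intro \<gamma>_mono) (auto simp: mult.commute)
    also have "\<dots> \<le> w y * \<gamma> c"
      using \<gamma>_weight[OF y, of c] c by (cases "c = 0") (auto simp: \<gamma>_0)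
    finally show ?thesis by (simp add: mult.commute)
  qed
  then have "(\<integral>y. \<bar>real_discount (v y) - real_discount (v' y)\<bar> \<partial>?N) \<le> (\<integral>y. \<gamma> c * w y \<partial>?N)"
    using int integrable_w[OF d] by (intro integral_mono) (auto simp: space_Q[OF d])
  also have "\<dots> \<le> \<gamma> c * (\<alpha> * w x)"
    using integral_w[OF d] \<gamma>_nonneg[OF c] by (simp add: mult_left_mono)
  also have "\<dots> = \<alpha> * (\<gamma> c * w x)" by simp
  also have "\<dots> \<le> max 1 \<alpha> * (\<gamma> c * w x)"
    using \<gamma>_nonneg[OF c] w_pos[OF D_states[OF d]] by (intro mult_right_mono) auto
  finally have "(\<integral>y. \<bar>real_discount (v y) - real_discount (v' y)\<bar> \<partial>?N) \<le> \<psi> c * w x"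
    by (simp add: \<psi>_def)
  moreover have "action_value v (x, a) - action_value v' (x, a) =
      (\<integral>y. real_discount (v y) - real_discount (v' y) \<partial>?N)"
    using int by (simp add: action_value_def)
  ultimately show ?thesis
    using integral_abs_bound[of ?N "\<lambda>y. real_discount (v y) - real_discount (v' y)"] by linarith
qed

lemma action_value_bound:
  assumes d: "(x, a) \<in> D" and v: "v \<in> weighted_ball C" and C: "0 \<le> C" "\<kappa> + \<psi> C \<le> C"
  shows "\<bar>action_value v (x, a)\<bar> \<le> C * w x"
proof -
  have "\<bar>action_value v (x, a) - action_value (\<lambda>_. 0) (x, a)\<bar> \<le> \<psi> C * w x"
    using weighted_ballD(2)[OF v] C
    by (intro action_value_contraction[OF d v zero_weighted_ball[of 0]]) auto
  moreover have "\<bar>action_value (\<lambda>_. 0) (x, a)\<bar> \<le> \<kappa> * w x"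
    using abs_real_utility[OF d] by (simp add: action_value_def)
  ultimately have "\<bar>action_value v (x, a)\<bar> \<le> (\<kappa> + \<psi> C) * w x"
    unfolding distrib_right by linarith
  also have "\<dots> \<le> C * w x" using C w_pos[OF D_states[OF d]] by (intro mult_right_mono) auto
  finally show ?thesis .
qed

lemma action_value_mono:
  assumes d: "d \<in> D" and v: "v \<in> weighted_ball C" and v': "v' \<in> weighted_ball C'"
    and le: "\<And>y. y \<in> X \<Longrightarrow> v y \<le> v' y"
  shows "action_value v d \<le> action_value v' d"
  unfolding action_value_def
  by (intro add_left_mono integral_mono integrable_weighted[OF d real_discount_weighted_ball[OF v]]
      integrable_weighted[OF d real_discount_weighted_ball[OF v']])
    (auto intro: real_discount_mono le simp: space_Q[OF d])

end

section \<open>The Bellman operator and value iteration\<close>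

context weighted_mdp
begin

text \<open>
  A radius whose weighted ball is mapped into itself by all one-stage operators.
\<close>
definition radius :: real where
  "radius = (SOME R. 0 \<le> R \<and> \<kappa> + \<psi> R \<le> R)"

lemma radius: "0 \<le> radius" "\<kappa> + \<psi> radius \<le> radius"
proof -
  have "\<exists>R. 0 \<le> R \<and> \<kappa> + \<psi> R \<le> R" using invariant_radius[of \<kappa>] by blast
  from someI_ex[OF this] show "0 \<le> radius" "\<kappa> + \<psi> radius \<le> radius"
    by (simp_all add: radius_def)
qed

text \<open>
  The Bellman operator on real functions. On weighted balls the supremum is finite
  (\<open>le_real_bellman\<close>), and the operator agrees with \<^const>\<open>bellman_op\<close> (\<open>ereal_real_bellman\<close>).
\<close>
definition real_bellman :: "('x \<Rightarrow> real) \<Rightarrow> 'x \<Rightarrow> real" where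
  "real_bellman v x = (SUP a\<in>A x. action_value v (x, a))"

lemma le_real_bellman:
  assumes d: "(x, a) \<in> D" and v: "v \<in> weighted_ball C"
  shows "action_value v (x, a) \<le> real_bellman v x"
proof -
  \<comment> \<open>The bound of \<open>action_value_bound\<close> needs an invariant radius, and \<open>C\<close> need not be one.\<close>
  obtain R0 where R0: "0 \<le> R0" "\<forall>R\<ge>R0. \<kappa> + \<psi> R \<le> R" using invariant_radius by blast
  define R where "R = max C R0"
  have R: "v \<in> weighted_ball R" "0 \<le> R" "\<kappa> + \<psi> R \<le> R"
    using R0 weighted_ball_mono[OF _ v, of R] by (auto simp: R_def)
  have "bdd_above ((\<lambda>a. action_value v (x, a)) ` A x)"
    using action_value_bound[OF _ R] by (intro bdd_aboveI2[of _ _ "R * w x"]) (force simp: A_iff abs_le_iff)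
  then show ?thesis
    unfolding real_bellman_def using d by (intro cSUP_upper) (simp_all add: A_iff)
qed

lemma real_bellman_le:
  assumes "x \<in> X" and "\<And>a. (x, a) \<in> D \<Longrightarrow> action_value v (x, a) \<le> c"
  shows "real_bellman v x \<le> c"
  unfolding real_bellman_def using assms A_nonempty by (intro cSUP_least) (auto simp: A_iff)

lemma ereal_real_bellman:
  assumes x: "x \<in> X" and v: "v \<in> weighted_ball C" and V: "\<And>y. y \<in> X \<Longrightarrow> V y = ereal (v y)"
  shows "bellman_op M V x = ereal (real_bellman v x)"
proof -
  have "bellman_op M V x = (SUP a\<in>A x. ereal (action_value v (x, a)))"
    unfolding bellman_op_def using ereal_action_value[OF _ v V] by (intro SUP_cong) (auto simp: A_iff)
  also have "\<dots> = ereal (real_bellman v x)"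
  proof (rule SUP_eqI)
    fix a assume "a \<in> A x"
    then show "ereal (action_value v (x, a)) \<le> ereal (real_bellman v x)"
      using le_real_bellman[OF _ v] by (simp add: A_iff)
  next
    fix y assume y: "\<And>a. a \<in> A x \<Longrightarrow> ereal (action_value v (x, a)) \<le> y"
    obtain a where "a \<in> A x" using A_nonempty[OF x] by blast
    with y have "y \<noteq> -\<infinity>" by fastforce
    then show "ereal (real_bellman v x) \<le> y"
      using real_bellman_le[OF x, of v] y by (cases y) (auto simp: A_iff)
  qed
  finally show ?thesis .
qed

lemma real_bellman_contraction:
  assumes x: "x \<in> X" and v: "v \<in> weighted_ball C" and v': "v' \<in> weighted_ball C'"
    and c: "0 \<le> c" and diff: "\<And>y. y \<in> X \<Longrightarrow> \<bar>v y - v' y\<bar> \<le> c * w y"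
  shows "\<bar>real_bellman v x - real_bellman v' x\<bar> \<le> \<psi> c * w x"
proof -
  have le: "\<bar>action_value v (x, a) - action_value v' (x, a)\<bar> \<le> \<psi> c * w x" if "(x, a) \<in> D" for a
    by (rule action_value_contraction[OF that v v' c diff])
  have "real_bellman v x \<le> real_bellman v' x + \<psi> c * w x"
  proof (rule real_bellman_le[OF x])
    fix a assume a: "(x, a) \<in> D"
    show "action_value v (x, a) \<le> real_bellman v' x + \<psi> c * w x"
      using le[OF a] le_real_bellman[OF a v'] by linarith
  qed
  moreover have "real_bellman v' x \<le> real_bellman v x + \<psi> c * w x"
  proof (rule real_bellman_le[OF x])
    fix a assume a: "(x, a) \<in> D"
    show "action_value v' (x, a) \<le> real_bellman v x + \<psi> c * w x"
      using le[OF a] le_real_bellman[OF a v] by linarith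
  qed
  ultimately show ?thesis by linarith
qed

lemma decision_rule_graph:
  assumes "f \<in> decision_rules M"
  shows "(\<lambda>x. (x, f x)) \<in> borel_on X \<rightarrow>\<^sub>M borel_on D" and "x \<in> X \<Longrightarrow> (x, f x) \<in> D"
proof -
  show D: "(x, f x) \<in> D" if "x \<in> X" for x
    using assms that by (auto simp: decision_rules_def A_iff)
  have "f \<in> borel_on X \<rightarrow>\<^sub>M borel"
    using assms by (auto simp: decision_rules_def measurable_restrict_space2_iff)
  moreover have "(\<lambda>x. x) \<in> borel_on X \<rightarrow>\<^sub>M borel"
    by (rule measurable_restrict_space1) simp
  ultimately have "(\<lambda>x. (x, f x)) \<in> borel_on X \<rightarrow>\<^sub>M borel \<Otimes>\<^sub>M borel"
    by (intro measurable_Pair)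
  then show "(\<lambda>x. (x, f x)) \<in> borel_on X \<rightarrow>\<^sub>M borel_on D"
    using D by (intro measurable_restrict_space2) (auto simp: space_X borel_prod)
qed

lemma real_bellman_bound:
  assumes x: "x \<in> X" and v: "v \<in> weighted_ball C" and C: "0 \<le> C" "\<kappa> + \<psi> C \<le> C"
  shows "\<bar>real_bellman v x\<bar> \<le> C * w x"
proof -
  have le: "\<bar>action_value v (x, a)\<bar> \<le> C * w x" if "(x, a) \<in> D" for a
    by (rule action_value_bound[OF that v C])
  obtain a where a: "(x, a) \<in> D" using A_nonempty[OF x] A_iff by blast
  have "real_bellman v x \<le> C * w x"
    by (rule real_bellman_le[OF x]) (use le in \<open>auto simp: abs_le_iff\<close>)
  moreover have "- (C * w x) \<le> real_bellman v x"
    using le_real_bellman[OF a v] le[OF a] by linarith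
  ultimately show ?thesis by linarith
qed

end

text \<open>
  What the topological assumptions contribute: a class of functions that contains 0, is closed
  under the Bellman operator and weighted uniform limits, and for whose members the maximizer
  theorem applies. It is the class of upper semicontinuous functions under (W), and the class of all
  functions under (S).
\<close>
locale regular_mdp = weighted_mdp M \<gamma> \<alpha> \<kappa>
  for M :: "('x::polish_space, 'a::polish_space) mdp" and \<gamma> :: "real \<Rightarrow> real" and \<alpha> \<kappa> :: real +
  fixes good :: "('x \<Rightarrow> real) \<Rightarrow> bool"
  assumes compact_A: "x \<in> states M \<Longrightarrow> compact (admissible M x)"
    and good_zero: "good (\<lambda>_. 0)"
    and good_upper: "v \<in> weighted_ball C \<Longrightarrow> good v \<Longrightarrow> x \<in> states M \<Longrightarrow>
      closed {a \<in> admissible M x. c \<le> action_value v (x, a)}"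
    and good_bellman: "v \<in> weighted_ball C \<Longrightarrow> good v \<Longrightarrow> good (real_bellman v)"
    and good_limit: "(\<And>n::nat. u n \<in> weighted_ball C) \<Longrightarrow> (\<And>n. good (u n)) \<Longrightarrow>
      (\<And>n x. x \<in> states M \<Longrightarrow> \<bar>u n x - v' x\<bar> \<le> e n * weight M x) \<Longrightarrow> e \<longlonglongrightarrow> 0 \<Longrightarrow> good v'"
begin

lemma maximizer_exists:
  assumes v: "v \<in> weighted_ball C" "good v"
  shows "\<exists>f\<in>decision_rules M. \<forall>x\<in>X. action_value v (x, f x) = real_bellman v x"
proof -
  have sections: "{a. (x, a) \<in> D} = A x" for x by (auto simp: A_iff)
  have empty: "A x = {}" if "x \<notin> X" for x
    using that D_states by (auto simp: A_iff)
  have "compact {a. (x, a) \<in> D}" for x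
    unfolding sections by (cases "x \<in> X") (simp_all add: compact_A empty)
  moreover have "closed {a. (x, a) \<in> D \<and> c \<le> action_value v (x, a)}" for x c
    using good_upper[OF v, of x c] empty[of x] by (cases "x \<in> X") (simp_all flip: A_iff)
  ultimately have "\<exists>f\<in>borel_measurable (borel_on X). \<forall>x\<in>X. (x, f x) \<in> D \<and>
      (\<forall>a. (x, a) \<in> D \<longrightarrow> action_value v (x, a) \<le> action_value v (x, f x))"
    unfolding fst_D[symmetric]
    by (intro measurable_maximizer D_borel action_value_measurable[OF v(1)])
  then obtain f where f: "f \<in> borel_measurable (borel_on X)"
    "\<And>x. x \<in> X \<Longrightarrow> (x, f x) \<in> D"
    "\<And>x a. x \<in> X \<Longrightarrow> (x, a) \<in> D \<Longrightarrow> action_value v (x, a) \<le> action_value v (x, f x)"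
    by blast
  have "f x \<in> actions M" if "x \<in> X" for x
    using f(2)[OF that] D_subset by blast
  then have "f \<in> decision_rules M"
    using f(1,2) unfolding decision_rules_def
    by (auto simp: A_iff space_X intro!: measurable_restrict_space2)
  moreover have "action_value v (x, f x) = real_bellman v x" if "x \<in> X" for x
    using real_bellman_le[OF that f(3)[OF that]] le_real_bellman[OF f(2)[OF that] v(1)] by (rule antisym[rotated])
  ultimately show ?thesis by blast
qed

lemma real_bellman_weighted_ball:
  assumes v: "v \<in> weighted_ball C" "good v" and C: "0 \<le> C" "\<kappa> + \<psi> C \<le> C"
  shows "real_bellman v \<in> weighted_ball C"
proof -
  obtain f where f: "f \<in> decision_rules M" "\<forall>x\<in>X. action_value v (x, f x) = real_bellman v x"
    using maximizer_exists[OF v] by blast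
  have "(\<lambda>x. action_value v (x, f x)) \<in> borel_measurable (borel_on X)"
    by (rule measurable_compose[OF decision_rule_graph(1)[OF f(1)] action_value_measurable[OF v(1)]])
  then have "real_bellman v \<in> borel_measurable (borel_on X)"
    by (rule measurable_cong[THEN iffD1, rotated]) (simp add: f space_X)
  then show ?thesis
    using real_bellman_bound[OF _ v(1) C] by (simp add: weighted_ball_def)
qed

definition value_iterate :: "nat \<Rightarrow> 'x \<Rightarrow> real" where
  "value_iterate n = (real_bellman ^^ n) (\<lambda>_. 0)"

lemma value_iterate_simps: "value_iterate 0 = (\<lambda>_. 0)" "value_iterate (Suc n) = real_bellman (value_iterate n)"
  by (simp_all add: value_iterate_def)

lemma value_iterate: "value_iterate n \<in> weighted_ball radius" "good (value_iterate n)"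
proof (induction n)
  case (Suc n)
  case 1 show ?case unfolding value_iterate_simps by (rule real_bellman_weighted_ball[OF Suc radius])
  case 2 show ?case unfolding value_iterate_simps by (rule good_bellman[OF Suc])
qed (simp_all add: value_iterate_simps zero_weighted_ball radius good_zero)

lemma ereal_value_iterate: "x \<in> X \<Longrightarrow> (bellman_op M ^^ n) (\<lambda>_. 0) x = ereal (value_iterate n x)"
proof (induction n arbitrary: x)
  case (Suc n)
  then show ?case
    using ereal_real_bellman[OF Suc.prems value_iterate(1)[of n]] by (simp add: value_iterate_simps)
qed (simp add: value_iterate_simps zero_ereal_def)

lemma iterate_radius_nonneg: "0 \<le> (\<psi> ^^ n) radius"
  by (rule iterate_nonneg[OF radius(1)])

lemma value_iterate_diff:
  "x \<in> X \<Longrightarrow> \<bar>value_iterate n x - value_iterate (n + k) x\<bar> \<le> (\<psi> ^^ n) radius * w x"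
proof (induction n arbitrary: x)
  case 0
  then show ?case using weighted_ballD(2)[OF value_iterate(1)[of k]] by (simp add: value_iterate_simps)
next
  case (Suc n)
  show ?case
    using real_bellman_contraction[OF Suc.prems value_iterate(1) value_iterate(1) iterate_radius_nonneg Suc.IH]
    by (simp add: value_iterate_simps)
qed

text \<open>
  The value function, as the limit of value iteration started at 0.
\<close>
definition value_fun :: "'x \<Rightarrow> real" where
  "value_fun x = lim (\<lambda>n. value_iterate n x)"

lemma value_iterate_tendsto:
  assumes x: "x \<in> X"
  shows "(\<lambda>n. value_iterate n x) \<longlonglongrightarrow> value_fun x"
proof -
  have "\<bar>value_iterate (n + k) x - value_iterate n x\<bar> \<le> (\<psi> ^^ n) radius * w x" for n k
    using value_iterate_diff[OF x, of n k] by (simp add: abs_minus_commute)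
  from convergent_iterate_bound[OF radius(1) this]
  show ?thesis unfolding value_fun_def by (simp add: convergent_LIMSEQ_iff)
qed

lemma value_iterate_close:
  assumes x: "x \<in> X"
  shows "\<bar>value_iterate n x - value_fun x\<bar> \<le> (\<psi> ^^ n) radius * w x"
proof (rule LIMSEQ_le_const2)
  show "(\<lambda>k. \<bar>value_iterate n x - value_iterate (n + k) x\<bar>) \<longlonglongrightarrow> \<bar>value_iterate n x - value_fun x\<bar>"
    using LIMSEQ_ignore_initial_segment[OF value_iterate_tendsto[OF x], of n]
    by (intro tendsto_intros) (simp add: add.commute)
qed (use value_iterate_diff[OF x] in blast)

lemma value_fun: "value_fun \<in> weighted_ball radius" "good value_fun"
proof -
  have "value_fun \<in> borel_measurable (borel_on X)"
    by (rule borel_measurable_LIMSEQ_real[of _ value_iterate])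
      (simp_all add: value_iterate_tendsto space_X weighted_ballD(1)[OF value_iterate(1)])
  moreover have "\<bar>value_fun x\<bar> \<le> radius * w x" if "x \<in> X" for x
    using value_iterate_close[OF that, of 0] by (simp add: value_iterate_simps)
  ultimately show "value_fun \<in> weighted_ball radius"
    by (simp add: weighted_ball_def)
  show "good value_fun"
    by (rule good_limit[OF value_iterate value_iterate_close iterate_tendsto_0[OF radius(1)]])
qed

lemma real_bellman_value_fun:
  assumes x: "x \<in> X"
  shows "real_bellman value_fun x = value_fun x"
proof -
  have close: "\<bar>value_iterate (Suc n) x - real_bellman value_fun x\<bar> \<le> (\<psi> ^^ Suc n) radius * w x" for n
    using real_bellman_contraction[OF x value_iterate(1)[of n] value_fun(1) iterate_radius_nonneg value_iterate_close]
    by (simp add: value_iterate_simps)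
  have "(\<lambda>n. (\<psi> ^^ n) radius * w x) \<longlonglongrightarrow> 0"
    by (intro tendsto_mult_left_zero iterate_tendsto_0 radius)
  then have "(\<lambda>n. (\<psi> ^^ Suc n) radius * w x) \<longlonglongrightarrow> 0"
    by (rule LIMSEQ_Suc)
  with close have "(\<lambda>n. value_iterate (Suc n) x - real_bellman value_fun x) \<longlonglongrightarrow> 0"
    unfolding real_norm_def[symmetric] by (rule Lim_null_comparison[OF always_eventually[OF allI]])
  then have "(\<lambda>n. value_iterate (Suc n) x) \<longlonglongrightarrow> real_bellman value_fun x"
    by (rule LIM_zero_cancel)
  then show ?thesis
    by (rule LIMSEQ_unique[OF _ LIMSEQ_Suc[OF value_iterate_tendsto[OF x]]])
qed

text \<open>
  The function \<open>v\<close> is not assumed to be good, since solutions of the Bellman equation are only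
  required to be measurable and bounded.
\<close>
lemma fixed_point_unique:
  assumes v: "v \<in> weighted_ball C" and fixed: "\<And>x. x \<in> X \<Longrightarrow> real_bellman v x = v x" and x: "x \<in> X"
  shows "v x = value_fun x"
proof -
  define c where "c = \<bar>C\<bar> + radius"
  have c: "0 \<le> c" using radius by (simp add: c_def)
  have diff: "\<bar>v x - value_fun x\<bar> \<le> (\<psi> ^^ n) c * w x" if "x \<in> X" for n x
    using that
  proof (induction n arbitrary: x)
    case 0
    have "C * w x \<le> \<bar>C\<bar> * w x" using w_pos[OF 0] by (intro mult_right_mono) auto
    then show ?case
      using weighted_ballD(2)[OF v 0] weighted_ballD(2)[OF value_fun(1) 0]
      by (simp add: c_def distrib_right)
  next
    case (Suc n)
    show ?case
      using real_bellman_contraction[OF Suc.prems v value_fun(1) iterate_nonneg[OF c] Suc.IH]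
      by (simp add: fixed[OF Suc.prems] real_bellman_value_fun[OF Suc.prems])
  qed
  have "(\<lambda>n. (\<psi> ^^ n) c * w x) \<longlonglongrightarrow> 0"
    by (intro tendsto_mult_left_zero iterate_tendsto_0 c)
  then have "\<bar>v x - value_fun x\<bar> \<le> 0"
    by (rule LIMSEQ_le_const) (use diff[OF x] in auto)
  then show ?thesis by simp
qed

end

section \<open>Policies and recursive utility\<close>

context weighted_mdp
begin

abbreviation H where "H \<equiv> history_space M"

lemma space_H: "(d, x) \<in> space (H k) \<longleftrightarrow> d \<in> {1..<k} \<rightarrow>\<^sub>E D \<and> x \<in> X"
  by (simp add: history_space_def space_pair_measure space_PiM space_D space_X)

text \<open>
  The analogue of \<^const>\<open>weighted_ball\<close> for functions of the histories up to stage \<open>k\<close>; the weight is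
  that of the current state.
\<close>
definition history_ball :: "nat \<Rightarrow> real \<Rightarrow> (('x, 'a) history \<Rightarrow> real) set" where
  "history_ball k C = {V \<in> borel_measurable (H k). \<forall>(d, x)\<in>space (H k). \<bar>V (d, x)\<bar> \<le> C * w x}"

lemma history_ballD:
  assumes "V \<in> history_ball k C"
  shows "V \<in> borel_measurable (H k)" and "(d, x) \<in> space (H k) \<Longrightarrow> \<bar>V (d, x)\<bar> \<le> C * w x"
  using assms by (auto simp: history_ball_def)

lemma history_ball_section:
  assumes V: "V \<in> history_ball k C" and d: "d \<in> {1..<k} \<rightarrow>\<^sub>E D"
  shows "(\<lambda>y. V (d, y)) \<in> weighted_ball C"
proof -
  have "d \<in> space (\<Pi>\<^sub>M i\<in>{1..<k}. borel_on D)" using d by (simp add: space_PiM space_D)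
  then have "(\<lambda>y. V (d, y)) \<in> borel_measurable (borel_on X)"
    by (rule measurable_Pair2[OF history_ballD(1)[OF V, unfolded history_space_def]])
  moreover have "\<bar>V (d, y)\<bar> \<le> C * w y" if "y \<in> X" for y
    using history_ballD(2)[OF V] d that by (simp add: space_H)
  ultimately show ?thesis by (simp add: weighted_ball_def)
qed

lemma weighted_ball_history_ball:
  assumes v: "v \<in> weighted_ball C"
  shows "(\<lambda>h. v (snd h)) \<in> history_ball k C"
proof -
  have "(\<lambda>h. v (snd h)) \<in> borel_measurable (H k)"
    unfolding history_space_def by (rule measurable_compose[OF measurable_snd weighted_ballD(1)[OF v]])
  then show ?thesis using weighted_ballD(2)[OF v] by (auto simp: history_ball_def space_H)
qed

text \<open>
  The operator \<^const>\<open>policy_op\<close> on real functions.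
\<close>
definition real_policy_op :: "(nat \<Rightarrow> ('x, 'a) history \<Rightarrow> 'a) \<Rightarrow> nat \<Rightarrow>
    (('x, 'a) history \<Rightarrow> real) \<Rightarrow> ('x, 'a) history \<Rightarrow> real" where
  "real_policy_op \<pi> k V = (\<lambda>(d, x). let a = \<pi> k (d, x) in
     action_value (\<lambda>y. V (d(k := (x, a)), y)) (x, a))"

lemma policy_D:
  assumes "\<pi> \<in> policies M" "1 \<le> k" "(d, x) \<in> space (H k)"
  shows "(x, \<pi> k (d, x)) \<in> D"
  using assms unfolding policies_def by (auto simp: A_iff)

lemma history_extend:
  assumes "1 \<le> k" "(d, x) \<in> space (H k)" "(x, a) \<in> D"
  shows "d(k := (x, a)) \<in> {1..<Suc k} \<rightarrow>\<^sub>E D"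
proof -
  have "{1..<Suc k} = insert k {1..<k}" using assms(1) by auto
  then show ?thesis using assms by (simp add: space_H fun_upd_in_PiE) (auto simp: PiE_iff extensional_def)
qed

lemma stationary_policy:
  assumes f: "f \<in> decision_rules M"
  shows "stationary f \<in> policies M"
proof -
  have "(\<lambda>(d, x). f x) \<in> H n \<rightarrow>\<^sub>M borel_on (actions M)" for n
    unfolding history_space_def case_prod_unfold
    using f by (intro measurable_compose[OF measurable_snd]) (auto simp: decision_rules_def)
  then show ?thesis
    using f by (auto simp: policies_def stationary_def decision_rules_def space_H)
qed

text \<open>
  Measurability of a parametric integral: both the kernel and the integrand \<open>F\<close> depend on the
  history.
\<close>
lemma real_policy_op_measurable:
  assumes \<pi>: "\<pi> \<in> policies M" and k: "1 \<le> k" and V: "V \<in> history_ball (Suc k) C"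
  shows "real_policy_op \<pi> k V \<in> borel_measurable (H k)"
proof -
  define act where "act h = (snd h, \<pi> k h)" for h
  have act_D: "act h \<in> D" if "h \<in> space (H k)" for h
    using policy_D[OF \<pi> k, of "fst h" "snd h"] that by (simp add: act_def)
  have "\<pi> k \<in> H k \<rightarrow>\<^sub>M borel_on (actions M)"
    using \<pi> k unfolding policies_def by blast
  then have "\<pi> k \<in> H k \<rightarrow>\<^sub>M borel"
    by (simp add: measurable_restrict_space2_iff)
  moreover have "snd \<in> H k \<rightarrow>\<^sub>M borel_on X"
    unfolding history_space_def by (rule measurable_snd)
  then have "snd \<in> H k \<rightarrow>\<^sub>M borel"
    by (simp add: measurable_restrict_space2_iff)
  ultimately have "act \<in> H k \<rightarrow>\<^sub>M borel \<Otimes>\<^sub>M borel"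
    unfolding act_def by (intro measurable_Pair)
  then have act: "act \<in> H k \<rightarrow>\<^sub>M borel_on D"
    using act_D by (intro measurable_restrict_space2) (auto simp: borel_prod)
  have Q_act: "(\<lambda>h. Q (act h)) \<in> H k \<rightarrow>\<^sub>M subprob_algebra (borel_on X)"
    by (rule measurable_compose[OF act measurable_prob_algebraD[OF kernel_measurable]])
  have "(\<lambda>p. (fst (fst p))(k := act (fst p))) \<in> H k \<Otimes>\<^sub>M borel_on X \<rightarrow>\<^sub>M (\<Pi>\<^sub>M i\<in>{1..<Suc k}. borel_on D)"
  proof (rule measurable_fun_upd[of _ "{1..<k}"])
    show "{1..<Suc k} = {1..<k} \<union> {k}" using k by auto
    show "(\<lambda>p. fst (fst p)) \<in> H k \<Otimes>\<^sub>M borel_on X \<rightarrow>\<^sub>M (\<Pi>\<^sub>M i\<in>{1..<k}. borel_on D)"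
      unfolding history_space_def by (intro measurable_compose[OF measurable_fst measurable_fst])
    show "(\<lambda>p. act (fst p)) \<in> H k \<Otimes>\<^sub>M borel_on X \<rightarrow>\<^sub>M borel_on D"
      by (rule measurable_compose[OF measurable_fst act])
  qed
  then have "(\<lambda>p. ((fst (fst p))(k := act (fst p)), snd p)) \<in> H k \<Otimes>\<^sub>M borel_on X \<rightarrow>\<^sub>M H (Suc k)"
    unfolding history_space_def[of M "Suc k"] by (intro measurable_Pair measurable_snd)
  from measurable_real_discount[OF measurable_compose[OF this history_ballD(1)[OF V]]]
  have next_V: "(\<lambda>p. real_discount (V ((fst (fst p))(k := act (fst p)), snd p)))
      \<in> borel_measurable (H k \<Otimes>\<^sub>M borel_on X)" .
  define F where "F h y = real_discount (V ((fst h)(k := act h), y))" for h y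
  have F: "(\<lambda>(h, y). F h y) \<in> borel_measurable (H k \<Otimes>\<^sub>M borel_on X)"
    using next_V by (simp add: F_def case_prod_unfold)
  then have F_pos: "(\<lambda>(h, y). ennreal (F h y)) \<in> borel_measurable (H k \<Otimes>\<^sub>M borel_on X)"
    and F_neg: "(\<lambda>(h, y). ennreal (- F h y)) \<in> borel_measurable (H k \<Otimes>\<^sub>M borel_on X)"
    unfolding case_prod_unfold by measurable
  have integrable: "integrable (Q (act h)) (F h)" if h: "h \<in> space (H k)" for h
  proof -
    have "(fst h)(k := act h) \<in> {1..<Suc k} \<rightarrow>\<^sub>E D"
      using history_extend[OF k, of "fst h" "snd h"] h act_D[OF h] by (simp add: act_def)
    from real_discount_weighted_ball[OF history_ball_section[OF V this]]
    show ?thesis unfolding F_def by (intro integrable_weighted act_D h)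
  qed
  \<comment> \<open>Positive and negative parts are integrated separately.\<close>
  have "(\<lambda>h. real_utility (act h) + (enn2real (\<integral>\<^sup>+ y. ennreal (F h y) \<partial>Q (act h)) -
      enn2real (\<integral>\<^sup>+ y. ennreal (- F h y) \<partial>Q (act h)))) \<in> borel_measurable (H k)"
    unfolding real_utility_def
    by (intro borel_measurable_add borel_measurable_diff borel_measurable_enn2real
        borel_measurable_real_of_ereal measurable_compose[OF act utility_measurable]
        nn_integral_measurable_subprob_algebra2[OF F_pos Q_act]
        nn_integral_measurable_subprob_algebra2[OF F_neg Q_act])
  then show ?thesis
    by (rule measurable_cong[THEN iffD1, rotated])
      (simp add: real_policy_op_def action_value_def case_prod_unfold Let_def act_def F_def
        real_lebesgue_integral_def[OF integrable, symmetric, unfolded F_def act_def])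
qed

lemma real_policy_op_history_ball:
  assumes \<pi>: "\<pi> \<in> policies M" and k: "1 \<le> k" and V: "V \<in> history_ball (Suc k) C"
    and C: "0 \<le> C" "\<kappa> + \<psi> C \<le> C"
  shows "real_policy_op \<pi> k V \<in> history_ball k C"
proof -
  have "\<bar>real_policy_op \<pi> k V (d, x)\<bar> \<le> C * w x" if h: "(d, x) \<in> space (H k)" for d x
  proof -
    note D = policy_D[OF \<pi> k h]
    show ?thesis
      unfolding real_policy_op_def
      using action_value_bound[OF D history_ball_section[OF V history_extend[OF k h D]] C]
      by (simp add: Let_def)
  qed
  then show ?thesis
    using real_policy_op_measurable[OF \<pi> k V] by (auto simp: history_ball_def)
qed

lemma ereal_real_policy_op:
  assumes \<pi>: "\<pi> \<in> policies M" and k: "1 \<le> k" and V: "V \<in> history_ball (Suc k) C"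
    and eq: "\<And>h. h \<in> space (H (Suc k)) \<Longrightarrow> U h = ereal (V h)" and h: "(d, x) \<in> space (H k)"
  shows "policy_op M \<pi> k U (d, x) = ereal (real_policy_op \<pi> k V (d, x))"
proof -
  note D = policy_D[OF \<pi> k h]
  note d = history_extend[OF k h D]
  show ?thesis
    unfolding real_policy_op_def policy_op_def
    using ereal_action_value[OF D history_ball_section[OF V d], of "\<lambda>y. U (d(k := (x, \<pi> k (d, x))), y)"] eq d
    by (simp add: Let_def space_H)
qed

lemma real_policy_op_contraction:
  assumes \<pi>: "\<pi> \<in> policies M" and k: "1 \<le> k"
    and V: "V \<in> history_ball (Suc k) C" and V': "V' \<in> history_ball (Suc k) C'"
    and c: "0 \<le> c"
    and diff: "\<And>d y. (d, y) \<in> space (H (Suc k)) \<Longrightarrow> \<bar>V (d, y) - V' (d, y)\<bar> \<le> c * w y"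
    and h: "(d, x) \<in> space (H k)"
  shows "\<bar>real_policy_op \<pi> k V (d, x) - real_policy_op \<pi> k V' (d, x)\<bar> \<le> \<psi> c * w x"
proof -
  note D = policy_D[OF \<pi> k h]
  note d = history_extend[OF k h D]
  show ?thesis
    unfolding real_policy_op_def
    using action_value_contraction[OF D history_ball_section[OF V d] history_ball_section[OF V' d] c] diff d
    by (simp add: Let_def space_H)
qed

lemma real_policy_op_le:
  assumes \<pi>: "\<pi> \<in> policies M" and k: "1 \<le> k"
    and V: "V \<in> history_ball (Suc k) C" and v: "v \<in> weighted_ball C'"
    and le: "\<And>d y. (d, y) \<in> space (H (Suc k)) \<Longrightarrow> V (d, y) \<le> v y"
    and h: "(d, x) \<in> space (H k)"
  shows "real_policy_op \<pi> k V (d, x) \<le> real_bellman v x"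
proof -
  note D = policy_D[OF \<pi> k h]
  note d = history_extend[OF k h D]
  have "real_policy_op \<pi> k V (d, x) \<le> action_value v (x, \<pi> k (d, x))"
    unfolding real_policy_op_def
    using action_value_mono[OF D history_ball_section[OF V d] v] le d by (simp add: Let_def space_H)
  also have "\<dots> \<le> real_bellman v x" by (rule le_real_bellman[OF D v])
  finally show ?thesis .
qed

text \<open>
  The composition of the operators of a policy for the stages \<open>k, \<dots>, n - 1\<close>, applied to a terminal
  reward \<open>V\<close> which depends on the history up to stage \<open>n\<close>.
\<close>
definition policy_value :: "(nat \<Rightarrow> ('x, 'a) history \<Rightarrow> 'a) \<Rightarrow> nat \<Rightarrow> nat \<Rightarrow>
    (('x, 'a) history \<Rightarrow> real) \<Rightarrow> ('x, 'a) history \<Rightarrow> real" where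
  "policy_value \<pi> k n V = foldr (real_policy_op \<pi>) [k..<n] V"

lemma policy_value_refl [simp]: "policy_value \<pi> n n V = V"
  by (simp add: policy_value_def)

lemma policy_value_step: "k < n \<Longrightarrow> policy_value \<pi> k n V = real_policy_op \<pi> k (policy_value \<pi> (Suc k) n V)"
  by (simp add: policy_value_def upt_conv_Cons)

lemma policy_value_split:
  "k \<le> m \<Longrightarrow> m \<le> n \<Longrightarrow> policy_value \<pi> k n V = policy_value \<pi> k m (policy_value \<pi> m n V)"
  using upt_add_eq_append[of k m "n - m"] by (simp add: policy_value_def)

lemma policy_value_history_ball:
  assumes "\<pi> \<in> policies M" and "0 \<le> C" "\<kappa> + \<psi> C \<le> C" and V: "V \<in> history_ball n C"
    and "k \<le> n" "1 \<le> k"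
  shows "policy_value \<pi> k n V \<in> history_ball k C"
  using \<open>k \<le> n\<close> \<open>1 \<le> k\<close>
proof (induction k rule: inc_induct)
  case (step k)
  then show ?case by (simp add: policy_value_step real_policy_op_history_ball assms)
qed (simp add: V)

lemma iterate_diff_Suc:
  assumes "k < n"
  shows "\<psi> ((\<psi> ^^ (n - Suc k)) c) = (\<psi> ^^ (n - k)) c"
proof -
  have "n - k = Suc (n - Suc k)" using assms by simp
  then show ?thesis by simp
qed

lemma policy_value_contraction:
  assumes \<pi>: "\<pi> \<in> policies M" and C: "0 \<le> C" "\<kappa> + \<psi> C \<le> C"
    and V: "V \<in> history_ball n C" and V': "V' \<in> history_ball n C" and c: "0 \<le> c"
    and diff: "\<And>d y. (d, y) \<in> space (H n) \<Longrightarrow> \<bar>V (d, y) - V' (d, y)\<bar> \<le> c * w y"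
    and "k \<le> n" "1 \<le> k" "(d, x) \<in> space (H k)"
  shows "\<bar>policy_value \<pi> k n V (d, x) - policy_value \<pi> k n V' (d, x)\<bar> \<le> (\<psi> ^^ (n - k)) c * w x"
  using \<open>k \<le> n\<close> \<open>1 \<le> k\<close> \<open>(d, x) \<in> space (H k)\<close>
proof (induction k arbitrary: d x rule: inc_induct)
  case (step k)
  have PV: "policy_value \<pi> (Suc k) n V \<in> history_ball (Suc k) C"
    and PV': "policy_value \<pi> (Suc k) n V' \<in> history_ball (Suc k) C"
    using step.hyps by (intro policy_value_history_ball[OF \<pi> C] V V'; simp)+
  have "\<bar>policy_value \<pi> k n V (d, x) - policy_value \<pi> k n V' (d, x)\<bar> \<le> \<psi> ((\<psi> ^^ (n - Suc k)) c) * w x"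
    unfolding policy_value_step[OF step.hyps(2)]
    using step by (intro real_policy_op_contraction[OF \<pi> _ PV PV'] iterate_nonneg[OF c] step.IH) auto
  then show ?case unfolding iterate_diff_Suc[OF step.hyps(2)] .
qed (simp add: diff)

lemma zero_history_ball: "0 \<le> C \<Longrightarrow> (\<lambda>_. 0) \<in> history_ball k C"
  using weighted_ball_history_ball[OF zero_weighted_ball] by simp

lemma ereal_policy_value:
  assumes \<pi>: "\<pi> \<in> policies M" and "k \<le> n" "1 \<le> k" "h \<in> space (H k)"
  shows "foldr (policy_op M \<pi>) [k..<n] (\<lambda>_. 0) h = ereal (policy_value \<pi> k n (\<lambda>_. 0) h)"
  using \<open>k \<le> n\<close> \<open>1 \<le> k\<close> \<open>h \<in> space (H k)\<close>
proof (induction k arbitrary: h rule: inc_induct)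
  case (step k)
  obtain d x where h: "h = (d, x)" by (cases h)
  have "policy_value \<pi> (Suc k) n (\<lambda>_. 0) \<in> history_ball (Suc k) radius"
    using step by (intro policy_value_history_ball[OF \<pi> radius] zero_history_ball radius) auto
  from ereal_real_policy_op[OF \<pi> step.prems(1) this step.IH, of d x] step.prems h
  show ?case
    using step.hyps by (simp add: policy_value_step upt_conv_Cons)
qed (simp add: zero_ereal_def)

lemma initial_history: "x \<in> X \<Longrightarrow> ((\<lambda>_. undefined), x) \<in> space (H 1)"
  by (simp add: space_H)

text \<open>
  The operators for the stages \<open>1, \<dots>, n\<close> are applied to the terminal reward 0 at stage \<open>n + 1\<close>.
\<close>
definition real_finite_utility :: "nat \<Rightarrow> 'x \<Rightarrow> (nat \<Rightarrow> ('x, 'a) history \<Rightarrow> 'a) \<Rightarrow> real" where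
  "real_finite_utility n x \<pi> = policy_value \<pi> 1 (Suc n) (\<lambda>_. 0) (\<lambda>_. undefined, x)"

lemma ereal_real_finite_utility:
  assumes "\<pi> \<in> policies M" "x \<in> X"
  shows "finite_utility M n x \<pi> = ereal (real_finite_utility n x \<pi>)"
  unfolding finite_utility_def real_finite_utility_def
  by (intro ereal_policy_value initial_history assms) auto

lemma real_finite_utility_diff:
  assumes \<pi>: "\<pi> \<in> policies M" and x: "x \<in> X"
  shows "\<bar>real_finite_utility (n + j) x \<pi> - real_finite_utility n x \<pi>\<bar> \<le> (\<psi> ^^ n) radius * w x"
proof -
  \<comment> \<open>The longer horizon is the shorter one with the terminal reward \<open>?V\<close>, which lies in the invariant ball, instead of 0.\<close>
  let ?V = "policy_value \<pi> (Suc n) (Suc (n + j)) (\<lambda>_. 0)"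
  have V: "?V \<in> history_ball (Suc n) radius"
    by (intro policy_value_history_ball \<pi> radius zero_history_ball) auto
  have "\<bar>policy_value \<pi> 1 (Suc n) ?V (\<lambda>_. undefined, x) - policy_value \<pi> 1 (Suc n) (\<lambda>_. 0) (\<lambda>_. undefined, x)\<bar>
      \<le> (\<psi> ^^ (Suc n - 1)) radius * w x"
    using history_ballD(2)[OF V]
    by (intro policy_value_contraction[OF \<pi> radius V zero_history_ball[OF radius(1)] radius(1)]
        initial_history x) auto
  then show ?thesis
    using policy_value_split[of 1 "Suc n" "Suc (n + j)" \<pi> "\<lambda>_. 0"] by (simp add: real_finite_utility_def)
qed

end

context regular_mdp
begin

lemma policy_value_le_value_iterate:
  assumes \<pi>: "\<pi> \<in> policies M" and "k \<le> n" "1 \<le> k" "(d, x) \<in> space (H k)"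
  shows "policy_value \<pi> k n (\<lambda>_. 0) (d, x) \<le> value_iterate (n - k) x"
  using \<open>k \<le> n\<close> \<open>1 \<le> k\<close> \<open>(d, x) \<in> space (H k)\<close>
proof (induction k arbitrary: d x rule: inc_induct)
  case (step k)
  have "policy_value \<pi> (Suc k) n (\<lambda>_. 0) \<in> history_ball (Suc k) radius"
    using step by (intro policy_value_history_ball[OF \<pi> radius] zero_history_ball radius) auto
  from real_policy_op_le[OF \<pi> step.prems(1) this value_iterate(1) step.IH step.prems(2)]
  have "policy_value \<pi> k n (\<lambda>_. 0) (d, x) \<le> value_iterate (Suc (n - Suc k)) x"
    by (simp add: policy_value_step[OF step.hyps(2)] value_iterate_simps)
  then show ?case using step.hyps(2) by (simp add: Suc_diff_Suc)
qed (simp add: value_iterate_simps)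

lemma real_finite_utility_le:
  "\<pi> \<in> policies M \<Longrightarrow> x \<in> X \<Longrightarrow> real_finite_utility n x \<pi> \<le> value_iterate n x"
  unfolding real_finite_utility_def
  using policy_value_le_value_iterate[of \<pi> 1 "Suc n" "\<lambda>_. undefined" x] initial_history by simp

lemma recursive_utility_le:
  assumes \<pi>: "\<pi> \<in> policies M" and x: "x \<in> X"
  shows "recursive_utility M x \<pi> \<le> ereal (value_fun x)"
proof -
  have "convergent (\<lambda>n. real_finite_utility n x \<pi>)"
    by (rule convergent_iterate_bound[OF radius(1) real_finite_utility_diff[OF \<pi> x]])
  then obtain l where l: "(\<lambda>n. real_finite_utility n x \<pi>) \<longlonglongrightarrow> l"
    by (auto simp: convergent_def)
  then have "(\<lambda>n. finite_utility M n x \<pi>) \<longlonglongrightarrow> ereal l"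
    by (simp add: ereal_real_finite_utility[OF \<pi> x])
  then have "recursive_utility M x \<pi> = ereal l"
    unfolding recursive_utility_def by (rule limI)
  moreover have "l \<le> value_fun x"
    using real_finite_utility_le[OF \<pi> x] by (intro LIMSEQ_le[OF l value_iterate_tendsto[OF x]]) blast
  ultimately show ?thesis by simp
qed

lemma recursive_utility_stationary:
  assumes f: "f \<in> decision_rules M" and opt: "\<And>x. x \<in> X \<Longrightarrow> action_value value_fun (x, f x) = value_fun x"
    and x: "x \<in> X"
  shows "recursive_utility M x (stationary f) = ereal (value_fun x)"
proof -
  let ?\<sigma> = "stationary f" and ?V = "\<lambda>h. value_fun (snd h)"
  note \<sigma> = stationary_policy[OF f]
  have V: "?V \<in> history_ball k radius" for k
    by (rule weighted_ball_history_ball[OF value_fun(1)])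
  have close: "\<bar>policy_value ?\<sigma> k n (\<lambda>_. 0) (d, x) - value_fun x\<bar> \<le> (\<psi> ^^ (n - k)) radius * w x"
    if "k \<le> n" "1 \<le> k" "(d, x) \<in> space (H k)" for k n d x
    using that
  proof (induction k arbitrary: d x rule: inc_induct)
    case base
    then show ?case using weighted_ballD(2)[OF value_fun(1)] by (simp add: space_H)
  next
    case (step k)
    have 0: "policy_value ?\<sigma> (Suc k) n (\<lambda>_. 0) \<in> history_ball (Suc k) radius"
      using step by (intro policy_value_history_ball[OF \<sigma> radius] zero_history_ball radius) auto
    have "\<bar>policy_value ?\<sigma> k n (\<lambda>_. 0) (d, x) - real_policy_op ?\<sigma> k ?V (d, x)\<bar> \<le>
        \<psi> ((\<psi> ^^ (n - Suc k)) radius) * w x"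
      unfolding policy_value_step[OF step.hyps(2)]
      using step.IH step.prems
      by (intro real_policy_op_contraction[OF \<sigma> _ 0 V] iterate_nonneg radius) auto
    moreover have "real_policy_op ?\<sigma> k ?V (d, x) = value_fun x"
      using opt[of x] step.prems by (simp add: real_policy_op_def stationary_def space_H)
    ultimately show ?case unfolding iterate_diff_Suc[OF step.hyps(2)] by simp
  qed
  have "\<bar>real_finite_utility n x ?\<sigma> - value_fun x\<bar> \<le> (\<psi> ^^ n) radius * w x" for n
    using close[of 1 "Suc n" "\<lambda>_. undefined" x] initial_history[OF x] by (simp add: real_finite_utility_def)
  moreover have "(\<lambda>n. (\<psi> ^^ n) radius * w x) \<longlonglongrightarrow> 0"
    by (intro tendsto_mult_left_zero iterate_tendsto_0 radius)
  ultimately have "(\<lambda>n. real_finite_utility n x ?\<sigma> - value_fun x) \<longlonglongrightarrow> 0"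
    unfolding real_norm_def[symmetric] by (rule Lim_null_comparison[OF always_eventually[OF allI]])
  then have "(\<lambda>n. real_finite_utility n x ?\<sigma>) \<longlonglongrightarrow> value_fun x"
    by (rule LIM_zero_cancel)
  then have "(\<lambda>n. finite_utility M n x ?\<sigma>) \<longlonglongrightarrow> ereal (value_fun x)"
    by (simp add: ereal_real_finite_utility[OF \<sigma> x])
  then show ?thesis
    unfolding recursive_utility_def by (rule limI)
qed

text \<open>
  The conclusions common to both sets of assumptions, in terms of extended real functions.
\<close>
lemma bellman_solution:
  defines "v \<equiv> \<lambda>x. ereal (value_fun x)"
  shows "solves_bellman M v"
    and "solves_bellman M u \<Longrightarrow> x \<in> X \<Longrightarrow> u x = v x"
    and "(\<lambda>m. weighted_norm M (\<lambda>x. (bellman_op M ^^ m) (\<lambda>_. 0) x - v x)) \<longlonglongrightarrow> 0"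
    and "x \<in> X \<Longrightarrow> v x = (SUP \<pi>\<in>policies M. recursive_utility M x \<pi>)"
    and "\<exists>f\<in>decision_rules M. (\<forall>x\<in>X. decision_op M f v x = v x) \<and> optimal_policy M (stationary f)"
proof -
  have norm_le: "weighted_norm M u \<le> ereal c" if "\<And>x. x \<in> X \<Longrightarrow> \<bar>u x\<bar> \<le> ereal (c * w x)" for u c
    unfolding weighted_norm_def
  proof (rule SUP_least)
    fix x assume x: "x \<in> X"
    have "\<bar>u x\<bar> / ereal (w x) \<le> ereal (c * w x) / ereal (w x)"
      using w_pos[OF x] by (intro ereal_divide_right_mono that x) simp
    then show "\<bar>u x\<bar> / ereal (w x) \<le> ereal c" using w_pos[OF x] by simp
  qed
  have "v \<in> measurable_funs X"
    using weighted_ballD(1)[OF value_fun(1)] by (simp add: measurable_funs_def v_def)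
  moreover have "weighted_norm M v \<le> ereal radius"
    using weighted_ballD(2)[OF value_fun(1)] by (intro norm_le) (simp add: v_def)
  ultimately have "v \<in> weighted_bounded M"
    by (auto simp: weighted_bounded_def intro: order.strict_trans1)
  then show "solves_bellman M v"
    using ereal_real_bellman[OF _ value_fun(1), of _ v] real_bellman_value_fun
    by (simp add: solves_bellman_def v_def)
  show "u x = v x" if u: "solves_bellman M u" and x: "x \<in> X"
  proof -
    have norm: "weighted_norm M u < \<infinity>" and meas: "u \<in> borel_measurable (borel_on X)"
      using u by (auto simp: solves_bellman_def weighted_bounded_def measurable_funs_def)
    have le_norm: "\<bar>u x\<bar> / ereal (w x) \<le> weighted_norm M u" if "x \<in> X" for x
      unfolding weighted_norm_def by (rule SUP_upper[OF that])
    obtain C where C: "weighted_norm M u = ereal C"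
    proof -
      have "0 \<le> \<bar>u x\<bar> / ereal (w x)" using w_pos[OF x] by simp
      then have "0 \<le> weighted_norm M u" using le_norm[OF x] by (rule order.trans)
      with norm show ?thesis using that by (cases "weighted_norm M u") auto
    qed
    have bound: "\<bar>u x\<bar> \<le> ereal (C * w x)" if "x \<in> X" for x
      using le_norm[OF that] w_pos[OF that] unfolding C
      by (cases "u x") (auto simp: pos_divide_le_eq)
    have real_u: "u x = ereal (real_of_ereal (u x))" if "x \<in> X" for x
      using bound[OF that] by (cases "u x") auto
    have "\<bar>real_of_ereal (u x)\<bar> \<le> C * w x" if "x \<in> X" for x
      using bound[OF that] by (cases "u x") auto
    then have ball: "(\<lambda>x. real_of_ereal (u x)) \<in> weighted_ball C"
      using borel_measurable_real_of_ereal[OF meas] by (simp add: weighted_ball_def)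
    have fixed: "real_bellman (\<lambda>x. real_of_ereal (u x)) x = real_of_ereal (u x)" if "x \<in> X" for x
      using ereal_real_bellman[OF that ball real_u] u that unfolding solves_bellman_def by simp
    show "u x = v x"
      using fixed_point_unique[OF ball fixed x] real_u[OF x] by (simp add: v_def)
  qed
  show "(\<lambda>m. weighted_norm M (\<lambda>x. (bellman_op M ^^ m) (\<lambda>_. 0) x - v x)) \<longlonglongrightarrow> 0"
  proof (rule tendsto_sandwich)
    show "\<forall>\<^sub>F m in sequentially. 0 \<le> weighted_norm M (\<lambda>x. (bellman_op M ^^ m) (\<lambda>_. 0) x - v x)"
    proof (intro always_eventually allI)
      fix m
      obtain x where x: "x \<in> X" using X_nonempty by blast
      show "0 \<le> weighted_norm M (\<lambda>x. (bellman_op M ^^ m) (\<lambda>_. 0) x - v x)"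
        unfolding weighted_norm_def using w_pos[OF x] by (intro SUP_upper2[OF x]) simp
    qed
    show "\<forall>\<^sub>F m in sequentially. weighted_norm M (\<lambda>x. (bellman_op M ^^ m) (\<lambda>_. 0) x - v x) \<le> ereal ((\<psi> ^^ m) radius)"
      using value_iterate_close
      by (intro always_eventually allI norm_le) (simp add: ereal_value_iterate v_def)
    show "(\<lambda>m. ereal ((\<psi> ^^ m) radius)) \<longlonglongrightarrow> 0"
      using iterate_tendsto_0[OF radius(1)] by (simp add: zero_ereal_def)
  qed simp
  obtain f where f: "f \<in> decision_rules M" "\<And>x. x \<in> X \<Longrightarrow> action_value value_fun (x, f x) = value_fun x"
    using maximizer_exists[OF value_fun] real_bellman_value_fun by metis
  note \<sigma> = stationary_policy[OF f(1)]
  have opt: "recursive_utility M x (stationary f) = v x" if "x \<in> X" for x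
    using recursive_utility_stationary[OF f that] by (simp add: v_def)
  have upper: "recursive_utility M x \<pi> \<le> v x" if "\<pi> \<in> policies M" "x \<in> X" for \<pi> x
    using recursive_utility_le[OF that] by (simp add: v_def)
  show "v x = (SUP \<pi>\<in>policies M. recursive_utility M x \<pi>)" if x: "x \<in> X"
  proof (rule antisym)
    show "v x \<le> (SUP \<pi>\<in>policies M. recursive_utility M x \<pi>)"
      by (rule SUP_upper2[OF \<sigma>]) (simp add: opt[OF x])
    show "(SUP \<pi>\<in>policies M. recursive_utility M x \<pi>) \<le> v x"
      by (rule SUP_least) (rule upper[OF _ x])
  qed
  have "decision_op M f v x = v x" if x: "x \<in> X" for x
    using ereal_action_value[OF decision_rule_graph(2)[OF f(1) x] value_fun(1), of v] f(2)[OF x]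
    by (simp add: decision_op_def v_def)
  moreover have "optimal_policy M (stationary f)"
    unfolding optimal_policy_def by (simp add: \<sigma> opt upper)
  ultimately show "\<exists>f\<in>decision_rules M. (\<forall>x\<in>X. decision_op M f v x = v x) \<and> optimal_policy M (stationary f)"
    using f(1) by blast
qed

end

section \<open>Upper semicontinuous functions and their integrals\<close>

lemma usc_on_ereal_iff:
  "usc_on S (\<lambda>x. ereal (f x)) \<longleftrightarrow> (\<forall>x\<in>S. \<forall>e>0. \<forall>\<^sub>F y in at x within S. f y < f x + e)"
proof -
  have "Limsup (at x within S) (\<lambda>x. ereal (f x)) \<le> ereal (f x) \<longleftrightarrow>
      (\<forall>e>0. \<forall>\<^sub>F y in at x within S. f y < f x + e)" for x
  proof (intro iffI allI impI)
    fix e :: real assume le: "Limsup (at x within S) (\<lambda>x. ereal (f x)) \<le> ereal (f x)" and "0 < e"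
    have "\<forall>\<^sub>F y in at x within S. ereal (f y) < ereal (f x + e)"
      using le[unfolded Limsup_le_iff, rule_format, of "ereal (f x + e)"] \<open>0 < e\<close> by simp
    then show "\<forall>\<^sub>F y in at x within S. f y < f x + e" by simp
  next
    assume f: "\<forall>e>0. \<forall>\<^sub>F y in at x within S. f y < f x + e"
    show "Limsup (at x within S) (\<lambda>x. ereal (f x)) \<le> ereal (f x)"
      unfolding Limsup_le_iff
    proof (intro allI impI)
      fix c assume c: "ereal (f x) < c"
      show "\<forall>\<^sub>F y in at x within S. ereal (f y) < c"
      proof (cases c)
        case (real r)
        then show ?thesis using f[rule_format, of "r - f x"] c by simp
      qed (use c in auto)
    qed
  qed
  then show ?thesis by (simp add: usc_on_def)
qed

lemma usc_onD:
  assumes "usc_on S (\<lambda>x. ereal (f x))" "x \<in> S" "0 < e"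
  shows "\<forall>\<^sub>F y in at x within S. f y < f x + e"
  using assms by (simp add: usc_on_ereal_iff)

lemma usc_on_cong:
  assumes "\<And>x. x \<in> S \<Longrightarrow> f x = g x"
  shows "usc_on S f \<longleftrightarrow> usc_on S g"
proof -
  have "Limsup (at x within S) f = Limsup (at x within S) g" for x
    by (rule Limsup_eq) (auto simp: eventually_at_filter assms)
  then show ?thesis using assms by (simp add: usc_on_def)
qed

lemma usc_on_add:
  assumes f: "usc_on S (\<lambda>x. ereal (f x))" and g: "usc_on S (\<lambda>x. ereal (g x))"
  shows "usc_on S (\<lambda>x. ereal (f x + g x))"
  unfolding usc_on_ereal_iff
proof (intro ballI allI impI)
  fix x and e :: real assume x: "x \<in> S" and "0 < e"
  then have "0 < e / 2" by simp
  from usc_onD[OF f x this] usc_onD[OF g x this]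
  show "\<forall>\<^sub>F y in at x within S. f y + g y < f x + g x + e"
    by eventually_elim simp
qed

lemma usc_on_iff_closedin:
  "usc_on S (\<lambda>x. ereal (f x)) \<longleftrightarrow> (\<forall>c. closedin (top_of_set S) {x \<in> S. c \<le> f x})"
proof -
  have complement: "closedin (top_of_set S) {x \<in> S. c \<le> f x} \<longleftrightarrow> openin (top_of_set S) {x \<in> S. f x < c}" for c
  proof -
    have "S - {x \<in> S. c \<le> f x} = {x \<in> S. f x < c}" by auto
    then show ?thesis by (simp add: closedin_def)
  qed
  show ?thesis
    unfolding complement
  proof (intro iffI allI)
    fix c assume usc: "usc_on S (\<lambda>x. ereal (f x))"
    show "openin (top_of_set S) {x \<in> S. f x < c}"
    proof (subst openin_subopen, intro ballI)
      fix x assume x: "x \<in> {x \<in> S. f x < c}"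
      then have "\<forall>\<^sub>F y in at x within S. f y < f x + (c - f x)"
        by (intro usc_onD[OF usc]) auto
      then obtain T where T: "open T" "x \<in> T" "\<forall>y\<in>T. y \<noteq> x \<longrightarrow> y \<in> S \<longrightarrow> f y < c"
        by (auto simp: eventually_at_topological)
      have "openin (top_of_set S) (S \<inter> T)" using T(1) by (rule openin_open_Int)
      moreover have "S \<inter> T \<subseteq> {x \<in> S. f x < c}" using T(3) x by auto
      ultimately show "\<exists>T. openin (top_of_set S) T \<and> x \<in> T \<and> T \<subseteq> {x \<in> S. f x < c}"
        using T(2) x by blast
    qed
  next
    assume *: "\<forall>c. openin (top_of_set S) {x \<in> S. f x < c}"
    show "usc_on S (\<lambda>x. ereal (f x))"
      unfolding usc_on_ereal_iff
    proof (intro ballI allI impI)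
      fix x and e :: real assume x: "x \<in> S" and "0 < e"
      from * obtain T where T: "open T" "{y \<in> S. f y < f x + e} = S \<inter> T"
        by (meson openin_open)
      have "x \<in> {y \<in> S. f y < f x + e}" using x \<open>0 < e\<close> by simp
      then have "x \<in> T" unfolding T(2) by blast
      moreover have "f y < f x + e" if "y \<in> T" "y \<in> S" for y
        using that T(2) by blast
      ultimately show "\<forall>\<^sub>F y in at x within S. f y < f x + e"
        unfolding eventually_at_topological using T(1) by blast
    qed
  qed
qed

lemma usc_on_compose:
  assumes f: "usc_on S (\<lambda>x. ereal (f x))" and g: "continuous_on T g" "g \<in> T \<rightarrow> S"
  shows "usc_on T (\<lambda>x. ereal (f (g x)))"
  unfolding usc_on_iff_closedin
proof
  fix c
  have "closedin (top_of_set T) (T \<inter> g -` {x \<in> S. c \<le> f x})"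
    using f unfolding usc_on_iff_closedin by (intro continuous_closedin_preimage_gen[OF g]) blast
  moreover have "T \<inter> g -` {x \<in> S. c \<le> f x} = {x \<in> T. c \<le> f (g x)}" using g(2) by auto
  ultimately show "closedin (top_of_set T) {x \<in> T. c \<le> f (g x)}" by simp
qed

lemma usc_on_closed_superlevel:
  "usc_on S (\<lambda>x. ereal (f x)) \<Longrightarrow> closed S \<Longrightarrow> closed {x \<in> S. c \<le> f x}"
  unfolding usc_on_iff_closedin by (auto intro: closedin_closed_trans)

text \<open>
  A nonnegative lower semicontinuous function is a limit from below of bounded Lipschitz functions,
  namely of the infimal convolutions of its truncations at \<open>n\<close> with \<open>n\<close> times the distance.
\<close>
lemma lsc_lipschitz_approximation:
  fixes k :: "'x::metric_space \<Rightarrow> real"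
  assumes nonneg: "\<And>x. x \<in> X \<Longrightarrow> 0 \<le> k x"
    and lsc: "usc_on X (\<lambda>x. ereal (- k x))" and "X \<noteq> {}"
  shows "\<exists>\<phi>. (\<forall>n::nat. continuous_on UNIV (\<phi> n) \<and> 
      (\<forall>x\<in>X. 0 \<le> \<phi> n x \<and> \<phi> n x \<le> real n \<and> \<phi> n x \<le> k x)) \<and> (\<forall>x\<in>X. (\<lambda>n. \<phi> n x) \<longlonglongrightarrow> k x)"
proof -
  define \<phi> where "\<phi> n x = (INF y\<in>X. min (real n) (k y) + real n * dist x y)" for n :: nat and x
  have lower: "0 \<le> min (real n) (k y) + real n * dist x y" if "y \<in> X" for n y x
    using nonneg[OF that] by simp
  have bdd: "bdd_below ((\<lambda>y. min (real n) (k y) + real n * dist x y) ` X)" for n x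
    using lower by (intro bdd_belowI2)
  have le: "\<phi> n x \<le> min (real n) (k y) + real n * dist x y" if "y \<in> X" for n x y
    unfolding \<phi>_def by (rule cINF_lower[OF bdd that])
  have ge: "c \<le> \<phi> n x" if "\<And>y. y \<in> X \<Longrightarrow> c \<le> min (real n) (k y) + real n * dist x y" for n x c
    unfolding \<phi>_def by (rule cINF_greatest[OF \<open>X \<noteq> {}\<close> that])
  have lipschitz: "\<phi> n x - \<phi> n z \<le> real n * dist x z" for n x z
  proof -
    have "\<phi> n x - real n * dist x z \<le> \<phi> n z"
    proof (rule ge)
      fix y assume "y \<in> X"
      have "real n * dist x y \<le> real n * (dist x z + dist z y)"
        by (intro mult_left_mono dist_triangle) simp
      then show "\<phi> n x - real n * dist x z \<le> min (real n) (k y) + real n * dist z y"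
        using le[OF \<open>y \<in> X\<close>, of n x] by (simp add: distrib_left)
    qed
    then show ?thesis by simp
  qed
  have "(real n)-lipschitz_on UNIV (\<phi> n)" for n
  proof (rule lipschitz_onI)
    show "dist (\<phi> n x) (\<phi> n z) \<le> real n * dist x z" for x z
      using lipschitz[of n x z] lipschitz[of n z x] by (simp add: dist_real_def dist_commute abs_le_iff)
  qed simp
  then have cont: "continuous_on UNIV (\<phi> n)" for n
    by (rule lipschitz_on_continuous_on)
  have upper: "\<phi> n x \<le> real n" if "x \<in> X" for n x
    using le[OF that, of n x] by simp
  have le_k: "\<phi> n x \<le> k x" if "x \<in> X" for n x
    using le[OF that, of n x] by simp
  have lim: "(\<lambda>n. \<phi> n x) \<longlonglongrightarrow> k x" if x: "x \<in> X" for x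
  proof (rule LIMSEQ_I)
    fix e :: real assume "0 < e"
    then have "0 < e / 2" by simp
    from usc_onD[OF lsc x this] have "\<forall>\<^sub>F y in at x within X. k x - e / 2 < k y"
      by eventually_elim simp
    then obtain r where r: "0 < r"
      "\<And>y. y \<in> X \<Longrightarrow> y \<noteq> x \<Longrightarrow> dist y x < r \<Longrightarrow> k x - e / 2 < k y"
      unfolding eventually_at by blast
    obtain N where N: "k x \<le> real N" "k x / r \<le> real N"
      using real_arch_simple[of "max (k x) (k x / r)"] by auto
    have close: "k x - e / 2 \<le> \<phi> n x" if "N \<le> n" for n
    proof (rule ge)
      fix y assume y: "y \<in> X"
      show "k x - e / 2 \<le> min (real n) (k y) + real n * dist x y"
      proof (cases "dist y x < r")
        case True
        then have "k x - e / 2 \<le> k y" using r(2)[OF y] \<open>0 < e\<close> by (cases "y = x") auto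
        moreover have "k x - e / 2 \<le> real n" using N(1) that \<open>0 < e\<close> by linarith
        moreover have "0 \<le> real n * dist x y" by simp
        ultimately show ?thesis by linarith
      next
        case False
        have "k x \<le> real N * r" using N(2) r(1) by (simp add: pos_divide_le_eq)
        also have "\<dots> \<le> real n * dist x y"
          using that False r(1) by (intro mult_mono) (auto simp: dist_commute)
        finally have "k x \<le> real n * dist x y" .
        then show ?thesis using nonneg[OF y] \<open>0 < e\<close> by linarith
      qed
    qed
    have "norm (\<phi> n x - k x) < e" if "N \<le> n" for n
      using close[OF that] le_k[OF x, of n] \<open>0 < e\<close> unfolding real_norm_def by linarith
    then show "\<exists>N. \<forall>n\<ge>N. norm (\<phi> n x - k x) < e" by blast
  qed
  show ?thesis using cont ge[OF lower] upper le_k lim by blast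
qed

context weighted_mdp
begin

lemma continuous_integral_w:
  fixes g :: "'p::topological_space \<Rightarrow> 'x \<times> 'a"
  assumes cont: "continuous_on E (\<lambda>p. \<integral>\<^sup>+ y. ennreal (w y) \<partial>Q (g p))" and g: "g \<in> E \<rightarrow> D"
  shows "continuous_on E (\<lambda>p. \<integral>y. w y \<partial>Q (g p))"
proof -
  have eq: "(\<integral>\<^sup>+ y. ennreal (w y) \<partial>Q (g p)) = ennreal (\<integral>y. w y \<partial>Q (g p))" if "p \<in> E" for p
  proof (rule nn_integral_eq_integral)
    have "g p \<in> D" using g that by auto
    then show "integrable (Q (g p)) w" using integrable_w[of "fst (g p)" "snd (g p)"] by simp
    show "AE y in Q (g p). 0 \<le> w y"
      using w_pos by (intro AE_I2) (auto simp: space_Q[OF \<open>g p \<in> D\<close>] intro: less_imp_le)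
  qed
  have nonneg: "0 \<le> (\<integral>y. w y \<partial>Q (g p))" if "p \<in> E" for p
    using g that w_pos by (intro integral_nonneg_AE AE_I2) (auto simp: space_Q Pi_iff intro: less_imp_le)
  have cont': "continuous_on E (\<lambda>p. ennreal (\<integral>y. w y \<partial>Q (g p)))"
    using cont by (simp add: eq cong: continuous_on_cong)
  have "continuous_on E (\<lambda>p. enn2real (ennreal (\<integral>y. w y \<partial>Q (g p))))"
    unfolding continuous_on_def
  proof
    fix p assume p: "p \<in> E"
    have "((\<lambda>p. enn2real (ennreal (\<integral>y. w y \<partial>Q (g p)))) \<longlongrightarrow> (\<integral>y. w y \<partial>Q (g p))) (at p within E)"
      using cont' p by (intro tendsto_enn2real nonneg) (auto simp: continuous_on_def)
    then show "((\<lambda>p. enn2real (ennreal (\<integral>y. w y \<partial>Q (g p)))) \<longlongrightarrow>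
        enn2real (ennreal (\<integral>y. w y \<partial>Q (g p)))) (at p within E)"
      by (simp only: enn2real_ennreal[OF nonneg[OF p]])
  qed
  then show ?thesis by (simp add: nonneg cong: continuous_on_cong)
qed

text \<open>
  Let \<open>\<phi> n\<close> converge to \<open>C w - h\<close> from below. If the integrals of \<open>\<phi> n\<close> depend continuously on the
  parameter, then that of \<open>C w - h\<close> is lower semicontinuous; so if the integral of \<open>w\<close> is continuous,
  that of \<open>h\<close> is upper semicontinuous. The parameter \<open>p\<close> is a pair of a state and an action under
  (W), and an action under (S).
\<close>
lemma usc_integral:
  fixes g :: "'p::topological_space \<Rightarrow> 'x \<times> 'a"
  assumes g: "g \<in> E \<rightarrow> D" and h: "h \<in> weighted_ball C"
    and cont_w: "continuous_on E (\<lambda>p. \<integral>y. w y \<partial>Q (g p))"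
    and meas: "\<And>n::nat. \<phi> n \<in> borel_measurable (borel_on X)"
    and nonneg: "\<And>n x. x \<in> X \<Longrightarrow> 0 \<le> \<phi> n x"
    and le: "\<And>n x. x \<in> X \<Longrightarrow> \<phi> n x \<le> C * w x - h x"
    and lim: "\<And>x. x \<in> X \<Longrightarrow> (\<lambda>n. \<phi> n x) \<longlonglongrightarrow> C * w x - h x"
    and cont: "\<And>n. continuous_on E (\<lambda>p. \<integral>y. \<phi> n y \<partial>Q (g p))"
  shows "usc_on E (\<lambda>p. ereal (\<integral>y. h y \<partial>Q (g p)))"
  unfolding usc_on_ereal_iff
proof (intro ballI allI impI)
  define k where "k x = C * w x - h x" for x
  have int_w: "integrable (Q d) w" if "d \<in> D" for d
    using integrable_w[of "fst d" "snd d"] that by simp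
  have int_h: "integrable (Q d) h" if "d \<in> D" for d
    by (rule integrable_weighted[OF that h])
  have int_k: "integrable (Q d) k" if "d \<in> D" for d
    unfolding k_def using int_w[OF that] int_h[OF that] by simp
  have integral_k: "(\<integral>y. k y \<partial>Q d) = C * (\<integral>y. w y \<partial>Q d) - (\<integral>y. h y \<partial>Q d)" if "d \<in> D" for d
    unfolding k_def using int_w[OF that] int_h[OF that] by simp
  have bound: "AE y in Q d. norm (\<phi> n y) \<le> k y" if "d \<in> D" for n d
    using nonneg le by (intro AE_I2) (simp add: space_Q[OF that] k_def)
  have int_\<phi>: "integrable (Q d) (\<phi> n)" if "d \<in> D" for n d
    by (rule Bochner_Integration.integrable_bound[OF int_k[OF that] measurable_Q[OF that meas]])
      (use bound[OF that, of n] in eventually_elim, simp)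
  fix p and e :: real assume p: "p \<in> E" and e: "0 < e"
  have gp: "g p \<in> D" using g p by auto
  have "(\<lambda>n. \<integral>y. \<phi> n y \<partial>Q (g p)) \<longlonglongrightarrow> (\<integral>y. k y \<partial>Q (g p))"
    using lim by (intro integral_dominated_convergence[where w = k] measurable_Q[OF gp] meas
        borel_measurable_integrable int_k gp bound AE_I2) (simp add: space_Q[OF gp] k_def)
  then have "\<forall>\<^sub>F n in sequentially. (\<integral>y. k y \<partial>Q (g p)) - e / 3 < (\<integral>y. \<phi> n y \<partial>Q (g p))"
    using e by (intro order_tendstoD) auto
  then obtain n where n: "(\<integral>y. k y \<partial>Q (g p)) - e / 3 < (\<integral>y. \<phi> n y \<partial>Q (g p))"
    using eventually_happens'[OF sequentially_bot] by blast
  have 1: "\<forall>\<^sub>F q in at p within E. (\<integral>y. \<phi> n y \<partial>Q (g p)) - e / 3 < (\<integral>y. \<phi> n y \<partial>Q (g q))"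
    using cont[of n] p e unfolding continuous_on_def by (intro order_tendstoD(1)[where y = "\<integral>y. \<phi> n y \<partial>Q (g p)"]) auto
  have "((\<lambda>q. C * (\<integral>y. w y \<partial>Q (g q))) \<longlongrightarrow> C * (\<integral>y. w y \<partial>Q (g p))) (at p within E)"
    using cont_w p by (intro tendsto_mult_left) (simp add: continuous_on_def)
  then have 2: "\<forall>\<^sub>F q in at p within E. C * (\<integral>y. w y \<partial>Q (g q)) < C * (\<integral>y. w y \<partial>Q (g p)) + e / 3"
    using e by (intro order_tendstoD) auto
  have 3: "\<forall>\<^sub>F q in at p within E. q \<in> E"
    by (simp add: eventually_at_filter)
  show "\<forall>\<^sub>F q in at p within E. (\<integral>y. h y \<partial>Q (g q)) < (\<integral>y. h y \<partial>Q (g p)) + e"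
    using 1 2 3
  proof eventually_elim
    case (elim q)
    have gq: "g q \<in> D" using g elim by auto
    have "(\<integral>y. \<phi> n y \<partial>Q (g q)) \<le> (\<integral>y. k y \<partial>Q (g q))"
      using le by (intro integral_mono int_\<phi> int_k gq) (simp add: space_Q[OF gq] k_def)
    with elim n integral_k[OF gp] integral_k[OF gq] show ?case by linarith
  qed
qed

end

section \<open>Continuity assumptions and the optimality theorem\<close>

context weighted_mdp
begin

text \<open>
  Under (S) every nonnegative measurable function is approximated from below by simple functions,
  whose integrals are linear combinations of measures of sets.
\<close>
lemma regular_mdp_S:
  assumes S: "assumptions_S M"
  shows "regular_mdp M \<gamma> \<alpha> \<kappa> (\<lambda>_. True)"
proof unfold_locales
  note S = S[unfolded assumptions_S_def, rule_format]
  show compact: "compact (A x)" if "x \<in> X" for x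
    using S[OF that] by blast
  show "closed {a \<in> A x. c \<le> action_value v (x, a)}"
    if v: "v \<in> weighted_ball C" and x: "x \<in> X" for v C x c
  proof -
    have D: "Pair x \<in> A x \<rightarrow> D" by (auto simp: A_iff)
    have measure_cont: "continuous_on (A x) (\<lambda>a. measure (Q (x, a)) B)" if "B \<in> sets (borel_on X)" for B
      using S[OF x] that by blast
    define h where "h y = real_discount (v y)" for y
    have h: "h \<in> weighted_ball C"
      unfolding h_def by (rule real_discount_weighted_ball[OF v])
    define k where "k y = C * w y - h y" for y
    have k_nonneg: "0 \<le> k y" if "y \<in> X" for y
      using weighted_ballD(2)[OF h that] unfolding k_def by linarith
    have "(\<lambda>y. ennreal (k y)) \<in> borel_measurable (borel_on X)"
      unfolding k_def using w_measurable weighted_ballD(1)[OF h] by measurable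
    then obtain s where s: "\<And>n::nat. simple_function (borel_on X) (s n)" "incseq s"
      "\<And>n y. s n y < top" "\<And>y. (SUP n. s n y) = ennreal (k y)"
      using borel_measurable_implies_simple_function_sequence' by metis
    define \<phi> where "\<phi> n y = enn2real (s n y)" for n y
    have simple: "simple_function (borel_on X) (\<phi> n)" for n
      unfolding \<phi>_def by (rule simple_function_compose1[OF s(1)])
    have "usc_on (A x) (\<lambda>a. ereal (\<integral>y. h y \<partial>Q (x, a)))"
    proof (rule usc_integral[OF D h])
      show "continuous_on (A x) (\<lambda>a. \<integral>y. w y \<partial>Q (x, a))"
        using S[OF x] by (intro continuous_integral_w[OF _ D]) blast
      show "\<phi> n \<in> borel_measurable (borel_on X)" for n
        by (rule borel_measurable_simple_function[OF simple])
      show "0 \<le> \<phi> n y" for n y by (simp add: \<phi>_def)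
      show "\<phi> n y \<le> C * w y - h y" if "y \<in> X" for n y
      proof -
        have "s n y \<le> ennreal (k y)" unfolding s(4)[symmetric] by (rule SUP_upper) simp
        then have "enn2real (s n y) \<le> enn2real (ennreal (k y))" by (intro enn2real_mono) auto
        then show ?thesis using k_nonneg[OF that] by (simp add: \<phi>_def k_def)
      qed
      show "(\<lambda>n. \<phi> n y) \<longlonglongrightarrow> C * w y - h y" if "y \<in> X" for y
      proof -
        have "incseq (\<lambda>n. s n y)" using s(2) by (auto simp: incseq_def le_fun_def)
        from LIMSEQ_SUP[OF this] have "(\<lambda>n. s n y) \<longlonglongrightarrow> ennreal (k y)" unfolding s(4) .
        from tendsto_enn2real[OF this k_nonneg[OF that]] show ?thesis by (simp add: \<phi>_def k_def)
      qed
      show "continuous_on (A x) (\<lambda>a. \<integral>y. \<phi> n y \<partial>Q (x, a))" for n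
      proof -
        define R where "R = \<phi> n ` X"
        have "finite R" using simple_functionD(1)[OF simple] by (simp add: R_def space_X)
        have level: "\<phi> n -` {z} \<inter> X \<in> sets (borel_on X)" for z
          using simple_functionD(2)[OF simple, of n "{z}"] by (simp add: space_X)
        have "(\<integral>y. \<phi> n y \<partial>Q (x, a)) = (\<Sum>z\<in>R. z * measure (Q (x, a)) (\<phi> n -` {z} \<inter> X))"
          if a: "a \<in> A x" for a
        proof -
          have d: "(x, a) \<in> D" using a by (simp add: A_iff)
          interpret prob_space "Q (x, a)" by (rule prob_space_Q[OF d])
          have "(\<integral>y. \<phi> n y \<partial>Q (x, a)) = (\<integral>y. (\<Sum>z\<in>R. z * indicator (\<phi> n -` {z} \<inter> X) y) \<partial>Q (x, a))"
          proof (rule Bochner_Integration.integral_cong[OF refl])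
            fix y assume "y \<in> space (Q (x, a))"
            then have y: "y \<in> X" by (simp add: space_Q[OF d])
            have "(\<Sum>z\<in>R. z * indicator (\<phi> n -` {z} \<inter> X) y) = (\<Sum>z\<in>R. if \<phi> n y = z then z else 0)"
              using y by (intro sum.cong) (auto simp: indicator_def)
            also have "\<dots> = \<phi> n y" using \<open>finite R\<close> y by (simp add: R_def)
            finally show "\<phi> n y = (\<Sum>z\<in>R. z * indicator (\<phi> n -` {z} \<inter> X) y)" by simp
          qed
          also have "\<dots> = (\<Sum>z\<in>R. (\<integral>y. z * indicator (\<phi> n -` {z} \<inter> X) y \<partial>Q (x, a)))"
            using level by (intro Bochner_Integration.integral_sum integrable_mult_right)
              (simp add: sets_Q[OF d] integrable_indicator_iff emeasure_finite less_top[symmetric])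
          also have "\<dots> = (\<Sum>z\<in>R. z * measure (Q (x, a)) (\<phi> n -` {z} \<inter> X))"
            using level by (simp add: space_Q[OF d] Int_assoc)
          finally show ?thesis .
        qed
        moreover have "continuous_on (A x) (\<lambda>a. \<Sum>z\<in>R. z * measure (Q (x, a)) (\<phi> n -` {z} \<inter> X))"
          by (intro continuous_on_sum continuous_on_mult continuous_on_const measure_cont level)
        ultimately show ?thesis by (simp cong: continuous_on_cong)
      qed
    qed
    moreover have "usc_on (A x) (\<lambda>a. ereal (real_utility (x, a)))"
    proof -
      have "usc_on (A x) (\<lambda>a. utility M (x, a))" using S[OF x] by blast
      then show ?thesis
        by (rule usc_on_cong[THEN iffD1, rotated]) (simp add: ereal_real_utility A_iff)
    qed
    ultimately have "usc_on (A x) (\<lambda>a. ereal (action_value v (x, a)))"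
      unfolding action_value_def h_def by (intro usc_on_add)
    then show ?thesis by (rule usc_on_closed_superlevel[OF _ compact_imp_closed[OF compact[OF x]]])
  qed
qed auto

lemma usc_on_action_value_W:
  assumes W: "assumptions_W M" and v: "v \<in> weighted_ball C" "usc_on X (\<lambda>x. ereal (v x))"
  shows "usc_on D (\<lambda>d. ereal (action_value v d))"
proof -
  note W = W[unfolded assumptions_W_def]
  define h where "h y = real_discount (v y)" for y
  have h: "h \<in> weighted_ball C"
    unfolding h_def by (rule real_discount_weighted_ball[OF v(1)])
  have h_usc: "usc_on X (\<lambda>y. ereal (h y))"
    unfolding usc_on_ereal_iff
  proof (intro ballI allI impI)
    fix x and e :: real assume x: "x \<in> X" and e: "0 < e"
    then have "0 < e / 2" by simp
    from usc_onD[OF v(2) x this]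
    show "\<forall>\<^sub>F y in at x within X. h y < h x + e"
    proof eventually_elim
      case (elim y)
      have "h y \<le> real_discount (v x + e / 2)"
        unfolding h_def using elim by (intro real_discount_mono) simp
      also have "\<dots> \<le> h x + e / 2"
        using real_discount_lipschitz[of "v x + e / 2" "v x"] e unfolding h_def by linarith
      finally show ?case using e by linarith
    qed
  qed
  define k where "k y = C * w y - h y" for y
  have k_nonneg: "0 \<le> k y" if "y \<in> X" for y
    using weighted_ballD(2)[OF h that] unfolding k_def by linarith
  have "usc_on X (\<lambda>y. ereal (- C * w y))"
  proof -
    have "continuous_on X (\<lambda>y. - C * w y)" using W by (intro continuous_intros) blast
    then have "((\<lambda>y. - C * w y) \<longlongrightarrow> - C * w x) (at x within X)" if "x \<in> X" for x
      using that by (simp add: continuous_on_def)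
    then show ?thesis
      unfolding usc_on_ereal_iff by (intro ballI allI impI order_tendstoD) auto
  qed
  from usc_on_add[OF this h_usc] have "usc_on X (\<lambda>y. ereal (- k y))"
    by (simp add: k_def)
  from lsc_lipschitz_approximation[OF k_nonneg this X_nonempty]
  obtain \<phi> where \<phi>: "\<And>n::nat. continuous_on UNIV (\<phi> n)"
    "\<And>n y. y \<in> X \<Longrightarrow> 0 \<le> \<phi> n y" "\<And>n y. y \<in> X \<Longrightarrow> \<phi> n y \<le> real n"
    "\<And>n y. y \<in> X \<Longrightarrow> \<phi> n y \<le> k y" "\<And>y. y \<in> X \<Longrightarrow> (\<lambda>n. \<phi> n y) \<longlonglongrightarrow> k y"
    by blast
  have "usc_on D (\<lambda>d. ereal (\<integral>y. h y \<partial>Q (id d)))"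
  proof (rule usc_integral[OF _ h])
    show "continuous_on D (\<lambda>d. \<integral>y. w y \<partial>Q (id d))"
      using W by (intro continuous_integral_w) auto
    show "\<phi> n \<in> borel_measurable (borel_on X)" for n
      by (intro measurable_restrict_space1 borel_measurable_continuous_onI \<phi>)
    show "continuous_on D (\<lambda>d. \<integral>y. \<phi> n y \<partial>Q (id d))" for n
    proof -
      have "bounded (\<phi> n ` X)"
        using \<phi>(2,3) by (intro boundedI[of _ "real n"]) auto
      moreover have "continuous_on X (\<phi> n)" by (rule continuous_on_subset[OF \<phi>(1)]) simp
      ultimately show ?thesis using W by simp
    qed
  qed (use \<phi> in \<open>auto simp: k_def\<close>)
  moreover have "usc_on D (\<lambda>d. ereal (real_utility d))"
  proof -
    have "usc_on D (utility M)" using W by blast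
    then show ?thesis
      by (rule usc_on_cong[THEN iffD1, rotated]) (auto simp: ereal_real_utility)
  qed
  ultimately show ?thesis
    unfolding action_value_def h_def id_def by (intro usc_on_add)
qed

text \<open>
  Let \<open>s n\<close> be states that converge to \<open>x\<close>, and \<open>a n\<close> actions at \<open>s n\<close> of value at least \<open>c\<close>. By the upper
  semicontinuity and compactness of the sets of admissible actions, the sequence \<open>a\<close> has a cluster
  point \<open>b\<close> admissible at \<open>x\<close>, and the value of \<open>b\<close> is at least \<open>c\<close>.
\<close>
lemma usc_on_real_bellman_W:
  assumes W: "assumptions_W M" and v: "v \<in> weighted_ball C"
    and usc: "usc_on D (\<lambda>d. ereal (action_value v d))"
  shows "usc_on X (\<lambda>x. ereal (real_bellman v x))"
  unfolding usc_on_iff_closedin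
proof
  note W = W[unfolded assumptions_W_def]
  fix c
  let ?S = "{x \<in> X. c \<le> real_bellman v x}"
  have compact: "compact (A x)" if "x \<in> X" for x using W that by blast
  have attained: "\<exists>a. (x, a) \<in> D \<and> c \<le> action_value v (x, a)" if x: "x \<in> ?S" for x
  proof -
    have "continuous_on (A x) (Pair x)" by (intro continuous_intros)
    then have "usc_on (A x) (\<lambda>a. ereal (action_value v (x, a)))"
      by (rule usc_on_compose[OF usc]) (auto simp: A_iff)
    then have "closed {a \<in> A x. c' \<le> action_value v (x, a)}" for c'
      using x by (intro usc_on_closed_superlevel compact_imp_closed compact) auto
    moreover have X: "x \<in> X" using x by simp
    ultimately obtain a where "a \<in> A x" "\<forall>b\<in>A x. action_value v (x, b) \<le> action_value v (x, a)"
      using usc_attains_max[OF compact[OF X] A_nonempty[OF X], of "\<lambda>a. action_value v (x, a)"] by blast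
    moreover from this have "real_bellman v x \<le> action_value v (x, a)"
      using x by (intro real_bellman_le) (auto simp: A_iff)
    ultimately show ?thesis using x A_iff by auto
  qed
  have "x \<in> ?S" if x: "x \<in> X" and closure: "x \<in> closure ?S" for x
  proof -
    obtain s where s: "\<And>n::nat. s n \<in> ?S" "s \<longlonglongrightarrow> x"
      using closure unfolding closure_sequential by blast
    obtain a where a: "\<And>n. (s n, a n) \<in> D" "\<And>n. c \<le> action_value v (s n, a n)"
      using attained[OF s(1)] by metis
    have tail: "A x \<inter> closure (a ` {N..}) \<noteq> {}" for N
    proof -
      let ?K = "actions M \<inter> closure (a ` {N..})"
      have "closedin (top_of_set (actions M)) ?K" by (rule closedin_closed_Int) simp
      then have "closedin (top_of_set X) {x \<in> X. A x \<inter> ?K \<noteq> {}}" using W by blast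
      then obtain T where T: "closed T" "{x \<in> X. A x \<inter> ?K \<noteq> {}} = X \<inter> T"
        unfolding closedin_closed by blast
      have "s (n + N) \<in> T" for n
      proof -
        have "a (n + N) \<in> A (s (n + N)) \<inter> ?K"
          using a(1)[of "n + N"] D_subset closure_subset[of "a ` {N..}"] by (auto simp: A_iff)
        moreover have "s (n + N) \<in> X" using s(1) by blast
        ultimately have "s (n + N) \<in> {x \<in> X. A x \<inter> ?K \<noteq> {}}" by blast
        then show ?thesis unfolding T(2) by blast
      qed
      then have "x \<in> T"
        by (rule closed_sequentially[OF T(1) _ LIMSEQ_ignore_initial_segment[OF s(2)]])
      then have "x \<in> {x \<in> X. A x \<inter> ?K \<noteq> {}}" using x unfolding T(2) by blast
      then show ?thesis by blast
    qed
    have "A x \<inter> (\<Inter>N\<in>UNIV. closure (a ` {N..})) \<noteq> {}"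
    proof (rule compact_imp_fip_image[OF compact[OF x]])
      fix I :: "nat set" assume I: "finite I"
      obtain N where N: "\<forall>n\<in>I. n \<le> N" using finite_nat_set_iff_bounded_le I by blast
      have "closure (a ` {N..}) \<subseteq> closure (a ` {n..})" if "n \<in> I" for n
        using that N by (intro closure_mono image_mono) auto
      with tail[of N] show "A x \<inter> (\<Inter>n\<in>I. closure (a ` {n..})) \<noteq> {}" by blast
    qed simp
    then obtain b where "b \<in> A x" "b \<in> (\<Inter>N\<in>UNIV. closure (a ` {N..}))" by blast
    then have b: "(x, b) \<in> D" "\<And>N. b \<in> closure (a ` {N..})"
      by (simp_all add: A_iff)
    have "c \<le> action_value v (x, b)"
    proof (rule ccontr)
      assume less: "\<not> ?thesis"
      have "closedin (top_of_set D) {d \<in> D. c \<le> action_value v d}"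
        using usc unfolding usc_on_iff_closedin by blast
      then obtain T where T: "closed T" "{d \<in> D. c \<le> action_value v d} = D \<inter> T"
        unfolding closedin_closed by blast
      have "(x, b) \<in> - T" using b(1) less T(2) by blast
      then obtain U V where UV: "open U" "open V" "x \<in> U" "b \<in> V" "U \<times> V \<subseteq> - T"
        using open_prod_elim[OF open_Compl[OF T(1)]] by (metis mem_Sigma_iff)
      obtain N where N: "\<And>n. N \<le> n \<Longrightarrow> s n \<in> U"
        using topological_tendstoD[OF s(2) UV(1,3)] unfolding eventually_sequentially by blast
      obtain n where n: "N \<le> n" "a n \<in> V"
        using b(2)[of N] UV(4) open_Int_closure_eq_empty[OF UV(2), of "a ` {N..}"] by auto
      have "(s n, a n) \<in> {d \<in> D. c \<le> action_value v d}" using a by blast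
      then have "(s n, a n) \<in> T" unfolding T(2) by blast
      with N[OF n(1)] n(2) UV(5) show False by blast
    qed
    then show ?thesis using le_real_bellman[OF b(1) v] x by simp
  qed
  then have "?S = X \<inter> closure ?S" using closure_subset[of ?S] by blast
  then show "closedin (top_of_set X) ?S"
    unfolding closedin_closed by (intro exI[of _ "closure ?S"] conjI closed_closure)
qed

lemma regular_mdp_W:
  assumes W: "assumptions_W M"
  shows "regular_mdp M \<gamma> \<alpha> \<kappa> (\<lambda>v. usc_on X (\<lambda>x. ereal (v x)))"
proof unfold_locales
  show compact: "compact (A x)" if "x \<in> X" for x
    using W that by (simp add: assumptions_W_def)
  show "usc_on X (\<lambda>x. ereal 0)"
    by (simp add: usc_on_ereal_iff)
  show "closed {a \<in> A x. c \<le> action_value v (x, a)}"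
    if "v \<in> weighted_ball C" "usc_on X (\<lambda>x. ereal (v x))" "x \<in> X" for v C x c
  proof (rule usc_on_closed_superlevel[OF _ compact_imp_closed[OF compact[OF that(3)]]])
    show "usc_on (A x) (\<lambda>a. ereal (action_value v (x, a)))"
      by (rule usc_on_compose[OF usc_on_action_value_W[OF W that(1,2)]])
        (auto simp: A_iff intro!: continuous_intros)
  qed
  show "usc_on X (\<lambda>x. ereal (real_bellman v x))"
    if v: "v \<in> weighted_ball C" "usc_on X (\<lambda>x. ereal (v x))" for v C
    by (rule usc_on_real_bellman_W[OF W v(1) usc_on_action_value_W[OF W v]])
  show "usc_on X (\<lambda>x. ereal (v' x))"
    if good: "\<And>n::nat. usc_on X (\<lambda>x. ereal (u n x))"
      and close: "\<And>n x. x \<in> X \<Longrightarrow> \<bar>u n x - v' x\<bar> \<le> e n * w x" and e: "e \<longlonglongrightarrow> 0" for u v' e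
    unfolding usc_on_ereal_iff
  proof (intro ballI allI impI)
    fix x and r :: real assume x: "x \<in> X" and r: "0 < r"
    have "((\<lambda>n. e n * (w x + 1)) \<longlongrightarrow> 0) sequentially" "((\<lambda>n. e n * w x) \<longlongrightarrow> 0) sequentially"
      by (intro tendsto_mult_left_zero e)+
    then have "\<forall>\<^sub>F n in sequentially. e n * (w x + 1) < r / 3" "\<forall>\<^sub>F n in sequentially. e n * w x < r / 3"
      using r by (auto intro!: order_tendstoD(2))
    then have "\<forall>\<^sub>F n in sequentially. e n * (w x + 1) < r / 3 \<and> e n * w x < r / 3"
      by eventually_elim simp
    then obtain n where n: "e n * (w x + 1) < r / 3" "e n * w x < r / 3"
      using eventually_happens'[OF sequentially_bot] by blast
    have "0 \<le> e n * w x" using close[OF x, of n] by linarith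
    then have "0 \<le> e n" using w_pos[OF x] by (simp add: zero_le_mult_iff)
    have 1: "\<forall>\<^sub>F y in at x within X. u n y < u n x + r / 3"
      using r by (intro usc_onD[OF good x]) simp
    have "continuous_on X w" using W by (simp add: assumptions_W_def)
    then have 2: "\<forall>\<^sub>F y in at x within X. w y < w x + 1"
      using x unfolding continuous_on_def by (intro order_tendstoD(2)) auto
    have 3: "\<forall>\<^sub>F y in at x within X. y \<in> X"
      by (simp add: eventually_at_filter)
    show "\<forall>\<^sub>F y in at x within X. v' y < v' x + r"
      using 1 2 3
    proof eventually_elim
      case (elim y)
      have "e n * w y \<le> e n * (w x + 1)" using elim \<open>0 \<le> e n\<close> by (intro mult_left_mono) auto
      then show ?case
        using close[OF elim(3), of n] close[OF x, of n] elim(1) n by linarith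
    qed
  qed
qed

end

lemma weighted_mdp_exists:
  fixes M :: "('x::polish_space, 'a::polish_space) mdp"
  assumes mdp: "markov_decision_process M" and A: "assumptions_A M" and B: "assumptions_B M"
  shows "\<exists>\<gamma> \<alpha> \<kappa>. weighted_mdp M \<gamma> \<alpha> \<kappa>"
proof -
  obtain b c where bc: "0 < b" "0 < c"
    "\<And>x a. (x, a) \<in> constr M \<Longrightarrow> ereal (- b * weight M x) \<le> utility M (x, a)"
    "\<And>x a. (x, a) \<in> constr M \<Longrightarrow> utility M (x, a) \<le> ereal (c * weight M x)"
    using A unfolding assumptions_A_def by blast
  obtain \<gamma> :: "real \<Rightarrow> real" and \<alpha> :: real where
    \<gamma>: "\<gamma> \<in> {0..} \<rightarrow> {0..}" "mono_on {0..} \<gamma>" "\<forall>z>0. \<gamma> z < z"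
    "\<forall>z1 z2 :: real. \<bar>discount M (ereal z1) - discount M (ereal z2)\<bar> \<le> ereal (\<gamma> \<bar>z1 - z2\<bar>)"
    "mono_on {..<\<infinity>} (discount M)" "discount M 0 = 0"
    "\<forall>y\<ge>0. \<forall>z\<ge>0. \<gamma> (y + z) \<le> \<gamma> y + \<gamma> z"
    "\<forall>x\<in>states M. \<forall>y>0. \<gamma> (weight M x * y) \<le> weight M x * \<gamma> y"
    and \<alpha>: "\<forall>(x, a)\<in>constr M.
           (\<integral>\<^sup>+ y. ennreal (weight M y) \<partial>kernel M (x, a)) \<le> ennreal (\<alpha> * weight M x)"
    "\<alpha> \<le> 1 \<or> \<alpha> > 1 \<and> (\<forall>z>0. \<alpha> * \<gamma> z < z)"
    using B unfolding assumptions_B_def by blast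
  have w: "1 \<le> weight M x" if "(x, a) \<in> constr M" for x a
    using mdp that unfolding markov_decision_process_def by blast
  have "weighted_mdp M \<gamma> \<alpha> (max b c)"
  proof
    show "markov_decision_process M" by fact
    show "\<bar>utility M (x, a)\<bar> \<le> ereal (max b c * weight M x)" if d: "(x, a) \<in> constr M" for x a
    proof -
      have "b * weight M x \<le> max b c * weight M x" "c * weight M x \<le> max b c * weight M x"
        using w[OF d] by (auto intro!: mult_right_mono)
      then show ?thesis
        using bc(3,4)[OF d] by (cases "utility M (x, a)") (auto simp: abs_le_iff)
    qed
    show "max 1 \<alpha> * \<gamma> z < z" if "0 < z" for z
      using \<alpha>(2) \<gamma>(3) that by (auto simp: max_def)
    show "discount M (ereal y) \<le> discount M (ereal z)" if "y \<le> z" for y z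
      using that by (intro mono_onD[OF \<gamma>(5)]) auto
  qed (use \<gamma> \<alpha>(1) in \<open>auto intro: mono_onD\<close>)
  then show ?thesis by blast
qed

theorem theorem5p1:
  fixes M :: "('x::polish_space, 'a::polish_space) mdp"
  assumes "markov_decision_process M"
    and "assumptions_A M"
    and "assumptions_B M"
  shows "(assumptions_W M \<longrightarrow> (\<exists>v.
            solves_bellman M v \<and>
            (\<forall>w. solves_bellman M w \<longrightarrow> (\<forall>x\<in>states M. w x = v x)) \<and>
            (\<lambda>m. weighted_norm M (\<lambda>x. (bellman_op M ^^ m) (\<lambda>_. 0) x - v x)) \<longlonglongrightarrow> 0 \<and>
            (\<forall>x\<in>states M. v x = (SUP \<pi>\<in>policies M. recursive_utility M x \<pi>)) \<and>
            (\<exists>f\<in>decision_rules M. (\<forall>x\<in>states M. decision_op M f v x = v x) \<and>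
               optimal_policy M (stationary f)) \<and>
            v \<in> weighted_bounded M \<inter> usc_funs (states M)))
       \<and> (assumptions_S M \<longrightarrow> (\<exists>v.
            solves_bellman M v \<and>
            (\<forall>w. solves_bellman M w \<longrightarrow> (\<forall>x\<in>states M. w x = v x)) \<and>
            (\<lambda>m. weighted_norm M (\<lambda>x. (bellman_op M ^^ m) (\<lambda>_. 0) x - v x)) \<longlonglongrightarrow> 0 \<and>
            (\<forall>x\<in>states M. v x = (SUP \<pi>\<in>policies M. recursive_utility M x \<pi>)) \<and>
            (\<exists>f\<in>decision_rules M. (\<forall>x\<in>states M. decision_op M f v x = v x) \<and>
               optimal_policy M (stationary f))))"
proof -
  obtain \<gamma> \<alpha> \<kappa> where "weighted_mdp M \<gamma> \<alpha> \<kappa>"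
    using weighted_mdp_exists[OF assms] by blast
  then interpret weighted_mdp M \<gamma> \<alpha> \<kappa> .
  show ?thesis
  proof (intro conjI impI)
    assume W: "assumptions_W M"
    interpret regular_mdp M \<gamma> \<alpha> \<kappa> "\<lambda>v. usc_on X (\<lambda>x. ereal (v x))"
      by (rule regular_mdp_W[OF W])
    have "(\<lambda>x. ereal (value_fun x)) \<in> weighted_bounded M \<inter> usc_funs X"
      using bellman_solution(1) value_fun(2) by (simp add: solves_bellman_def usc_funs_def)
    then show "\<exists>v. solves_bellman M v \<and>
            (\<forall>w. solves_bellman M w \<longrightarrow> (\<forall>x\<in>states M. w x = v x)) \<and>
            (\<lambda>m. weighted_norm M (\<lambda>x. (bellman_op M ^^ m) (\<lambda>_. 0) x - v x)) \<longlonglongrightarrow> 0 \<and>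
            (\<forall>x\<in>states M. v x = (SUP \<pi>\<in>policies M. recursive_utility M x \<pi>)) \<and>
            (\<exists>f\<in>decision_rules M. (\<forall>x\<in>states M. decision_op M f v x = v x) \<and>
               optimal_policy M (stationary f)) \<and>
            v \<in> weighted_bounded M \<inter> usc_funs (states M)"
      using bellman_solution by (intro exI[of _ "\<lambda>x. ereal (value_fun x)"] conjI ballI allI impI)
  next
    assume S: "assumptions_S M"
    interpret regular_mdp M \<gamma> \<alpha> \<kappa> "\<lambda>_. True"
      by (rule regular_mdp_S[OF S])
    show "\<exists>v. solves_bellman M v \<and>
            (\<forall>w. solves_bellman M w \<longrightarrow> (\<forall>x\<in>states M. w x = v x)) \<and>
            (\<lambda>m. weighted_norm M (\<lambda>x. (bellman_op M ^^ m) (\<lambda>_. 0) x - v x)) \<longlonglongrightarrow> 0 \<and>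
            (\<forall>x\<in>states M. v x = (SUP \<pi>\<in>policies M. recursive_utility M x \<pi>)) \<and>
            (\<exists>f\<in>decision_rules M. (\<forall>x\<in>states M. decision_op M f v x = v x) \<and>
               optimal_policy M (stationary f))"
      using bellman_solution by (intro exI[of _ "\<lambda>x. ereal (value_fun x)"] conjI ballI allI impI)
  qed
qed

end
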